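(* Let $(M,\mathcal{F})$ be any $\mathcal{C}^\infty$ foliated manifold. Let $E_1^{p,q}=E_1^{p,q}(M)$ be the first term of the de Rham spectral sequence of $(M,\mathcal{F})$ and let $E_1^{\bullet,>0}=\bigoplus_{p\geq 0,\,q>0}E_1^{p,q}$ be the subalgebra of $E_1$ of cohomology classes with positive tangential degree. Then the tangential Lusternik--Schnirelmann category of $(M,\mathcal{F})$ is bounded below by the length of the cup product $\mathrm{l.c.p.}\,E_1^{\bullet,>0}$ in $E_1^{\bullet,>0}$.
   Context: All foliations, maps and homotopies are $\mathcal{C}^\infty$, and cohomology has real coefficients. Tangential LS category: an open set $U\subset M$, endowed with the induced foliation $\mathcal{F}_U$, is tangentially categorical if it deforms to a transversal along the leaves, that is, if there is a $\mathcal{C}^\infty$ homotopy $H\colon U\times\mathbb{R}\to M$ such that $H_0$ is the inclusion $U\subset M$, for every leaf $L'$ of $\mathcal{F}_U$ the image $H(L'\times\mathbb{R})$ is contained in a single leaf of $\mathcal{F}$ (an integrable homotopy), and $H_1$ is constant on each leaf of $\mathcal{F}_U$. The tangential LS category of $(M,\mathcal{F})$ is the least integer $k\ge 0$ such that $M$ can be covered by $k+1$ tangentially categorical open sets (and $\infty$ if there is no such covering). Spectral sequence: let $\Omega^r=\Omega^r(M)$ be the space of differential $r$-forms. For $0\le p\le r$ let $F^p\Omega^r$ be the space of $\omega\in\Omega^r$ such that $i_{X_0}\cdots i_{X_{r-p}}\omega=0$ whenever the vector fields $X_0,\dots,X_{r-p}$ are tangent to $\mathcal{F}$; put $F^p\Omega^r=0$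 for $p>r$. Put $E_0^{p,q}=F^p\Omega^{p+q}/F^{p+1}\Omega^{p+q}$, for $0\le p\le \operatorname{codim}\mathcal{F}$, $0\le q\le\dim\mathcal{F}$. The exterior differential induces $d_0\colon E_0^{p,q}\to E_0^{p,q+1}$, with cohomology groups $E_1^{p,q}=H^q(E_0^{p,\bullet},d_0)$. The exterior product of forms induces a bigraded (cup) product on $E_1$. The index $q$ is called the tangential degree. Length of the cup product: for an algebra $A$, $\mathrm{l.c.p.}\,A$ is the maximum $k\ge 0$ for which there are $a_1,\dots,a_k\in A$ with $a_1\cdots a_k\neq 0$ ($k=0$ if there is no nonzero product of this kind, i.e. $A=0$). *)

theory Defs
  imports
    "HOL-Analysis.Analysis"
    "HOL-Algebra.Product_Groups"
    "HOL-Algebra.FiniteProduct"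
    "HOL-Combinatorics.Permutations"
    "HOL-Library.Extended_Nat"
begin

section \<open>Smooth maps between open subsets of normed spaces\<close>

text \<open>To be used on open sets of finite-dimensional spaces only: there, f is k times
  continuously differentiable iff it is differentiable and all its directional derivatives
  are k - 1 times continuously differentiable.\<close>

primrec Ck_on :: "nat \<Rightarrow> 'a::real_normed_vector set \<Rightarrow> ('a \<Rightarrow> 'b::real_normed_vector) \<Rightarrow> bool"
  where
    "Ck_on 0 S f \<longleftrightarrow> continuous_on S f"
  | "Ck_on (Suc k) S f \<longleftrightarrow> (\<forall>x\<in>S. f differentiable (at x)) \<and>
       (\<forall>v. Ck_on k S (\<lambda>x. frechet_derivative f (at x) v))"

definition smooth_on :: "'a::real_normed_vector set \<Rightarrow> ('a \<Rightarrow> 'b::real_normed_vector) \<Rightarrow> bool"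
  where "smooth_on S f \<longleftrightarrow> (\<forall>k. Ck_on k S f)"


section \<open>Atlases\<close>

text \<open>The model space of a manifold will be a type 'e of sort real_inner and heine_borel, i.e. a
  finite-dimensional Euclidean vector space. Unlike euclidean_space, this sort does not exclude
  dimension 0.\<close>

lemma finite_dim_heine_borel: "\<exists>B. finite B \<and> span B = (UNIV :: 'e::{real_inner, heine_borel} set)"
proof -
  have cpt: "compact (cball (0::'e) 1)"
    by (simp add: compact_eq_bounded_closed)
  have cover: "cball (0::'e) 1 \<subseteq> (\<Union>b\<in>UNIV. ball b (1/2))"
  proof
    fix x :: 'e
    have "x \<in> ball x (1/2)" by simp
    then show "x \<in> (\<Union>b\<in>UNIV. ball b (1/2))" by blast
  qed
  obtain F where "F \<subseteq> UNIV" and F: "finite F" "cball (0::'e) 1 \<subseteq> (\<Union>b\<in>F. ball b (1/2))"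
    by (rule compactE_image[OF cpt open_ball cover])
  obtain C where C: "finite C" "span C = span F" "pairwise orthogonal C"
    using basis_orthogonal[OF F(1)] by blast
  have "x \<in> span C" for x
  proof (rule ccontr)
    assume x: "x \<notin> span C"
    define y where "y = x - (\<Sum>c\<in>C. (x \<bullet> c / (c \<bullet> c)) *\<^sub>R c)"
    have "(\<Sum>c\<in>C. (x \<bullet> c / (c \<bullet> c)) *\<^sub>R c) \<in> span C"
      by (intro span_sum span_scale span_base)
    then have "y \<noteq> 0"
      using x by (auto simp: y_def)
    have "y \<bullet> c = 0" if c: "c \<in> C" for c
    proof -
      have "(\<Sum>b\<in>C. (x \<bullet> b / (b \<bullet> b)) * (b \<bullet> c)) = (\<Sum>b\<in>C. if b = c then x \<bullet> c else 0)"
        using C(3) c by (intro sum.cong) (auto simp: pairwise_def orthogonal_def)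
      also have "\<dots> = x \<bullet> c"
        using C(1) c by simp
      finally show ?thesis
        by (simp add: y_def inner_diff_left inner_sum_left)
    qed
    then have orth: "y \<bullet> b = 0" if "b \<in> F" for b
      using orthogonal_to_span[of b C y] that C(2) by (auto simp: orthogonal_def span_base)
    define z where "z = y /\<^sub>R norm y"
    have z: "norm z = 1"
      using \<open>y \<noteq> 0\<close> by (simp add: z_def)
    then obtain b where b: "b \<in> F" "dist b z < 1/2"
      using F(2) by (force simp: subset_iff)
    have "z \<bullet> b = 0"
      using orth[OF b(1)] by (simp add: z_def)
    then have "(norm (z - b))\<^sup>2 = (norm z)\<^sup>2 + (norm b)\<^sup>2"
      by (simp add: power2_norm_eq_inner inner_diff inner_commute)
    then have "1 \<le> (norm (z - b))\<^sup>2"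
      using z by simp
    moreover have "(norm (z - b))\<^sup>2 < 1\<^sup>2"
      using b(2) by (intro power_strict_mono) (auto simp: dist_norm norm_minus_commute)
    ultimately show False by simp
  qed
  then show ?thesis
    using C(1) by blast
qed

type_synonym ('m, 'e) chart = "'m set \<times> ('m \<Rightarrow> 'e)"

abbreviation chart_dom :: "('m, 'e) chart \<Rightarrow> 'm set"
  where "chart_dom c \<equiv> fst c"

abbreviation chart_map :: "('m, 'e) chart \<Rightarrow> 'm \<Rightarrow> 'e"
  where "chart_map c \<equiv> snd c"

definition chart_inv :: "('m, 'e) chart \<Rightarrow> 'e \<Rightarrow> 'm"
  where "chart_inv c = inv_into (chart_dom c) (chart_map c)"

definition transition :: "('m, 'e) chart \<Rightarrow> ('m, 'e) chart \<Rightarrow> 'e \<Rightarrow> 'e"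
  where "transition c d = chart_map d \<circ> chart_inv c"

definition manifold_set :: "('m, 'e) chart set \<Rightarrow> 'm set"
  where "manifold_set A = (\<Union>c\<in>A. chart_dom c)"

definition smooth_atlas :: "('m::topological_space, 'e::real_normed_vector) chart set \<Rightarrow> bool"
  where "smooth_atlas A \<longleftrightarrow>
    (\<forall>c\<in>A. open (chart_dom c) \<and> open (chart_map c ` chart_dom c) \<and>
       homeomorphism (chart_dom c) (chart_map c ` chart_dom c) (chart_map c) (chart_inv c)) \<and>
    (\<forall>c\<in>A. \<forall>d\<in>A. smooth_on (chart_map c ` (chart_dom c \<inter> chart_dom d)) (transition c d))"

text \<open>A foliated atlas: the leaves are modelled on the affine subspaces parallel to V, so that
  dim V is the dimension of the foliation. The last condition says that, locally, the class of
  transition c d u modulo V depends only on the class of u modulo V. In coordinates (x,y) with x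
  in V and y in a complement of V, the transition maps are locally of the form
  (x,y) to (g(x,y), h(y)).\<close>

definition foliated_atlas ::
    "('m::topological_space, 'e::real_normed_vector) chart set \<Rightarrow> 'e set \<Rightarrow> bool"
  where "foliated_atlas A V \<longleftrightarrow> smooth_atlas A \<and> subspace V \<and>
    (\<forall>c\<in>A. \<forall>d\<in>A. \<forall>p \<in> chart_map c ` (chart_dom c \<inter> chart_dom d).
       \<exists>W. open W \<and> p \<in> W \<and> W \<subseteq> chart_map c ` (chart_dom c \<inter> chart_dom d) \<and>
         (\<forall>u\<in>W. \<forall>w\<in>W. u - w \<in> V \<longrightarrow> transition c d u - transition c d w \<in> V))"

definition restrict_atlas :: "('m, 'e) chart set \<Rightarrow> 'm set \<Rightarrow> ('m, 'e) chart set"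
  where "restrict_atlas A U = (\<lambda>c. (chart_dom c \<inter> U, chart_map c)) ` A"

definition times_line :: "('m, 'e) chart set \<Rightarrow> ('m \<times> real, 'e \<times> real) chart set"
  where "times_line A = (\<lambda>c. (chart_dom c \<times> UNIV, map_prod (chart_map c) id)) ` A"

definition smooth_map :: "('m::topological_space, 'e::real_normed_vector) chart set \<Rightarrow>
    ('n::topological_space, 'f::real_normed_vector) chart set \<Rightarrow> ('m \<Rightarrow> 'n) \<Rightarrow> bool"
  where "smooth_map A B f \<longleftrightarrow>
    f ` manifold_set A \<subseteq> manifold_set B \<and> continuous_on (manifold_set A) f \<and>
    (\<forall>c\<in>A. \<forall>d\<in>B. smooth_on (chart_map c ` (chart_dom c \<inter> f -` chart_dom d))
       (chart_map d \<circ> f \<circ> chart_inv c))"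


section \<open>Leaves and tangential category\<close>

definition same_plaque ::
    "('m, 'e::real_normed_vector) chart set \<Rightarrow> 'e set \<Rightarrow> 'm \<Rightarrow> 'm \<Rightarrow> bool"
  where "same_plaque A V x y \<longleftrightarrow>
    (\<exists>c\<in>A. x \<in> chart_dom c \<and> y \<in> chart_dom c \<and>
       connected_component (chart_map c ` chart_dom c \<inter> (+) (chart_map c x) ` V)
         (chart_map c x) (chart_map c y))"

definition leaves :: "('m, 'e::real_normed_vector) chart set \<Rightarrow> 'e set \<Rightarrow> 'm set set"
  where "leaves A V = {{y. (same_plaque A V)\<^sup>*\<^sup>* x y} | x. x \<in> manifold_set A}"

definition tangentially_categorical ::
    "('m::topological_space, 'e::real_normed_vector) chart set \<Rightarrow> 'e set \<Rightarrow> 'm set \<Rightarrow> bool"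
  where "tangentially_categorical A V U \<longleftrightarrow>
    open U \<and> U \<subseteq> manifold_set A \<and>
    (\<exists>H :: 'm \<times> real \<Rightarrow> 'm.
       smooth_map (times_line (restrict_atlas A U)) A H \<and>
       (\<forall>x\<in>U. H (x, 0) = x) \<and>
       (\<forall>L' \<in> leaves (restrict_atlas A U) V. \<exists>L \<in> leaves A V. H ` (L' \<times> UNIV) \<subseteq> L) \<and>
       (\<forall>L' \<in> leaves (restrict_atlas A U) V. \<exists>z. \<forall>x\<in>L'. H (x, 1) = z))"

definition tangential_cat ::
    "('m::topological_space, 'e::real_normed_vector) chart set \<Rightarrow> 'e set \<Rightarrow> enat"
  where "tangential_cat A V = (INF k \<in> {k. \<exists>U :: nat \<Rightarrow> 'm set.
     (\<forall>i\<le>k. tangentially_categorical A V (U i)) \<and> (\<Union>i\<le>k. U i) = manifold_set A}. enat k)"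


section \<open>Vector fields and differential forms\<close>

text \<open>Tangent vectors at x are represented by their coordinates in each chart around x. Vector
  fields and forms are set to 0 outside the chart domains, so that equality of two of them is
  equality of functions. An r-form takes its arguments from the first r terms of a sequence
  of vectors.\<close>

type_synonym ('m, 'e) vfield = "('m, 'e) chart \<Rightarrow> 'm \<Rightarrow> 'e"
type_synonym ('m, 'e) form = "('m, 'e) chart \<Rightarrow> 'm \<Rightarrow> (nat \<Rightarrow> 'e) \<Rightarrow> real"

definition D_transition :: "('m, 'e::real_normed_vector) chart \<Rightarrow> ('m, 'e) chart \<Rightarrow> 'm \<Rightarrow> 'e \<Rightarrow> 'e"
  where "D_transition c d x = frechet_derivative (transition c d) (at (chart_map c x))"

definition vector_fields :: "('m, 'e::real_normed_vector) chart set \<Rightarrow> ('m, 'e) vfield set"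
  where "vector_fields A = {X.
    (\<forall>c x. \<not> (c \<in> A \<and> x \<in> chart_dom c) \<longrightarrow> X c x = 0) \<and>
    (\<forall>c\<in>A. \<forall>d\<in>A. \<forall>x \<in> chart_dom c \<inter> chart_dom d. X d x = D_transition c d x (X c x)) \<and>
    (\<forall>c\<in>A. smooth_on (chart_map c ` chart_dom c) (\<lambda>u. X c (chart_inv c u)))}"

definition tangent_fields ::
    "('m, 'e::real_normed_vector) chart set \<Rightarrow> 'e set \<Rightarrow> ('m, 'e) vfield set"
  where "tangent_fields A V = {X \<in> vector_fields A. \<forall>c\<in>A. \<forall>x \<in> chart_dom c. X c x \<in> V}"

definition alternating :: "nat \<Rightarrow> ((nat \<Rightarrow> 'e::real_vector) \<Rightarrow> real) \<Rightarrow> bool"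
  where "alternating r a \<longleftrightarrow>
    (\<forall>v w. (\<forall>i<r. v i = w i) \<longrightarrow> a v = a w) \<and>
    (\<forall>i<r. \<forall>v. linear (\<lambda>x. a (v(i := x)))) \<and>
    (\<forall>i<r. \<forall>j<r. \<forall>v. i \<noteq> j \<and> v i = v j \<longrightarrow> a v = 0)"

definition forms :: "('m, 'e::real_normed_vector) chart set \<Rightarrow> nat \<Rightarrow> ('m, 'e) form set"
  where "forms A r = {\<omega>.
    (\<forall>c x v. \<not> (c \<in> A \<and> x \<in> chart_dom c) \<longrightarrow> \<omega> c x v = 0) \<and>
    (\<forall>c\<in>A. \<forall>x \<in> chart_dom c. alternating r (\<omega> c x)) \<and>
    (\<forall>c\<in>A. \<forall>d\<in>A. \<forall>x \<in> chart_dom c \<inter> chart_dom d. \<forall>v.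
       \<omega> d x (\<lambda>i. D_transition c d x (v i)) = \<omega> c x v) \<and>
    (\<forall>c\<in>A. \<forall>v. smooth_on (chart_map c ` chart_dom c) (\<lambda>u. \<omega> c (chart_inv c u) v))}"

definition ext_d ::
    "('m, 'e::real_normed_vector) chart set \<Rightarrow> nat \<Rightarrow> ('m, 'e) form \<Rightarrow> ('m, 'e) form"
  where "ext_d A r \<omega> = (\<lambda>c x v. if c \<in> A \<and> x \<in> chart_dom c
    then \<Sum>i\<le>r. (-1) ^ i *
           frechet_derivative
             (\<lambda>u. \<omega> c (chart_inv c u) (\<lambda>j. if j < i then v j else v (Suc j)))
             (at (chart_map c x)) (v i)
    else 0)"

text \<open>The exterior product of an r-form and an s-form, as a sum over all permutations (divided
  by r! s!) instead of over the (r,s)-shuffles.\<close>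

definition wedge :: "nat \<Rightarrow> nat \<Rightarrow> ('m, 'e) form \<Rightarrow> ('m, 'e) form \<Rightarrow> ('m, 'e) form"
  where "wedge r s \<alpha> \<beta> = (\<lambda>c x v.
    (\<Sum>\<sigma> | \<sigma> permutes {..<r + s}.
       of_int (sign \<sigma>) * \<alpha> c x (\<lambda>i. v (\<sigma> i)) * \<beta> c x (\<lambda>i. v (\<sigma> (r + i))))
    / (fact r * fact s))"

text \<open>Contraction of an r-form with a vector field; it vanishes on functions (r = 0).\<close>

definition contract :: "nat \<Rightarrow> ('m, 'e) vfield \<Rightarrow> ('m, 'e) form \<Rightarrow> ('m, 'e) form"
  where "contract r X \<omega> = (\<lambda>c x v. if r = 0 then 0 else \<omega> c x (case_nat (X c x) v))"

text \<open>For an r-form, contracts r [X0, ..., Xm] is the composite of the contractions with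
  X0, ..., Xm, the one with Xm being applied first.\<close>

primrec contracts :: "nat \<Rightarrow> ('m, 'e) vfield list \<Rightarrow> ('m, 'e) form \<Rightarrow> ('m, 'e) form"
  where
    "contracts r [] \<omega> = \<omega>"
  | "contracts r (X # Xs) \<omega> = contract (r - length Xs) X (contracts r Xs \<omega>)"


section \<open>The spectral sequence\<close>

definition filt ::
    "('m, 'e::real_normed_vector) chart set \<Rightarrow> 'e set \<Rightarrow> nat \<Rightarrow> nat \<Rightarrow> ('m, 'e) form set"
  where "filt A V p r =
    (if p \<le> r
     then {\<omega> \<in> forms A r. \<forall>Xs. length Xs = r - p + 1 \<and> set Xs \<subseteq> tangent_fields A V
             \<longrightarrow> contracts r Xs \<omega> = (\<lambda>c x v. 0)}
     else {\<lambda>c x v. 0})"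

definition filt_group ::
    "('m, 'e::real_normed_vector) chart set \<Rightarrow> 'e set \<Rightarrow> nat \<Rightarrow> nat \<Rightarrow> ('m, 'e) form monoid"
  where "filt_group A V p r = \<lparr>carrier = filt A V p r,
     monoid.mult = (\<lambda>\<alpha> \<beta> c x v. \<alpha> c x v + \<beta> c x v), one = (\<lambda>c x v. 0)\<rparr>"

text \<open>Quotients are taken in the sense of HOL-Algebra, with the additive groups written
  multiplicatively. The groups are defined for all p and q; outside of the range of p at most the
  codimension and q at most the dimension of the foliation they are trivial.\<close>

definition E0 ::
    "('m, 'e::real_normed_vector) chart set \<Rightarrow> 'e set \<Rightarrow> nat \<Rightarrow> nat \<Rightarrow> ('m, 'e) form set monoid"
  where "E0 A V p q = filt_group A V p (p + q) Mod filt A V (p + 1) (p + q)"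

text \<open>The induced maps on the quotients are defined as unions over all the representatives, as
  is done for the multiplication of cosets in HOL-Algebra.\<close>

definition d0 :: "('m, 'e::real_normed_vector) chart set \<Rightarrow> 'e set \<Rightarrow> nat \<Rightarrow> nat \<Rightarrow>
    ('m, 'e) form set \<Rightarrow> ('m, 'e) form set"
  where "d0 A V p q X =
    (\<Union>\<omega>\<in>X. filt A V (p + 1) (p + q + 1) #>\<^bsub>filt_group A V p (p + q + 1)\<^esub> ext_d A (p + q) \<omega>)"

definition boundaries0 ::
    "('m, 'e::real_normed_vector) chart set \<Rightarrow> 'e set \<Rightarrow> nat \<Rightarrow> nat \<Rightarrow> ('m, 'e) form set set"
  where "boundaries0 A V p q =
    (if q = 0 then {\<one>\<^bsub>E0 A V p q\<^esub>} else d0 A V p (q - 1) ` carrier (E0 A V p (q - 1)))"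

definition E1 ::
    "('m, 'e::real_normed_vector) chart set \<Rightarrow> 'e set \<Rightarrow> nat \<Rightarrow> nat \<Rightarrow> ('m, 'e) form set set monoid"
  where "E1 A V p q =
    (E0 A V p q)\<lparr>carrier := kernel (E0 A V p q) (E0 A V p (q + 1)) (d0 A V p q)\<rparr>
      Mod boundaries0 A V p q"

definition cup0 :: "('m, 'e::real_normed_vector) chart set \<Rightarrow> 'e set \<Rightarrow>
    nat \<Rightarrow> nat \<Rightarrow> nat \<Rightarrow> nat \<Rightarrow> ('m, 'e) form set \<Rightarrow> ('m, 'e) form set \<Rightarrow> ('m, 'e) form set"
  where "cup0 A V p q p' q' X Y =
    (\<Union>\<alpha>\<in>X. \<Union>\<beta>\<in>Y. filt A V (p + p' + 1) (p + p' + (q + q'))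
       #>\<^bsub>filt_group A V (p + p') (p + p' + (q + q'))\<^esub> wedge (p + q) (p' + q') \<alpha> \<beta>)"

definition cup1 :: "('m, 'e::real_normed_vector) chart set \<Rightarrow> 'e set \<Rightarrow>
    nat \<Rightarrow> nat \<Rightarrow> nat \<Rightarrow> nat \<Rightarrow>
    ('m, 'e) form set set \<Rightarrow> ('m, 'e) form set set \<Rightarrow> ('m, 'e) form set set"
  where "cup1 A V p q p' q' a b =
    (\<Union>X\<in>a. \<Union>Y\<in>b. boundaries0 A V (p + p') (q + q')
       #>\<^bsub>E0 A V (p + p') (q + q')\<^esub> cup0 A V p q p' q' X Y)"

definition E1_total :: "('m, 'e::real_normed_vector) chart set \<Rightarrow> 'e set \<Rightarrow>
    (nat \<times> nat \<Rightarrow> ('m, 'e) form set set) monoid"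
  where "E1_total A V = sum_group UNIV (\<lambda>(p, q). E1 A V p q)"

text \<open>In E1_cup, the finprod is the sum in the (additive) group E1 A V p q.\<close>

definition E1_cup :: "('m, 'e::real_normed_vector) chart set \<Rightarrow> 'e set \<Rightarrow>
    (nat \<times> nat \<Rightarrow> ('m, 'e) form set set) \<Rightarrow> (nat \<times> nat \<Rightarrow> ('m, 'e) form set set) \<Rightarrow>
    (nat \<times> nat \<Rightarrow> ('m, 'e) form set set)"
  where "E1_cup A V a b = (\<lambda>(p, q).
    finprod (E1 A V p q)
      (\<lambda>(i, j). cup1 A V i j (p - i) (q - j) (a (i, j)) (b (p - i, q - j)))
      ({..p} \<times> {..q}))"

definition E1_pos :: "('m, 'e::real_normed_vector) chart set \<Rightarrow> 'e set \<Rightarrow>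
    (nat \<times> nat \<Rightarrow> ('m, 'e) form set set) set"
  where "E1_pos A V = {a \<in> carrier (E1_total A V). \<forall>p. a (p, 0) = \<one>\<^bsub>E1 A V p 0\<^esub>}"


section \<open>Length of the cup product\<close>

text \<open>For an algebra with underlying set S, product and zero element; the supremum of the empty
  set is 0 in enat.\<close>

definition lcp :: "('a \<Rightarrow> 'a \<Rightarrow> 'a) \<Rightarrow> 'a \<Rightarrow> 'a set \<Rightarrow> enat"
  where "lcp prd zero S =
    (SUP xs \<in> {xs. xs \<noteq> [] \<and> set xs \<subseteq> S \<and> foldl prd (hd xs) (tl xs) \<noteq> zero}.
       enat (length xs))"

end

theory Submission
  imports Defs
begin

text \<open>A class of positive tangential degree dies on a tangentially categorical open set U: the
  contraction H yields a homotopy operator K, obtained by integrating the contraction of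
  the pulled back form with the time direction over [0,1]. As H moves points inside leaves, K is
  compatible with the filtration; as H at time 1 is constant on leaves, a form pulled back by it
  and having at least one tangential degree lies in the next step of the filtration. So a cycle
  w becomes w + d K w in the next step of the filtration over U. Cutting K off by a smooth function
  that vanishes outside U and equals 1 near each point of C gives a representative, on all of M,
  that lies in the next step at the points of C. If M is covered by k + 1 such sets C, then a
  product of k + 1 such representatives lies pointwise, hence globally, in the next step, and its
  class vanishes.

  That the derivative of H in the leaf directions is again tangent rests on the second
  countability of M: a leaf meets a chart in countably many cosets of V, and a continuous curve
  through countably many cosets stays in one.\<close>

section \<open>Calculus of smooth maps\<close>

text \<open>The filtration is defined by contractions with global vector fields, whereas the
  argument needs forms that lie in the next step at single points. The two notions agree because a
  vector of \<open>V\<close> at a point extends to a global tangent field. This leads to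
  \<open>fvan\<close>, a condition on one alternating map, and to \<open>J1 C p q\<close>, the
  classes with a representative in the next step at all points of C. Under products these sets C
  unite, and over all of M only the trivial class is left.

  Cutting off K costs a term (d phi) wedge (K w), which disappears only where phi is locally
  constant. So C consists of the points with phi = 1 nearby, and it is these smaller sets, not
  merely the open sets U, that have to cover M.

  The identities for d and the exterior product are proved after multiplication by factorials, as
  equalities of full alternations \<open>Alt\<close>. In this form every sign is the sign of a
  permutation of slots, and second derivatives cancel because they are symmetric in two
  slots.\<close>

lemma orthonormal_basis_exists:
  "\<exists>B. finite B \<and> (\<forall>x::'e::{real_inner, heine_borel}. x = (\<Sum>b\<in>B. (x \<bullet> b) *\<^sub>R b)) \<and>
     (\<forall>a\<in>B. \<forall>b\<in>B. a \<bullet> b = (if a = b then 1 else 0))"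
proof -
  obtain B :: "'e set" where B: "finite B" "span B = UNIV"
    using finite_dim_heine_borel by blast
  obtain C where C: "finite C" "span C = span B" "pairwise orthogonal C"
    using basis_orthogonal[OF B(1)] by blast
  define D where "D = (\<lambda>c. c /\<^sub>R norm c) ` (C - {0})"
  have orth: "a \<bullet> b = (if a = b then 1 else 0)" if ab: "a \<in> D" "b \<in> D" for a b
  proof -
    obtain c d where c: "c \<in> C" "c \<noteq> 0" "a = c /\<^sub>R norm c" and d: "d \<in> C" "d \<noteq> 0" "b = d /\<^sub>R norm d"
      using ab by (auto simp: D_def)
    show ?thesis
    proof (cases "c = d")
      case True
      then show ?thesis
        using c d by (simp add: dot_square_norm power2_eq_square)
    next
      case False
      then have *: "c \<bullet> d = 0"
        using C(3) c d by (auto simp: pairwise_def orthogonal_def)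
      then have "a \<bullet> b = 0"
        using c d by simp
      moreover have "a \<bullet> a = 1"
        using c by (simp add: dot_square_norm power2_eq_square)
      ultimately show ?thesis by auto
    qed
  qed
  have fin: "finite D"
    using C(1) by (simp add: D_def)
  have "x = (\<Sum>b\<in>D. (x \<bullet> b) *\<^sub>R b)" for x
  proof -
    have "x \<in> span D"
    proof -
      have "c \<in> span D" if "c \<in> C" for c
      proof (cases "c = 0")
        case False
        then have "c /\<^sub>R norm c \<in> D"
          using that by (auto simp: D_def)
        then have "norm c *\<^sub>R (c /\<^sub>R norm c) \<in> span D"
          by (intro span_scale span_base)
        then show ?thesis using False by simp
      qed (simp add: span_zero)
      then have "span C \<subseteq> span D"
        by (intro span_minimal) auto
      then show ?thesis using B(2) C(2) by auto
    qed
    then obtain u where u: "x = (\<Sum>b\<in>D. u b *\<^sub>R b)"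
      using fin by (auto simp: span_finite)
    have "x \<bullet> b = u b" if "b \<in> D" for b
    proof -
      have "x \<bullet> b = (\<Sum>a\<in>D. if a = b then u b else 0)"
        unfolding u inner_sum_left using orth that by (intro sum.cong) auto
      then show ?thesis
        using that fin by simp
    qed
    then show ?thesis
      using u by simp
  qed
  then show ?thesis
    using fin orth by blast
qed

text \<open>Stands in for \<open>Basis\<close>, which the sort of the model space does not
  provide.\<close>

definition onb :: "'e::{real_inner, heine_borel} set"
  where "onb = (SOME B. finite B \<and> (\<forall>x::'e. x = (\<Sum>b\<in>B. (x \<bullet> b) *\<^sub>R b)) \<and>
     (\<forall>a\<in>B. \<forall>b\<in>B. a \<bullet> b = (if a = b then 1 else 0)))"

lemma finite_onb [simp]: "finite onb"
  and onb_expand: "x = (\<Sum>b\<in>onb. (x \<bullet> b) *\<^sub>R b)"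
  and inner_onb: "a \<in> onb \<Longrightarrow> b \<in> onb \<Longrightarrow> a \<bullet> b = (if a = b then 1 else 0)"
  using someI_ex[OF orthonormal_basis_exists] unfolding onb_def[symmetric] by blast+

text \<open>Turns a derivative in a varying direction into a finite sum of derivatives in fixed
  directions, the only ones that \<open>Ck_on\<close> controls.\<close>

lemma linear_onb_expand:
  assumes "linear f"
  shows "f x = (\<Sum>b\<in>onb. (x \<bullet> b) *\<^sub>R f b)"
  by (subst onb_expand[of x]) (simp add: linear_sum[OF assms] linear_scale[OF assms])

lemma bounded_linear_finite_dim:
  fixes f :: "'e::{real_inner, heine_borel} \<Rightarrow> 'b::real_normed_vector"
  assumes "linear f"
  shows "bounded_linear f"
proof -
  have "f = (\<lambda>x. \<Sum>b\<in>onb. (x \<bullet> b) *\<^sub>R f b)"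
    by (rule ext) (rule linear_onb_expand[OF assms])
  moreover have "bounded_linear (\<lambda>x. \<Sum>b\<in>onb. (x \<bullet> b) *\<^sub>R f b)"
    by (intro bounded_linear_sum bounded_linear_scaleR_const bounded_linear_inner_left)
  ultimately show ?thesis by simp
qed

section \<open>Functions of class C^k and their closure properties\<close>

lemma frechet_derivative_cong_open:
  assumes "open S" "x \<in> S" "\<And>y. y \<in> S \<Longrightarrow> f y = g y"
  shows "frechet_derivative f (at x) = frechet_derivative g (at x)"
proof -
  have "(f has_derivative D) (at x) \<longleftrightarrow> (g has_derivative D) (at x)" for D
    using has_derivative_transform_within_open[OF _ assms(1,2), of f D UNIV g]
      has_derivative_transform_within_open[OF _ assms(1,2), of g D UNIV f] assms(3) by auto
  then show ?thesis
    by (simp add: frechet_derivative_def)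
qed

lemma differentiable_cong_open:
  assumes "open S" "x \<in> S" "\<And>y. y \<in> S \<Longrightarrow> f y = g y"
  shows "f differentiable (at x) \<longleftrightarrow> g differentiable (at x)"
proof -
  have "(f has_derivative D) (at x) \<longleftrightarrow> (g has_derivative D) (at x)" for D
    using has_derivative_transform_within_open[OF _ assms(1,2), of f D UNIV g]
      has_derivative_transform_within_open[OF _ assms(1,2), of g D UNIV f] assms(3) by auto
  then show ?thesis
    by (simp add: differentiable_def)
qed

lemma Ck_on_cong:
  assumes "open S" "\<And>x. x \<in> S \<Longrightarrow> f x = g x"
  shows "Ck_on k S f \<longleftrightarrow> Ck_on k S g"
  using assms(2)
proof (induction k arbitrary: f g)
  case 0
  then show ?case
    using continuous_on_cong[OF refl, of S f g] by simp
next
  case (Suc k)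
  have "Ck_on k S (\<lambda>x. frechet_derivative f (at x) v) \<longleftrightarrow> Ck_on k S (\<lambda>x. frechet_derivative g (at x) v)" for v
    by (rule Suc.IH) (simp add: frechet_derivative_cong_open[OF assms(1) _ Suc.prems])
  moreover have "(\<forall>x\<in>S. f differentiable (at x)) \<longleftrightarrow> (\<forall>x\<in>S. g differentiable (at x))"
    using differentiable_cong_open[OF assms(1), of _ f g] Suc.prems by blast
  ultimately show ?case by simp
qed

lemma Ck_on_subset: "Ck_on k S f \<Longrightarrow> T \<subseteq> S \<Longrightarrow> Ck_on k T f"
  by (induction k arbitrary: f) (auto intro: continuous_on_subset)

lemma Ck_on_local:
  assumes "\<And>x. x \<in> S \<Longrightarrow> \<exists>T. open T \<and> x \<in> T \<and> Ck_on k T f"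
  shows "Ck_on k S f"
  using assms
proof (induction k arbitrary: f)
  case 0
  have "isCont f x" if "x \<in> S" for x
    using 0[OF that] by (auto simp: continuous_on_eq_continuous_at)
  then show ?case
    by (simp add: continuous_at_imp_continuous_on)
next
  case (Suc k)
  have "f differentiable (at x)" if "x \<in> S" for x
    using Suc.prems[OF that] by auto
  moreover have "Ck_on k S (\<lambda>x. frechet_derivative f (at x) v)" for v
    by (rule Suc.IH) (use Suc.prems in force)
  ultimately show ?case by simp
qed

lemma Ck_on_Suc_imp: "Ck_on (Suc k) S f \<Longrightarrow> Ck_on k S f"
proof (induction k arbitrary: f)
  case 0
  then show ?case
    by (auto intro!: continuous_at_imp_continuous_on differentiable_imp_continuous_within)
qed auto

lemma Ck_on_le: "Ck_on k S f \<Longrightarrow> j \<le> k \<Longrightarrow> Ck_on j S f"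
proof (induction k)
  case (Suc k)
  then show ?case
    using Ck_on_Suc_imp[of k S f] by (cases "j = Suc k") auto
qed simp

lemma Ck_on_continuous: "Ck_on k S f \<Longrightarrow> continuous_on S f"
  using Ck_on_le[of k S f 0] by simp

text \<open>Frees the recursion from \<open>frechet_derivative\<close>: any explicit formula for the
  derivative will do. Most closure properties below are proved through it.\<close>

lemma Ck_on_SucI:
  assumes "open S" "\<And>x. x \<in> S \<Longrightarrow> (f has_derivative f' x) (at x)" "\<And>v. Ck_on k S (\<lambda>x. f' x v)"
  shows "Ck_on (Suc k) S f"
proof -
  have "frechet_derivative f (at x) = f' x" if "x \<in> S" for x
    using frechet_derivative_at[OF assms(2)[OF that]] by simp
  then have "Ck_on k S (\<lambda>x. frechet_derivative f (at x) v)" for v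
    using Ck_on_cong[OF assms(1), of "\<lambda>x. frechet_derivative f (at x) v" "\<lambda>x. f' x v"] assms(3) by simp
  then show ?thesis
    using assms(2) by (auto simp: differentiable_def)
qed

lemma Ck_on_Suc_deriv: "Ck_on (Suc k) S f \<Longrightarrow> x \<in> S \<Longrightarrow> (f has_derivative frechet_derivative f (at x)) (at x)"
  by (simp add: frechet_derivative_works)

lemma Ck_on_const: "open S \<Longrightarrow> Ck_on k S (\<lambda>x. a)"
proof (induction k arbitrary: a)
  case (Suc k)
  show ?case
    by (rule Ck_on_SucI[OF Suc.prems has_derivative_const]) (rule Suc.IH[OF Suc.prems])
qed simp

lemma Ck_on_bounded_linear:
  assumes "bounded_linear L" "open S"
  shows "Ck_on k S L"
proof (cases k)
  case 0
  then show ?thesis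
    using assms bounded_linear.continuous_on[OF assms(1) continuous_on_id] by simp
next
  case (Suc j)
  show ?thesis
    unfolding Suc
    by (rule Ck_on_SucI[OF assms(2) bounded_linear.has_derivative[OF assms(1) has_derivative_ident]])
      (rule Ck_on_const[OF assms(2)])
qed

lemma Ck_on_bounded_linear_comp:
  assumes "bounded_linear L" "open S" "Ck_on k S f"
  shows "Ck_on k S (\<lambda>x. L (f x))"
  using assms(3)
proof (induction k arbitrary: f)
  case 0
  then show ?case
    using bounded_linear.continuous_on[OF assms(1)] by simp
next
  case (Suc k)
  show ?case
  proof (rule Ck_on_SucI[OF assms(2)])
    show "((\<lambda>x. L (f x)) has_derivative (\<lambda>v. L (frechet_derivative f (at x) v))) (at x)" if "x \<in> S" for x
      by (rule bounded_linear.has_derivative[OF assms(1) Ck_on_Suc_deriv[OF Suc.prems that]])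
  qed (rule Suc.IH, use Suc.prems in simp)
qed

lemma Ck_on_add:
  assumes "open S" "Ck_on k S f" "Ck_on k S g"
  shows "Ck_on k S (\<lambda>x. f x + g x)"
  using assms(2,3)
proof (induction k arbitrary: f g)
  case 0
  then show ?case by (simp add: continuous_on_add)
next
  case (Suc k)
  show ?case
    by (rule Ck_on_SucI[OF assms(1) has_derivative_add[OF Ck_on_Suc_deriv[OF Suc.prems(1)] Ck_on_Suc_deriv[OF Suc.prems(2)]]])
      (use Suc in auto)
qed

lemma Ck_on_sum:
  assumes "open S" "\<And>i. i \<in> I \<Longrightarrow> Ck_on k S (f i)"
  shows "Ck_on k S (\<lambda>x. \<Sum>i\<in>I. f i x)"
  using assms(2)
  by (induction I rule: infinite_finite_induct) (simp_all add: Ck_on_const Ck_on_add assms(1))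

lemma Ck_on_scaleR:
  assumes "open S" "Ck_on k S (f :: _ \<Rightarrow> real)" "Ck_on k S g"
  shows "Ck_on k S (\<lambda>x. f x *\<^sub>R g x)"
  using assms(2,3)
proof (induction k arbitrary: f g)
  case 0
  then show ?case by (simp add: continuous_on_scaleR)
next
  case (Suc k)
  show ?case
  proof (rule Ck_on_SucI[OF assms(1)
      has_derivative_scaleR[OF Ck_on_Suc_deriv[OF Suc.prems(1)] Ck_on_Suc_deriv[OF Suc.prems(2)]]])
    show "Ck_on k S (\<lambda>x. f x *\<^sub>R frechet_derivative g (at x) v + frechet_derivative f (at x) v *\<^sub>R g x)" for v
      using Suc.prems Suc.prems[THEN Ck_on_Suc_imp] by (intro Ck_on_add assms(1) Suc.IH) auto
  qed
qed

lemma Ck_on_mult: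
  assumes "open S" "Ck_on k S (f :: _ \<Rightarrow> real)" "Ck_on k S g"
  shows "Ck_on k S (\<lambda>x. f x * g x)"
  using Ck_on_scaleR[OF assms] by simp

lemma Ck_on_compose:
  fixes f :: "'a::real_normed_vector \<Rightarrow> 'e::{real_inner, heine_borel}"
  assumes "open S" "open T" "f ` S \<subseteq> T" "Ck_on k S f" "Ck_on k T g"
  shows "Ck_on k S (\<lambda>x. g (f x))"
  using assms(4,5)
proof (induction k arbitrary: g)
  case 0
  then show ?case
    using continuous_on_compose2[of T g S f] assms(3) by auto
next
  case (Suc k)
  have fx: "f x \<in> T" if "x \<in> S" for x
    using assms(3) that by auto
  show ?case
  proof (rule Ck_on_SucI[OF assms(1)])
    \<comment> \<open>The direction in which \<open>g\<close> is differentiated moves with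
      \<open>x\<close>. Expanding it in \<open>onb\<close> leaves products of a coordinate of the
      derivative of \<open>f\<close> with a derivative of \<open>g\<close> in a fixed direction, and
      the latter is covered by the induction hypothesis.\<close>
    let ?D = "\<lambda>x v. \<Sum>b\<in>onb. (frechet_derivative f (at x) v \<bullet> b) *\<^sub>R frechet_derivative g (at (f x)) b"
    show "((\<lambda>x. g (f x)) has_derivative ?D x) (at x)" if "x \<in> S" for x
    proof -
      have "linear (frechet_derivative g (at (f x)))"
        using Ck_on_Suc_deriv[OF Suc.prems(2) fx[OF that]] by (rule has_derivative_linear)
      from linear_onb_expand[OF this]
      have "?D x = (\<lambda>v. frechet_derivative g (at (f x)) (frechet_derivative f (at x) v))"
        by (intro ext) (rule sym)
      then show ?thesis
        using has_derivative_compose[OF Ck_on_Suc_deriv[OF Suc.prems(1) that] Ck_on_Suc_deriv[OF Suc.prems(2) fx[OF that]]]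
        by simp
    qed
    show "Ck_on k S (\<lambda>x. ?D x v)" for v
    proof (intro Ck_on_sum Ck_on_scaleR assms(1))
      show "Ck_on k S (\<lambda>x. frechet_derivative f (at x) v \<bullet> b)" for b
        by (rule Ck_on_bounded_linear_comp[OF bounded_linear_inner_left assms(1)]) (use Suc.prems(1) in auto)
      show "Ck_on k S (\<lambda>x. frechet_derivative g (at (f x)) b)" for b
        by (rule Suc.IH) (use Suc.prems Ck_on_Suc_imp in auto)
    qed
  qed
qed

lemma Ck_on_inverse: "Ck_on k {x::real. x \<noteq> 0} inverse"
proof (induction k)
  case 0
  show ?case by (auto intro!: continuous_intros)
next
  case (Suc k)
  have op: "open {x::real. x \<noteq> 0}"
    by (simp add: open_Collect_neq)
  show ?case
  proof (rule Ck_on_SucI[OF op])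
    show "(inverse has_derivative (\<lambda>v. - (inverse x * v * inverse x))) (at x)" if "x \<in> {x. x \<noteq> 0}" for x :: real
      using that has_derivative_inverse'[of x UNIV] by simp
    show "Ck_on k {x::real. x \<noteq> 0} (\<lambda>x. - (inverse x * v * inverse x))" for v
    proof -
      have "Ck_on k {x::real. x \<noteq> 0} (\<lambda>x. (- v) *\<^sub>R (inverse x * inverse x))"
        by (intro Ck_on_scaleR Ck_on_const Ck_on_mult op Suc)
      then show ?thesis by (simp add: mult.commute mult.left_commute)
    qed
  qed
qed

lemma smooth_on_cong: "open S \<Longrightarrow> (\<And>x. x \<in> S \<Longrightarrow> f x = g x) \<Longrightarrow> smooth_on S f \<longleftrightarrow> smooth_on S g"
  unfolding smooth_on_def using Ck_on_cong[of S f g] by blast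

lemma smooth_on_subset: "smooth_on S f \<Longrightarrow> T \<subseteq> S \<Longrightarrow> smooth_on T f"
  unfolding smooth_on_def using Ck_on_subset by blast

lemma smooth_on_local:
  "(\<And>x. x \<in> S \<Longrightarrow> \<exists>T. open T \<and> x \<in> T \<and> smooth_on T f) \<Longrightarrow> smooth_on S f"
  unfolding smooth_on_def by (intro allI Ck_on_local) fast

lemma smooth_on_continuous: "smooth_on S f \<Longrightarrow> continuous_on S f"
  unfolding smooth_on_def using Ck_on_continuous by blast

lemma smooth_on_has_derivative: "smooth_on S f \<Longrightarrow> x \<in> S \<Longrightarrow> (f has_derivative frechet_derivative f (at x)) (at x)"
  unfolding smooth_on_def using Ck_on_Suc_deriv by blast

lemma smooth_on_linear_deriv: "smooth_on S f \<Longrightarrow> x \<in> S \<Longrightarrow> linear (frechet_derivative f (at x))"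
  using smooth_on_has_derivative has_derivative_linear by blast

lemma smooth_on_deriv: "smooth_on S f \<Longrightarrow> smooth_on S (\<lambda>x. frechet_derivative f (at x) v)"
  unfolding smooth_on_def using Ck_on.simps(2)[of _ S f] by blast

lemma smooth_on_const: "open S \<Longrightarrow> smooth_on S (\<lambda>x. a)"
  unfolding smooth_on_def by (simp add: Ck_on_const)

lemma smooth_on_bounded_linear: "bounded_linear L \<Longrightarrow> open S \<Longrightarrow> smooth_on S L"
  unfolding smooth_on_def by (simp add: Ck_on_bounded_linear)

lemma smooth_on_bounded_linear_comp:
  "bounded_linear L \<Longrightarrow> open S \<Longrightarrow> smooth_on S f \<Longrightarrow> smooth_on S (\<lambda>x. L (f x))"
  unfolding smooth_on_def by (simp add: Ck_on_bounded_linear_comp)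

lemma smooth_on_add: "open S \<Longrightarrow> smooth_on S f \<Longrightarrow> smooth_on S g \<Longrightarrow> smooth_on S (\<lambda>x. f x + g x)"
  unfolding smooth_on_def by (simp add: Ck_on_add)

lemma smooth_on_sum:
  "open S \<Longrightarrow> (\<And>i. i \<in> I \<Longrightarrow> smooth_on S (f i)) \<Longrightarrow> smooth_on S (\<lambda>x. \<Sum>i\<in>I. f i x)"
  unfolding smooth_on_def by (simp add: Ck_on_sum)

lemma smooth_on_scaleR: "open S \<Longrightarrow> smooth_on S f \<Longrightarrow> smooth_on S g \<Longrightarrow> smooth_on S (\<lambda>x. f x *\<^sub>R g x)"
  unfolding smooth_on_def by (simp add: Ck_on_scaleR)

lemma smooth_on_mult: "open S \<Longrightarrow> smooth_on S f \<Longrightarrow> smooth_on S g \<Longrightarrow> smooth_on S (\<lambda>x. f x * g x :: real)"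
  unfolding smooth_on_def by (simp add: Ck_on_mult)

lemma smooth_on_prod:
  "open S \<Longrightarrow> (\<And>i. i \<in> I \<Longrightarrow> smooth_on S (f i)) \<Longrightarrow> smooth_on S (\<lambda>x. \<Prod>i\<in>I. f i x :: real)"
  by (induction I rule: infinite_finite_induct) (simp_all add: smooth_on_const smooth_on_mult)

lemma smooth_on_diff:
  assumes "open S" "smooth_on S f" "smooth_on S g"
  shows "smooth_on S (\<lambda>x. f x - g x)"
  using smooth_on_add[OF assms(1,2)
      smooth_on_bounded_linear_comp[OF bounded_linear_minus[OF bounded_linear_ident] assms(1,3)]]
  by simp

lemma smooth_on_compose:
  fixes f :: "'a::real_normed_vector \<Rightarrow> 'e::{real_inner, heine_borel}"
  shows "open S \<Longrightarrow> open T \<Longrightarrow> f ` S \<subseteq> T \<Longrightarrow> smooth_on S f \<Longrightarrow> smooth_on T g \<Longrightarrow> smooth_on S (\<lambda>x. g (f x))"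
  unfolding smooth_on_def by (simp add: Ck_on_compose)

lemma smooth_on_inverse: "smooth_on {x::real. x \<noteq> 0} inverse"
  unfolding smooth_on_def by (simp add: Ck_on_inverse)

text \<open>By the mean value theorem on the segment from \<open>x\<close> to
  \<open>y = x + h\<close>, the error is \<open>G z h - G x h\<close> for some \<open>z\<close> on
  the segment. Expanded in \<open>onb\<close>, it is small by the continuity of the finitely many
  functions \<open>G u b\<close>.\<close>

lemma has_derivative_if_directional:
  fixes f :: "'e::{real_inner, heine_borel} \<Rightarrow> real"
  assumes S: "open S" "x \<in> S"
    and lin: "linear (G x)" "\<And>u. u \<in> S \<Longrightarrow> linear (G u)"
    and cont: "\<And>v. continuous_on S (\<lambda>u. G u v)"
    and dir: "\<And>u v. u \<in> S \<Longrightarrow> ((\<lambda>s. f (u + s *\<^sub>R v)) has_real_derivative G u v) (at 0)"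
  shows "(f has_derivative G x) (at x)"
  unfolding has_derivative_at_alt
proof (intro conjI allI impI)
  show "bounded_linear (G x)"
    by (rule bounded_linear_finite_dim[OF lin(1)])
next
  fix e :: real
  assume e: "0 < e"
  \<comment> \<open>One more than the number of basis vectors, so that the division by
    \<open>N\<close> is legitimate in dimension 0 as well.\<close>
  define N where "N = real (card (onb :: 'e set)) + 1"
  have N: "N > 0" by (simp add: N_def add_nonneg_pos)
  have "\<exists>d>0. \<forall>y. dist y x < d \<longrightarrow> \<bar>G y b - G x b\<bar> < e / N" for b
  proof -
    have "isCont (\<lambda>u. G u b) x"
      using cont S by (simp add: continuous_on_eq_continuous_at)
    then show ?thesis
      using e N by (auto simp: continuous_at_eps_delta dist_real_def)
  qed
  then obtain D where D: "\<And>b. D b > 0" "\<And>b y. dist y x < D b \<Longrightarrow> \<bar>G y b - G x b\<bar> < e / N"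
    by metis
  obtain d0 where d0: "d0 > 0" "ball x d0 \<subseteq> S"
    using S by (auto simp: open_contains_ball)
  define d where "d = Min (insert d0 (D ` onb))"
  have d: "d > 0" "d \<le> d0" "\<And>b. b \<in> onb \<Longrightarrow> d \<le> D b"
    using D(1) d0(1) by (auto simp: d_def)
  show "\<exists>d>0. \<forall>y. norm (y - x) < d \<longrightarrow> norm (f y - f x - G x (y - x)) \<le> e * norm (y - x)"
  proof (intro exI[of _ d] conjI allI impI d(1))
    fix y assume y: "norm (y - x) < d"
    define h where "h = y - x"
    have near: "dist (x + s *\<^sub>R h) x < d" if "0 \<le> s" "s \<le> 1" for s :: real
    proof -
      have "\<bar>s\<bar> * norm h \<le> norm h"
        using that by (simp add: mult_left_le_one_le)
      then show ?thesis using y by (simp add: dist_norm h_def)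
    qed
    then have inS: "x + s *\<^sub>R h \<in> S" if "0 \<le> s" "s \<le> 1" for s :: real
      using that d(2) d0(2) near[OF that] by (force simp: dist_commute)
    have der: "((\<lambda>s. f (x + s *\<^sub>R h)) has_real_derivative G (x + s *\<^sub>R h) h) (at s)" if "0 \<le> s" "s \<le> 1" for s
    proof -
      have "((\<lambda>r. f (x + (r + s) *\<^sub>R h)) has_real_derivative G (x + s *\<^sub>R h) h) (at 0)"
        using dir[OF inS[OF that], of h] by (simp add: algebra_simps)
      then show ?thesis
        using DERIV_shift[of "\<lambda>s. f (x + s *\<^sub>R h)" "G (x + s *\<^sub>R h) h" 0 s] by (simp add: add.commute)
    qed
    obtain z where z: "0 < z" "z < 1" "f (x + 1 *\<^sub>R h) - f (x + 0 *\<^sub>R h) = (1 - 0) * G (x + z *\<^sub>R h) h"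
      using MVT2[of 0 1 "\<lambda>s. f (x + s *\<^sub>R h)" "\<lambda>s. G (x + s *\<^sub>R h) h"] der by auto
    let ?z = "x + z *\<^sub>R h"
    have zS: "?z \<in> S" and zd: "dist ?z x < d"
      using inS[of z] near[of z] z by auto
    have "f y - f x - G x h = G ?z h - G x h"
      using z(3) by (simp add: h_def)
    also have "\<dots> = (\<Sum>b\<in>onb. (h \<bullet> b) * (G ?z b - G x b))"
      using linear_onb_expand[OF lin(2)[OF zS], of h] linear_onb_expand[OF lin(1), of h]
      by (simp add: sum_subtractf right_diff_distrib)
    also have "\<bar>\<dots>\<bar> \<le> (\<Sum>b\<in>(onb :: 'e set). norm h * (e / N))"
    proof (rule order_trans[OF sum_abs sum_mono])
      fix b :: 'e assume b: "b \<in> onb"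
      have "norm b = 1"
        using inner_onb[OF b b] by (simp add: norm_eq_sqrt_inner)
      then have "\<bar>h \<bullet> b\<bar> \<le> norm h"
        using Cauchy_Schwarz_ineq2[of h b] by simp
      moreover have "\<bar>G ?z b - G x b\<bar> \<le> e / N"
        using D(2)[of ?z b] zd d(3)[OF b] by fastforce
      ultimately show "\<bar>(h \<bullet> b) * (G ?z b - G x b)\<bar> \<le> norm h * (e / N)"
        unfolding abs_mult by (intro mult_mono) auto
    qed
    also have "\<dots> = norm h * e * (real (card (onb :: 'e set)) / N)"
      by simp
    also have "\<dots> \<le> norm h * e * 1"
      using e N by (intro mult_left_mono) (auto simp: N_def divide_simps)
    finally show "norm (f y - f x - G x (y - x)) \<le> e * norm (y - x)"
      by (simp add: h_def mult.commute)
  qed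
qed

section \<open>Differentiation under the integral sign\<close>

lemma Ck_on_param_cont:
  assumes "continuous_on (S \<times> UNIV) (g :: 'e::{real_inner, heine_borel} \<times> real \<Rightarrow> real)"
  shows "continuous_on (S \<times> cbox 0 1) (\<lambda>(x, t). g (x, t))" "x \<in> S \<Longrightarrow> (\<lambda>t. g (x, t)) integrable_on {0..1}"
proof -
  show "continuous_on (S \<times> cbox 0 1) (\<lambda>(x, t). g (x, t))"
    using continuous_on_subset[OF assms, of "S \<times> cbox 0 1"] by (auto simp: case_prod_unfold)
  show "(\<lambda>t. g (x, t)) integrable_on {0..1}" if "x \<in> S"
    using that by (intro integrable_continuous_real continuous_on_compose2[OF assms]) (auto intro!: continuous_intros)
qed

text \<open>The Leibniz rule in one real variable gives the derivative along each line. These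
  directional derivatives are continuous in \<open>u\<close> and linear in \<open>v\<close>, so they
  make up a full derivative.\<close>

lemma has_derivative_param_integral:
  fixes g :: "'e::{real_inner, heine_borel} \<times> real \<Rightarrow> real"
  assumes S: "open S" "u \<in> S" and g: "Ck_on (Suc 0) (S \<times> UNIV) g"
  shows "((\<lambda>u. integral {0..1} (\<lambda>t. g (u, t))) has_derivative
     (\<lambda>v. integral {0..1} (\<lambda>t. frechet_derivative g (at (u, t)) (v, 0)))) (at u)"
proof (rule has_derivative_if_directional[OF S])
  let ?G = "\<lambda>u v. integral {0..1} (\<lambda>t. frechet_derivative g (at (u, t)) (v, 0))"
  have der: "(g has_derivative frechet_derivative g (at (w, t))) (at (w, t))" if "w \<in> S" for w t
    using Ck_on_Suc_deriv[OF g] that by simp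
  have cont: "continuous_on (S \<times> UNIV) (\<lambda>z. frechet_derivative g (at z) (v, 0))" for v
    using g by simp
  note cont' = Ck_on_param_cont[OF cont]
  show lin: "linear (?G w)" if "w \<in> S" for w
  proof (rule linearI)
    have L: "linear (frechet_derivative g (at (w, t)))" for t
      using der[OF that] by (rule has_derivative_linear)
    show "?G w (a + b) = ?G w a + ?G w b" for a b
      using linear_add[OF L, of _ "(a, 0)" "(b, 0)"]
      by (simp add: integral_add[OF cont'(2)[OF that] cont'(2)[OF that], symmetric])
    show "?G w (c *\<^sub>R a) = c *\<^sub>R ?G w a" for c a
      using linear_scale[OF L, of _ c "(a, 0)"] by simp
  qed
  then show "linear (?G u)"
    using S(2) by blast
  show "continuous_on S (\<lambda>u. ?G u v)" for v
    using integral_continuous_on_param[OF cont'(1)] by simp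
  fix w v :: 'e assume w: "w \<in> S"
  obtain e where e: "e > 0" "ball w e \<subseteq> S"
    using S(1) w by (auto simp: open_contains_ball)
  \<comment> \<open>The added 1 covers \<open>v = 0\<close>; for \<open>s\<close> below
    \<open>d\<close> the point \<open>w + s *\<^sub>R v\<close> stays in the ball of radius
    \<open>e\<close>.\<close>
  define d where "d = e / (norm v + 1)"
  have np: "norm v + 1 > 0"
    by (simp add: add_nonneg_pos)
  have d: "d > 0"
    using e(1) np by (simp add: d_def)
  have inS: "w + s *\<^sub>R v \<in> S" if "s \<in> ball 0 d" for s :: real
  proof -
    have "\<bar>s\<bar> * norm v \<le> \<bar>s\<bar> * (norm v + 1)"
      by (intro mult_left_mono) auto
    also have "\<dots> < e"
      using that np by (simp add: d_def field_simps dist_norm)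
    finally have "w + s *\<^sub>R v \<in> ball w e"
      by (simp add: dist_norm)
    then show ?thesis using e by blast
  qed
  have "((\<lambda>s. integral (cbox 0 1) (\<lambda>t. g (w + s *\<^sub>R v, t))) has_real_derivative
     integral (cbox 0 1) (\<lambda>t. frechet_derivative g (at (w + 0 *\<^sub>R v, t)) (v, 0))) (at 0 within ball 0 d)"
  proof (rule leibniz_rule_field_derivative[where f = "\<lambda>s t. g (w + s *\<^sub>R v, t)"
      and fx = "\<lambda>s t. frechet_derivative g (at (w + s *\<^sub>R v, t)) (v, 0)"])
    fix s t :: real assume s: "s \<in> ball 0 d"
    have "((\<lambda>s. (w + s *\<^sub>R v, t)) has_derivative (\<lambda>r. (r *\<^sub>R v, 0))) (at s within ball 0 d)"
      by (auto intro!: derivative_eq_intros)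
    from has_derivative_compose[OF this der[OF inS[OF s]]]
    have *: "((\<lambda>s. g (w + s *\<^sub>R v, t)) has_derivative
       (\<lambda>r. frechet_derivative g (at (w + s *\<^sub>R v, t)) (r *\<^sub>R v, 0))) (at s within ball 0 d)" .
    have "frechet_derivative g (at (w + s *\<^sub>R v, t)) (r *\<^sub>R v, 0)
      = frechet_derivative g (at (w + s *\<^sub>R v, t)) (v, 0) * r" for r
      using linear_scale[OF has_derivative_linear[OF der[OF inS[OF s]]], of t r "(v, 0)"] by simp
    then show "((\<lambda>s. g (w + s *\<^sub>R v, t)) has_real_derivative
       frechet_derivative g (at (w + s *\<^sub>R v, t)) (v, 0)) (at s within ball 0 d)"
      using * by (simp add: has_field_derivative_def)
  next
    show "(\<lambda>t. g (w + s *\<^sub>R v, t)) integrable_on cbox 0 1" if "s \<in> ball 0 d" for s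
      using Ck_on_param_cont(2)[OF Ck_on_continuous[OF g] inS[OF that]] by simp
    show "continuous_on (ball 0 d \<times> cbox 0 1) (\<lambda>(s, t). frechet_derivative g (at (w + s *\<^sub>R v, t)) (v, 0))"
      unfolding case_prod_unfold
      by (rule continuous_on_compose2[OF cont]) (use inS in \<open>auto intro!: continuous_intros\<close>)
  qed (use d in auto)
  then show "((\<lambda>s. integral {0..1} (\<lambda>t. g (w + s *\<^sub>R v, t))) has_real_derivative ?G w v) (at 0)"
    using d by (simp add: at_within_open[of 0 "ball 0 d"])
qed

lemma Ck_on_param_integral:
  fixes g :: "'e::{real_inner, heine_borel} \<times> real \<Rightarrow> real"
  assumes S: "open S" and g: "Ck_on k (S \<times> UNIV) g"
  shows "Ck_on k S (\<lambda>u. integral {0..1} (\<lambda>t. g (u, t)))"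
  using g
proof (induction k arbitrary: g)
  case 0
  then show ?case
    using integral_continuous_on_param[OF Ck_on_param_cont(1), of S g] by simp
next
  case (Suc k)
  show ?case
  proof (rule Ck_on_SucI[OF S])
    show "((\<lambda>u. integral {0..1} (\<lambda>t. g (u, t))) has_derivative
       (\<lambda>v. integral {0..1} (\<lambda>t. frechet_derivative g (at (u, t)) (v, 0)))) (at u)" if "u \<in> S" for u
      using Ck_on_le[OF Suc.prems, of "Suc 0"] by (intro has_derivative_param_integral[OF S that]) simp
    show "Ck_on k S (\<lambda>u. integral {0..1} (\<lambda>t. frechet_derivative g (at (u, t)) (v, 0)))" for v
      using Suc.IH[of "\<lambda>z. frechet_derivative g (at z) (v, 0)"] Suc.prems by simp
  qed
qed

lemma smooth_on_param_integral:
  fixes g :: "'e::{real_inner, heine_borel} \<times> real \<Rightarrow> real"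
  shows "open S \<Longrightarrow> smooth_on (S \<times> UNIV) g \<Longrightarrow> smooth_on S (\<lambda>u. integral {0..1} (\<lambda>t. g (u, t)))"
  unfolding smooth_on_def by (simp add: Ck_on_param_integral)

text \<open>The mean value theorem is applied twice: to the difference of \<open>f\<close> on two
  parallel segments in direction \<open>v\<close>, then to the resulting derivative along
  \<open>w\<close>. The left side is symmetric in \<open>v\<close> and \<open>w\<close>, and letting
  \<open>h\<close> tend to 0 transfers the symmetry to the second derivative.\<close>

lemma second_difference:
  fixes f :: "'e::{real_inner, heine_borel} \<Rightarrow> real"
  assumes f: "smooth_on S f" and h: "h > 0"
    and S: "\<And>s t. 0 \<le> s \<Longrightarrow> s \<le> 1 \<Longrightarrow> 0 \<le> t \<Longrightarrow> t \<le> 1 \<Longrightarrow> u + (s * h) *\<^sub>R v + (t * h) *\<^sub>R w \<in> S"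
  obtains s t where "0 \<le> s" "s \<le> 1" "0 \<le> t" "t \<le> 1"
    "f (u + h *\<^sub>R v + h *\<^sub>R w) - f (u + h *\<^sub>R v) - f (u + h *\<^sub>R w) + f u
      = h * (h * frechet_derivative (\<lambda>x. frechet_derivative f (at x) v) (at (u + (s * h) *\<^sub>R v + (t * h) *\<^sub>R w)) w)"
proof -
  have line: "((\<lambda>s. g (a + (s * h) *\<^sub>R z)) has_real_derivative h * frechet_derivative g (at (a + (s * h) *\<^sub>R z)) z) (at s)"
    if "smooth_on S g" "a + (s * h) *\<^sub>R z \<in> S" for g :: "'e \<Rightarrow> real" and a z s
  proof -
    have "((\<lambda>s. a + (s * h) *\<^sub>R z) has_derivative (\<lambda>r. r *\<^sub>R (h *\<^sub>R z))) (at s)"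
      by (auto intro!: derivative_eq_intros)
    from has_derivative_compose[OF this smooth_on_has_derivative[OF that]]
    have *: "((\<lambda>s. g (a + (s * h) *\<^sub>R z)) has_derivative (\<lambda>r. frechet_derivative g (at (a + (s * h) *\<^sub>R z)) (r *\<^sub>R (h *\<^sub>R z)))) (at s)" .
    have "frechet_derivative g (at (a + (s * h) *\<^sub>R z)) (r *\<^sub>R (h *\<^sub>R z)) = (h * frechet_derivative g (at (a + (s * h) *\<^sub>R z)) z) * r" for r
      using linear_scale[OF smooth_on_linear_deriv[OF that], of "r * h" z] by simp
    then show ?thesis
      using * by (simp add: has_field_derivative_def)
  qed
  have *: "((\<lambda>s. f (u + h *\<^sub>R w + (s * h) *\<^sub>R v) - f (u + (s * h) *\<^sub>R v)) has_real_derivative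
     h * frechet_derivative f (at (u + h *\<^sub>R w + (s * h) *\<^sub>R v)) v - h * frechet_derivative f (at (u + (s * h) *\<^sub>R v)) v) (at s)"
    if "0 \<le> s" "s \<le> 1" for s
    using S[of s 1] S[of s 0] that
    by (intro DERIV_diff line f) (simp_all add: add.assoc add.commute[of "h *\<^sub>R w"])
  have "\<exists>s>0. s < 1 \<and> (f (u + h *\<^sub>R w + (1 * h) *\<^sub>R v) - f (u + (1 * h) *\<^sub>R v)) - (f (u + h *\<^sub>R w + (0 * h) *\<^sub>R v) - f (u + (0 * h) *\<^sub>R v))
      = (1 - 0) * (h * frechet_derivative f (at (u + h *\<^sub>R w + (s * h) *\<^sub>R v)) v - h * frechet_derivative f (at (u + (s * h) *\<^sub>R v)) v)"
    by (rule MVT2[OF zero_less_one]) (rule *)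
  then obtain s where s: "0 < s" "s < 1"
    "(f (u + h *\<^sub>R w + (1 * h) *\<^sub>R v) - f (u + (1 * h) *\<^sub>R v)) - (f (u + h *\<^sub>R w + (0 * h) *\<^sub>R v) - f (u + (0 * h) *\<^sub>R v))
      = (1 - 0) * (h * frechet_derivative f (at (u + h *\<^sub>R w + (s * h) *\<^sub>R v)) v - h * frechet_derivative f (at (u + (s * h) *\<^sub>R v)) v)"
    by blast
  let ?g = "\<lambda>x. frechet_derivative f (at x) v"
  have *: "((\<lambda>t. ?g (u + (s * h) *\<^sub>R v + (t * h) *\<^sub>R w)) has_real_derivative
     h * frechet_derivative ?g (at (u + (s * h) *\<^sub>R v + (t * h) *\<^sub>R w)) w) (at t)"
    if "0 \<le> t" "t \<le> 1" for t
    using S[of s t] that s by (intro line smooth_on_deriv f) auto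
  have "\<exists>t>0. t < 1 \<and> ?g (u + (s * h) *\<^sub>R v + (1 * h) *\<^sub>R w) - ?g (u + (s * h) *\<^sub>R v + (0 * h) *\<^sub>R w)
      = (1 - 0) * (h * frechet_derivative ?g (at (u + (s * h) *\<^sub>R v + (t * h) *\<^sub>R w)) w)"
    by (rule MVT2[OF zero_less_one]) (rule *)
  then obtain t where t: "0 < t" "t < 1" "?g (u + (s * h) *\<^sub>R v + (1 * h) *\<^sub>R w) - ?g (u + (s * h) *\<^sub>R v + (0 * h) *\<^sub>R w)
      = (1 - 0) * (h * frechet_derivative ?g (at (u + (s * h) *\<^sub>R v + (t * h) *\<^sub>R w)) w)"
    by blast
  show thesis
  proof (rule that[of s t])
    have "f (u + h *\<^sub>R v + h *\<^sub>R w) - f (u + h *\<^sub>R v) - f (u + h *\<^sub>R w) + f u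
      = h * (?g (u + (s * h) *\<^sub>R v + h *\<^sub>R w) - ?g (u + (s * h) *\<^sub>R v))"
      using s(3) by (simp add: add.assoc add.commute[of "h *\<^sub>R w"] right_diff_distrib)
    also have "\<dots> = h * (h * frechet_derivative ?g (at (u + (s * h) *\<^sub>R v + (t * h) *\<^sub>R w)) w)"
      using t(3) by simp
    finally show "f (u + h *\<^sub>R v + h *\<^sub>R w) - f (u + h *\<^sub>R v) - f (u + h *\<^sub>R w) + f u
      = h * (h * frechet_derivative ?g (at (u + (s * h) *\<^sub>R v + (t * h) *\<^sub>R w)) w)" .
  qed (use s t in auto)
qed

lemma symmetric_second_deriv:
  fixes f :: "'e::{real_inner, heine_borel} \<Rightarrow> real"
  assumes f: "smooth_on S f" and S: "open S" "u \<in> S"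
  shows "frechet_derivative (\<lambda>x. frechet_derivative f (at x) v) (at u) w
       = frechet_derivative (\<lambda>x. frechet_derivative f (at x) w) (at u) v"
proof (rule ccontr)
  let ?A = "\<lambda>y. frechet_derivative (\<lambda>x. frechet_derivative f (at x) v) (at y) w"
  let ?B = "\<lambda>y. frechet_derivative (\<lambda>x. frechet_derivative f (at x) w) (at y) v"
  assume ne: "?A u \<noteq> ?B u"
  define e where "e = \<bar>?A u - ?B u\<bar> / 2"
  have e: "e > 0" using ne by (simp add: e_def)
  have "isCont ?A u" "isCont ?B u"
    using smooth_on_continuous[OF smooth_on_deriv[OF smooth_on_deriv[OF f]]] S
    by (simp_all add: continuous_on_eq_continuous_at)
  then obtain dA dB where dA: "dA > 0" "\<And>y. dist y u < dA \<Longrightarrow> \<bar>?A y - ?A u\<bar> < e"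
    and dB: "dB > 0" "\<And>y. dist y u < dB \<Longrightarrow> \<bar>?B y - ?B u\<bar> < e"
    unfolding continuous_at_eps_delta dist_real_def using e by metis
  obtain d0 where d0: "d0 > 0" "ball u d0 \<subseteq> S"
    using S by (auto simp: open_contains_ball)
  define d where "d = min d0 (min dA dB)"
  have d: "d > 0" using d0 dA dB by (simp add: d_def)
  \<comment> \<open>Small enough that the whole parallelogram spanned at \<open>u\<close> by
    \<open>h *\<^sub>R v\<close> and \<open>h *\<^sub>R w\<close> lies within distance
    \<open>d\<close> of \<open>u\<close>.\<close>
  define h where "h = d / (norm v + norm w + 1)"
  have np: "norm v + norm w + 1 > 0"
    by (simp add: add_nonneg_pos)
  have h: "h > 0" using d np by (simp add: h_def)
  have near: "dist (u + (s * h) *\<^sub>R a + (t * h) *\<^sub>R b) u < d"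
    if st: "0 \<le> s" "s \<le> 1" "0 \<le> t" "t \<le> 1" and ab: "norm a + norm b = norm v + norm w" for s t a b
  proof -
    have "dist (u + (s * h) *\<^sub>R a + (t * h) *\<^sub>R b) u \<le> s * h * norm a + t * h * norm b"
      using st h norm_triangle_ineq[of "(s * h) *\<^sub>R a" "(t * h) *\<^sub>R b"] by (simp add: dist_norm abs_mult)
    also have "\<dots> \<le> h * norm a + h * norm b"
      using st h by (intro add_mono mult_right_mono) (auto simp: mult_le_cancel_right1)
    also have "\<dots> = h * (norm v + norm w)"
      using ab by (simp add: distrib_left[symmetric])
    also have "\<dots> < h * (norm v + norm w + 1)"
      using h by simp
    also have "\<dots> = d"
      using np by (simp add: h_def)
    finally show ?thesis .
  qed
  have inS: "u + (s * h) *\<^sub>R a + (t * h) *\<^sub>R b \<in> S"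
    if "0 \<le> s" "s \<le> 1" "0 \<le> t" "t \<le> 1" "norm a + norm b = norm v + norm w" for s t a b
    using near[OF that] d0(2) by (auto simp: d_def dist_commute)
  obtain s t where st: "0 \<le> s" "s \<le> 1" "0 \<le> t" "t \<le> 1"
    "f (u + h *\<^sub>R v + h *\<^sub>R w) - f (u + h *\<^sub>R v) - f (u + h *\<^sub>R w) + f u
      = h * (h * ?A (u + (s * h) *\<^sub>R v + (t * h) *\<^sub>R w))"
    by (rule second_difference[OF f h, of u v w]) (use inS in auto)
  obtain s' t' where st': "0 \<le> s'" "s' \<le> 1" "0 \<le> t'" "t' \<le> 1"
    "f (u + h *\<^sub>R w + h *\<^sub>R v) - f (u + h *\<^sub>R w) - f (u + h *\<^sub>R v) + f u
      = h * (h * ?B (u + (s' * h) *\<^sub>R w + (t' * h) *\<^sub>R v))"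
    by (rule second_difference[OF f h, of u w v]) (use inS in auto)
  let ?p = "u + (s * h) *\<^sub>R v + (t * h) *\<^sub>R w" and ?q = "u + (s' * h) *\<^sub>R w + (t' * h) *\<^sub>R v"
  have "u + h *\<^sub>R w + h *\<^sub>R v = u + h *\<^sub>R v + h *\<^sub>R w"
    by (simp add: algebra_simps)
  then have "h * (h * ?A ?p) = h * (h * ?B ?q)"
    unfolding st(5)[symmetric] st'(5)[symmetric] by (simp only:)
  then have "?A ?p = ?B ?q" using h by simp
  moreover have "\<bar>?A ?p - ?A u\<bar> < e"
    using near[OF st(1-4), of v w] by (intro dA) (simp add: d_def)
  moreover have "\<bar>?B ?q - ?B u\<bar> < e"
    using near[OF st'(1-4), of w v] by (intro dB) (simp add: d_def add.commute)
  ultimately have "\<bar>?A u - ?B u\<bar> < 2 * e"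
    by linarith
  then show False by (simp add: e_def)
qed

lemma symmetric_second_deriv_vec:
  fixes f :: "'e::{real_inner, heine_borel} \<Rightarrow> 'f::{real_inner, heine_borel}"
  assumes f: "smooth_on S f" and S: "open S" "u \<in> S"
  shows "frechet_derivative (\<lambda>x. frechet_derivative f (at x) v) (at u) w
       = frechet_derivative (\<lambda>x. frechet_derivative f (at x) w) (at u) v"
proof (rule vector_eq_rdot[THEN iffD1, rule_format])
  fix b
  have inner: "frechet_derivative (\<lambda>x. g x \<bullet> b) (at x) = (\<lambda>v. frechet_derivative g (at x) v \<bullet> b)"
    if "smooth_on S g" "x \<in> S" for g :: "'e \<Rightarrow> 'f" and x
    using frechet_derivative_at[OF bounded_linear.has_derivative[OF bounded_linear_inner_left smooth_on_has_derivative[OF that]], of b]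
    by simp
  have "frechet_derivative (\<lambda>x. frechet_derivative f (at x) v) (at u) w \<bullet> b
    = frechet_derivative (\<lambda>x. frechet_derivative (\<lambda>x. f x \<bullet> b) (at x) v) (at u) w" for v w
  proof -
    have "frechet_derivative (\<lambda>x. frechet_derivative (\<lambda>x. f x \<bullet> b) (at x) v) (at u)
      = frechet_derivative (\<lambda>x. frechet_derivative f (at x) v \<bullet> b) (at u)"
      by (rule frechet_derivative_cong_open[OF S]) (simp add: inner[OF f])
    then show ?thesis
      by (simp add: inner[OF smooth_on_deriv[OF f] S(2)])
  qed
  then show "frechet_derivative (\<lambda>x. frechet_derivative f (at x) v) (at u) w \<bullet> b
    = frechet_derivative (\<lambda>x. frechet_derivative f (at x) w) (at u) v \<bullet> b"
    using symmetric_second_deriv[OF smooth_on_bounded_linear_comp[OF bounded_linear_inner_left S(1) f] S] by simp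
qed

section \<open>Bump functions\<close>

text \<open>The derivatives of exp(-1/t) are linear combinations of these functions. The family is
  closed under differentiation, which lets the smoothness proof go by induction on k for all
  \<open>n\<close> at once.\<close>

definition flat :: "nat \<Rightarrow> real \<Rightarrow> real"
  where "flat n t = (if t > 0 then exp (- inverse t) * inverse t ^ n else 0)"

lemma flat_tendsto_0: "(flat n \<longlongrightarrow> 0) (at 0)"
proof (rule filterlim_split_at)
  show "(flat n \<longlongrightarrow> 0) (at_left 0)"
    by (rule tendsto_eventually) (auto simp: eventually_at_filter flat_def)
  have "((\<lambda>t::real. inverse t ^ n / exp (inverse t)) \<longlongrightarrow> 0) (at_right 0)"
    by (rule filterlim_compose[OF tendsto_power_div_exp_0 filterlim_inverse_at_top_right])
  moreover have "\<forall>\<^sub>F t in at_right 0. inverse t ^ n / exp (inverse t) = flat n t"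
    by (auto simp: eventually_at_filter flat_def exp_minus field_simps)
  ultimately show "(flat n \<longlongrightarrow> 0) (at_right 0)"
    by (rule Lim_transform_eventually)
qed

lemma flat_deriv: "(flat n has_real_derivative flat (n + 2) t - n * flat (n + 1) t) (at t)"
proof -
  consider "t > 0" | "t < 0" | "t = 0" by linarith
  then show ?thesis
  proof cases
    case 1
    have "((\<lambda>t. exp (- inverse t) * inverse t ^ n) has_real_derivative flat (n + 2) t - n * flat (n + 1) t) (at t)"
    proof (cases n)
      case 0
      then show ?thesis
        using 1 by (auto intro!: derivative_eq_intros simp: flat_def power2_eq_square)
    next
      case (Suc m)
      show ?thesis
        using 1 power_minus_mult[of m "inverse t"]
        by (cases "m = 0") (auto intro!: derivative_eq_intros simp: flat_def Suc power2_eq_square algebra_simps)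
    qed
    moreover have ev: "\<forall>\<^sub>F s in nhds t. exp (- inverse s) * inverse s ^ n = flat n s"
      using eventually_nhds_in_open[of "{0<..}" t] 1 by (auto elim!: eventually_mono simp: flat_def)
    ultimately show ?thesis
      by (simp add: DERIV_cong_ev[OF refl ev refl])
  next
    case 2
    have ev: "\<forall>\<^sub>F s in nhds t. 0 = flat n s"
      using eventually_nhds_in_open[of "{..<0}" t] 2 by (auto elim!: eventually_mono simp: flat_def)
    moreover have "((\<lambda>t. 0) has_real_derivative flat (n + 2) t - n * flat (n + 1) t) (at t)"
      using 2 by (simp add: flat_def)
    ultimately show ?thesis
      by (simp add: DERIV_cong_ev[OF refl ev refl])
  next
    case 3
    \<comment> \<open>At 0 the difference quotient of \<open>flat n\<close> is
      \<open>flat (n + 1)\<close> itself, so its limit is known.\<close>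
    have "(\<lambda>s. (flat n s - flat n 0) / (s - 0)) = flat (n + 1)"
      by (auto simp: flat_def divide_inverse fun_eq_iff)
    moreover have "flat (n + 2) 0 - n * flat (n + 1) 0 = 0"
      by (simp add: flat_def)
    ultimately show ?thesis
      using flat_tendsto_0[of "n + 1"] unfolding 3 has_field_derivative_iff by (simp only:)
  qed
qed

lemma Ck_on_flat: "Ck_on k UNIV (flat n)"
proof (induction k arbitrary: n)
  case 0
  show ?case
    using flat_deriv by (auto intro!: DERIV_isCont continuous_at_imp_continuous_on)
next
  case (Suc k)
  show ?case
  proof (rule Ck_on_SucI)
    show "(flat n has_derivative (\<lambda>v. (flat (n + 2) t - n * flat (n + 1) t) * v)) (at t)" for t
      using flat_deriv[of n t] by (simp add: has_field_derivative_def)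
    have "Ck_on k UNIV (\<lambda>t. v *\<^sub>R flat (n + 2) t + (- real n * v) *\<^sub>R flat (n + 1) t)" for v
      by (intro Ck_on_add Ck_on_scaleR Ck_on_const Suc) auto
    then show "Ck_on k UNIV (\<lambda>t. (flat (n + 2) t - n * flat (n + 1) t) * v)" for v
      by (simp add: algebra_simps)
  qed simp
qed

text \<open>The usual smooth transition from 0 to 1. The denominator never vanishes, because
  \<open>t\<close> or \<open>1 - t\<close> is positive.\<close>

definition step :: "real \<Rightarrow> real"
  where "step t = flat 0 t * inverse (flat 0 t + flat 0 (1 - t))"

lemma step_0: "t \<le> 0 \<Longrightarrow> step t = 0"
  and step_1: "t \<ge> 1 \<Longrightarrow> step t = 1"
  by (simp_all add: step_def flat_def)

lemma smooth_on_step: "smooth_on UNIV step"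
proof -
  have f: "smooth_on UNIV (flat 0)"
    by (simp add: smooth_on_def Ck_on_flat)
  have "smooth_on UNIV (\<lambda>t. flat 0 (1 - t))"
    by (rule smooth_on_compose[OF _ _ _ _ f])
      (auto intro!: smooth_on_diff smooth_on_const smooth_on_bounded_linear[OF bounded_linear_ident])
  then have g: "smooth_on UNIV (\<lambda>t. flat 0 t + flat 0 (1 - t))"
    by (intro smooth_on_add f) auto
  have "flat 0 t + flat 0 (1 - t) \<noteq> 0" for t
    using exp_gt_zero[of "- inverse t"] exp_gt_zero[of "- inverse (1 - t)"]
    by (auto simp: flat_def add_nonneg_eq_0_iff)
  then have "smooth_on UNIV (\<lambda>t. inverse (flat 0 t + flat 0 (1 - t)))"
    by (intro smooth_on_compose[OF _ _ _ g smooth_on_inverse]) (auto simp: open_Collect_neq)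
  then have "smooth_on UNIV (\<lambda>t. flat 0 t * inverse (flat 0 t + flat 0 (1 - t)))"
    by (intro smooth_on_mult f) auto
  then show ?thesis
    by (simp add: step_def[abs_def])
qed

lemma smooth_on_step_comp:
  assumes "open S" "smooth_on S f"
  shows "smooth_on S (\<lambda>x. step (f x))"
  by (rule smooth_on_compose[OF assms(1) open_UNIV _ assms(2) smooth_on_step]) simp

lemma smooth_on_inner_self:
  fixes a :: "'e::{real_inner, heine_borel}"
  shows "smooth_on UNIV (\<lambda>x. (x - a) \<bullet> (x - a))"
proof -
  have "(x - a) \<bullet> (x - a) = (\<Sum>b\<in>onb. ((x - a) \<bullet> b) * ((x - a) \<bullet> b))" for x
    by (subst (2) onb_expand[of "x - a"]) (simp add: inner_sum_right)
  moreover have "smooth_on UNIV (\<lambda>x. (x - a) \<bullet> b)" for b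
    by (rule smooth_on_bounded_linear_comp[OF bounded_linear_inner_left])
      (auto intro!: smooth_on_diff smooth_on_const smooth_on_bounded_linear[OF bounded_linear_ident])
  then have "smooth_on UNIV (\<lambda>x. \<Sum>b\<in>onb. ((x - a) \<bullet> b) * ((x - a) \<bullet> b))"
    by (intro smooth_on_sum smooth_on_mult open_UNIV)
  ultimately show ?thesis by simp
qed

lemma bump_exists:
  fixes a :: "'e::{real_inner, heine_borel}"
  assumes "r > 0"
  obtains b :: "'e \<Rightarrow> real" where "smooth_on UNIV b" "\<And>x. dist x a \<le> r \<Longrightarrow> b x = 1"
    "\<And>x. dist x a \<ge> 2 * r \<Longrightarrow> b x = 0"
proof
  \<comment> \<open>The argument of \<open>step\<close> is affine in the squared distance to
    \<open>a\<close>, which unlike the distance is smooth at \<open>a\<close>. The constants make it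
    1 at distance \<open>r\<close> and 0 at distance \<open>2 * r\<close>.\<close>
  let ?b = "\<lambda>x. step (inverse (3 * r\<^sup>2) * (4 * r\<^sup>2 - (x - a) \<bullet> (x - a)))"
  show "smooth_on UNIV ?b"
    by (intro smooth_on_step_comp smooth_on_mult smooth_on_diff smooth_on_const smooth_on_inner_self open_UNIV)
  have sq: "(x - a) \<bullet> (x - a) = (dist x a)\<^sup>2" for x
    by (simp add: dist_norm power2_norm_eq_inner)
  show "?b x = 1" if "dist x a \<le> r" for x
  proof -
    have "(dist x a)\<^sup>2 \<le> r\<^sup>2"
      using that by (simp add: power_mono)
    then show ?thesis
      using assms by (intro step_1) (simp add: sq field_simps)
  qed
  show "?b x = 0" if "dist x a \<ge> 2 * r" for x
  proof -
    have "(2 * r)\<^sup>2 \<le> (dist x a)\<^sup>2"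
      using that assms by (intro power_mono) auto
    then have "4 * r\<^sup>2 - (x - a) \<bullet> (x - a) \<le> 0"
      by (simp add: sq power_mult_distrib)
    then show ?thesis
      by (intro step_0) (simp add: mult_nonneg_nonpos)
  qed
qed

section \<open>Alternation\<close>

abbreviation sgn_of :: "(nat \<Rightarrow> nat) \<Rightarrow> real"
  where "sgn_of \<sigma> \<equiv> of_int (sign \<sigma>)"

text \<open>Not normalised: on a map of \<open>n\<close> arguments that is already alternating it is
  multiplication by \<open>fact n\<close>.\<close>

definition Alt :: "nat \<Rightarrow> ((nat \<Rightarrow> 'e) \<Rightarrow> real) \<Rightarrow> (nat \<Rightarrow> 'e) \<Rightarrow> real"
  where "Alt n T v = (\<Sum>\<sigma> | \<sigma> permutes {..<n}. sgn_of \<sigma> * T (v \<circ> \<sigma>))"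

lemma finite_perms [simp]: "finite {\<sigma>. \<sigma> permutes {..<n::nat}}"
  by (simp add: finite_permutations)

lemma permutation_lessThan: "\<sigma> permutes {..<n::nat} \<Longrightarrow> permutation \<sigma>"
  using permutation_permutes by blast

lemma sgn_of_compose: "\<sigma> permutes {..<n} \<Longrightarrow> \<tau> permutes {..<n} \<Longrightarrow> sgn_of (\<sigma> \<circ> \<tau>) = sgn_of \<sigma> * sgn_of \<tau>"
  by (simp add: sign_compose permutation_lessThan)

lemma sgn_of_square [simp]: "sgn_of \<sigma> * sgn_of \<sigma> = 1" "sgn_of \<sigma> * (sgn_of \<sigma> * x) = x"
  by (simp_all flip: of_int_mult mult.assoc)

lemma Alt_perm_arg:
  assumes "\<rho> permutes {..<n}"
  shows "Alt n T (v \<circ> \<rho>) = sgn_of \<rho> * Alt n T v"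
proof -
  have "Alt n T v = (\<Sum>\<sigma> | \<sigma> permutes {..<n}. sgn_of (\<rho> \<circ> \<sigma>) * T (v \<circ> (\<rho> \<circ> \<sigma>)))"
    unfolding Alt_def by (rule setum_permutations_compose_left[OF assms])
  also have "\<dots> = sgn_of \<rho> * Alt n T (v \<circ> \<rho>)"
    unfolding Alt_def sum_distrib_left
    by (intro sum.cong refl) (simp add: sgn_of_compose[OF assms] o_assoc mult.assoc)
  finally show ?thesis by simp
qed

lemma Alt_perm_slots:
  assumes "\<rho> permutes {..<n}"
  shows "Alt n (\<lambda>v. T (v \<circ> \<rho>)) v = sgn_of \<rho> * Alt n T v"
proof -
  have "Alt n T v = (\<Sum>\<sigma> | \<sigma> permutes {..<n}. sgn_of (\<sigma> \<circ> \<rho>) * T (v \<circ> (\<sigma> \<circ> \<rho>)))"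
    unfolding Alt_def by (rule sum_permutations_compose_right[OF assms])
  also have "\<dots> = sgn_of \<rho> * Alt n (\<lambda>v. T (v \<circ> \<rho>)) v"
    unfolding Alt_def sum_distrib_left
    by (intro sum.cong refl) (simp add: sgn_of_compose[OF _ assms] o_assoc mult_ac)
  finally show ?thesis by simp
qed

text \<open>Exchanging the two slots reverses the sign of the alternation and yet leaves
  \<open>T\<close> unchanged. Second derivatives cancel by this in the proofs that d d = 0 and that
  d commutes with pullbacks.\<close>

lemma Alt_symmetric_0:
  assumes "i < n" "j < n" "i \<noteq> j" "\<And>v. T (v \<circ> Transposition.transpose i j) = T v"
  shows "Alt n T v = 0"
  using Alt_perm_slots[of "Transposition.transpose i j" n T v] assms
  by (simp add: permutes_swap_id sign_swap_id)

lemma Alt_equal_args_0: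
  assumes "i < n" "j < n" "i \<noteq> j" "v i = v j"
  shows "Alt n T v = 0"
proof -
  have "v \<circ> Transposition.transpose i j = v"
    using assms(4) by (auto simp: Transposition.transpose_def fun_eq_iff)
  then show ?thesis
    using Alt_perm_arg[of "Transposition.transpose i j" n T v] assms
    by (simp add: permutes_swap_id sign_swap_id)
qed

lemma Alt_cong: "(\<And>w. T w = T' w) \<Longrightarrow> Alt n T v = Alt n T' v"
  by (simp add: Alt_def)

lemma Alt_add: "Alt n (\<lambda>v. T v + T' v) v = Alt n T v + Alt n T' v"
  by (simp add: Alt_def distrib_left sum.distrib)

lemma Alt_sum: "Alt n (\<lambda>v. \<Sum>i\<in>I. T i v) v = (\<Sum>i\<in>I. Alt n (T i) v)"
  unfolding Alt_def sum_distrib_left by (rule sum.swap)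

lemma Alt_scale: "Alt n (\<lambda>v. c * T v) v = c * Alt n T v"
  by (simp add: Alt_def sum_distrib_left mult_ac)

definition lift_perm :: "(nat \<Rightarrow> nat) \<Rightarrow> nat \<Rightarrow> nat"
  where "lift_perm \<tau> = case_nat 0 (Suc \<circ> \<tau>)"

lemma lift_perm_simps [simp]: "lift_perm \<tau> 0 = 0" "lift_perm \<tau> (Suc i) = Suc (\<tau> i)"
  by (simp_all add: lift_perm_def)

lemma lift_perm_comp: "lift_perm (\<sigma> \<circ> \<tau>) = lift_perm \<sigma> \<circ> lift_perm \<tau>"
  by (auto simp: fun_eq_iff lift_perm_def split: nat.split)

lemma lift_perm_transpose: "lift_perm (Transposition.transpose a b) = Transposition.transpose (Suc a) (Suc b)"
  by (auto simp: fun_eq_iff lift_perm_def Transposition.transpose_def split: nat.split)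

lemma lift_perm:
  assumes "\<tau> permutes {..<n}"
  shows "lift_perm \<tau> permutes {..<Suc n} \<and> sign (lift_perm \<tau>) = sign \<tau>"
  using assms finite_lessThan
proof (induction rule: permutes_induct)
  case id
  have "lift_perm id = id"
    by (auto simp: fun_eq_iff lift_perm_def split: nat.split)
  then show ?case by (simp only: sign_id permutes_id simp_thms)
next
  case (swap a b p)
  have t: "Transposition.transpose (Suc a) (Suc b) permutes {..<Suc n}" "Transposition.transpose a b permutes {..<n}"
    using swap by (auto intro!: permutes_swap_id)
  have "sign (Transposition.transpose (Suc a) (Suc b) \<circ> lift_perm p) = sign (Transposition.transpose (Suc a) (Suc b)) * sign (lift_perm p)"
    using swap t by (intro sign_compose permutation_lessThan[of _ "Suc n"]) auto
  moreover have "sign (Transposition.transpose a b \<circ> p) = sign (Transposition.transpose a b) * sign p"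
    using swap t by (intro sign_compose permutation_lessThan[of _ n]) auto
  moreover have "lift_perm (Transposition.transpose a b \<circ> p) = Transposition.transpose (Suc a) (Suc b) \<circ> lift_perm p"
    unfolding lift_perm_comp lift_perm_transpose ..
  moreover have "Transposition.transpose (Suc a) (Suc b) \<circ> lift_perm p permutes {..<Suc n}"
    using swap.IH t(1) by (intro permutes_compose) auto
  ultimately show ?case
    using swap.IH swap.hyps by (simp only: sign_swap_id nat.inject)
qed

text \<open>A permutation of the last \<open>n\<close> slots is, via \<open>lift_perm\<close>, one
  of all slots with the same sign. The outer alternation absorbs it, so the inner sum consists of n!
  equal terms.\<close>

lemma Alt_nested_Suc:
  "Alt (Suc n) (\<lambda>w. \<Sum>\<tau> | \<tau> permutes {..<n}. sgn_of \<tau> * T (w 0) (w \<circ> Suc \<circ> \<tau>)) v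
     = fact n * Alt (Suc n) (\<lambda>w. T (w 0) (w \<circ> Suc)) v"
proof -
  have "Alt (Suc n) (\<lambda>w. sgn_of \<tau> * T (w 0) (w \<circ> Suc \<circ> \<tau>)) v = Alt (Suc n) (\<lambda>w. T (w 0) (w \<circ> Suc)) v"
    if \<tau>: "\<tau> permutes {..<n}" for \<tau>
  proof -
    have "Alt (Suc n) (\<lambda>w. T (w 0) (w \<circ> Suc \<circ> \<tau>)) v
      = Alt (Suc n) (\<lambda>w. (\<lambda>w. T (w 0) (w \<circ> Suc)) (w \<circ> lift_perm \<tau>)) v"
      by (intro Alt_cong) (simp add: comp_def)
    also have "\<dots> = sgn_of \<tau> * Alt (Suc n) (\<lambda>w. T (w 0) (w \<circ> Suc)) v"
      using lift_perm[OF \<tau>] by (subst Alt_perm_slots) auto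
    finally show ?thesis
      by (simp add: Alt_scale)
  qed
  then show ?thesis
    by (simp add: Alt_sum card_permutations)
qed

text \<open>The cycle of the positions r, ..., r + i that moves the entry at r + i to the front.\<close>

definition cyc :: "nat \<Rightarrow> nat \<Rightarrow> nat \<Rightarrow> nat"
  where "cyc r i k = (if k < r \<or> k > r + i then k else if k = r then r + i else k - 1)"

text \<open>The cycle is a product of \<open>i\<close> transpositions of neighbours.\<close>

lemma cyc:
  assumes "r + i < n"
  shows "cyc r i permutes {..<n} \<and> sign (cyc r i) = (-1) ^ i"
  using assms
proof (induction i)
  case 0
  have "cyc r 0 = id"
    by (auto simp: cyc_def fun_eq_iff)
  then show ?case by (simp only: sign_id permutes_id) simp
next
  case (Suc i)
  have eq: "cyc r (Suc i) = Transposition.transpose (r + i) (r + Suc i) \<circ> cyc r i"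
    by (auto simp: cyc_def fun_eq_iff Transposition.transpose_def)
  have t: "Transposition.transpose (r + i) (r + Suc i) permutes {..<n}"
    using Suc.prems by (intro permutes_swap_id) auto
  have c: "cyc r i permutes {..<n}" "sign (cyc r i) = (-1) ^ i"
    using Suc by auto
  show ?case
    unfolding eq using permutes_compose[OF c(1) t] sign_compose[OF permutation_lessThan[OF t] permutation_lessThan[OF c(1)]]
    by (simp only: c(2) sign_swap_id) simp
qed

text \<open>The argument list with the entry at \<open>i\<close> omitted, usually marked by a
  hat.\<close>

definition del :: "nat \<Rightarrow> (nat \<Rightarrow> 'e) \<Rightarrow> nat \<Rightarrow> 'e"
  where "del i v = (\<lambda>j. if j < i then v j else v (Suc j))"

lemma del_0: "del 0 v = v \<circ> Suc"
  by (simp add: del_def comp_def)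

text \<open>The sign \<open>(-1) ^ i\<close> is that of the cycle \<open>cyc r i\<close>, so the
  terms that an exterior derivative contributes for the various \<open>i\<close> all have the same
  alternation. The first argument of \<open>T\<close> carries the slots of the other factor of a
  product; the cycle must not disturb them.\<close>

lemma Alt_move_front:
  assumes "r + i < n" and that: "\<And>w w' x y. (\<And>j. j < r \<or> j > r + i \<Longrightarrow> w j = w' j) \<Longrightarrow> T w x y = T w' x y"
  shows "Alt n (\<lambda>w. (-1) ^ i * T w (w (r + i)) (del i (\<lambda>j. w (r + j)))) v
     = Alt n (\<lambda>w. T w (w r) (\<lambda>j. w (Suc (r + j)))) v"
proof -
  have "T (w \<circ> cyc r i) ((w \<circ> cyc r i) r) (\<lambda>j. (w \<circ> cyc r i) (Suc (r + j)))
    = T w (w (r + i)) (del i (\<lambda>j. w (r + j)))" for w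
  proof -
    have "T (w \<circ> cyc r i) = T w"
      by (intro ext that) (auto simp: cyc_def)
    moreover have "(\<lambda>j. (w \<circ> cyc r i) (Suc (r + j))) = del i (\<lambda>j. w (r + j))"
      by (auto simp: fun_eq_iff cyc_def del_def)
    ultimately show ?thesis
      by (simp add: cyc_def)
  qed
  then show ?thesis
    using Alt_perm_slots[of "cyc r i" n "\<lambda>w. T w (w r) (\<lambda>j. w (Suc (r + j)))" v] cyc[OF assms(1)]
    by (simp add: Alt_scale)
qed

section \<open>Alternating multilinear maps\<close>

lemma alternating_cong: "alternating r a \<Longrightarrow> (\<And>i. i < r \<Longrightarrow> v i = w i) \<Longrightarrow> a v = a w"
  and alternating_linear: "alternating r a \<Longrightarrow> i < r \<Longrightarrow> linear (\<lambda>x. a (v(i := x)))"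
  and alternating_eq_0: "alternating r a \<Longrightarrow> i < r \<Longrightarrow> j < r \<Longrightarrow> i \<noteq> j \<Longrightarrow> v i = v j \<Longrightarrow> a v = 0"
  unfolding alternating_def by blast+

text \<open>Polarisation: put the sum of the two entries into both slots and expand.\<close>

lemma multilinear_swap:
  assumes lin: "\<And>i v. i < r \<Longrightarrow> linear (\<lambda>x. a (v(i := x)))" and ij: "i < r" "j < r" "i \<noteq> j"
    and zero: "\<And>v. v i = v j \<Longrightarrow> a v = 0"
  shows "a (v \<circ> Transposition.transpose i j) = - a v"
proof -
  let ?f = "\<lambda>x y. a (v(i := x, j := y))"
  have add1: "?f (x + x') y = ?f x y + ?f x' y" for x x' y
    using linear_add[OF lin[OF ij(1), of "v(j := y)"], of x x'] ij(3) by (simp add: fun_upd_twist)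
  have add2: "?f x (y + y') = ?f x y + ?f x y'" for x y y'
    using linear_add[OF lin[OF ij(2), of "v(i := x)"], of y y'] by simp
  have z: "?f x x = 0" for x
    by (rule zero) (use ij in auto)
  have "?f (v i + v j) (v i + v j) = ?f (v i) (v j) + ?f (v j) (v i)"
    by (simp only: add1 add2, simp only: z add_0_left add_0_right add.commute)
  then have "?f (v j) (v i) = - ?f (v i) (v j)"
    unfolding z by (metis minus_unique)
  moreover have "v \<circ> Transposition.transpose i j = v(i := v j, j := v i)"
    by (auto simp: fun_eq_iff Transposition.transpose_def)
  moreover have "v(i := v i, j := v j) = v"
    by simp
  ultimately show ?thesis by metis
qed

text \<open>Two equal entries at a larger distance are brought together by swapping one of them with
  its neighbour, which only changes the sign; induction on the distance. For \<open>dloc\<close>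
  this leaves a single easy case to check.\<close>

lemma alternatingI_adjacent:
  assumes cong: "\<And>v w. (\<And>i. i < r \<Longrightarrow> v i = w i) \<Longrightarrow> a v = a w"
    and lin: "\<And>i v. i < r \<Longrightarrow> linear (\<lambda>x. a (v(i := x)))"
    and adj: "\<And>i v. Suc i < r \<Longrightarrow> v i = v (Suc i) \<Longrightarrow> a v = 0"
  shows "alternating r a"
proof -
  have zero: "a v = 0" if "i + Suc d < r" "v i = v (i + Suc d)" for i d v
    using that
  proof (induction d arbitrary: v)
    case 0
    then show ?case using adj by auto
  next
    case (Suc d)
    have "a (v \<circ> Transposition.transpose (i + Suc d) (Suc (i + Suc d))) = - a v"
      by (rule multilinear_swap[OF lin]) (use Suc.prems adj in auto)
    moreover have "a (v \<circ> Transposition.transpose (i + Suc d) (Suc (i + Suc d))) = 0"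
      by (rule Suc.IH) (use Suc.prems in \<open>auto simp: Transposition.transpose_def\<close>)
    ultimately show ?case by simp
  qed
  have "a v = 0" if "i < r" "j < r" "i \<noteq> j" "v i = v j" for i j v
  proof (cases "i < j")
    case True
    then have "j = i + Suc (j - Suc i)"
      by linarith
    then show ?thesis using zero[of i "j - Suc i" v] that by simp
  next
    case False
    then have "i = j + Suc (i - Suc j)"
      using that by linarith
    then show ?thesis using zero[of j "i - Suc j" v] that by simp
  qed
  then show ?thesis
    unfolding alternating_def by (intro conjI allI impI cong lin) auto
qed

lemma alternating_perm:
  assumes a: "alternating r a" and \<sigma>: "\<sigma> permutes {..<r}"
  shows "a (v \<circ> \<sigma>) = sgn_of \<sigma> * a v"
  using \<sigma> finite_lessThan
proof (induction arbitrary: v rule: permutes_induct)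
  case id
  show ?case by (simp only: sign_id comp_id of_int_1 mult_1)
next
  case (swap i j p)
  have "a (v \<circ> Transposition.transpose i j) = - a v"
    by (rule multilinear_swap[OF alternating_linear[OF a]]) (use swap alternating_eq_0[OF a] in auto)
  then have "a (v \<circ> (Transposition.transpose i j \<circ> p)) = sgn_of p * - a v"
    using swap.IH[of "v \<circ> Transposition.transpose i j"] by (simp only: o_assoc)
  moreover have "sgn_of (Transposition.transpose i j \<circ> p) = - sgn_of p"
    using swap.hyps permutes_swap_id[of i "{..<r}" j] by (subst sgn_of_compose[of _ r]) (auto simp: sign_swap_id)
  ultimately show ?case
    by (simp only: mult_minus_left mult_minus_right)
qed

lemma Alt_alternating: "alternating r a \<Longrightarrow> Alt r a v = fact r * a v"
  by (simp add: Alt_def alternating_perm card_permutations)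

lemma alternating_0: "alternating r (\<lambda>v. 0)"
  by (simp add: alternating_def linear_iff)

lemma alternating_add:
  assumes a: "alternating r a" and b: "alternating r b"
  shows "alternating r (\<lambda>v. a v + b v)"
  unfolding alternating_def
proof (intro conjI allI impI)
  show "a v + b v = a w + b w" if "\<forall>i<r. v i = w i" for v w
    using alternating_cong[OF a, of v w] alternating_cong[OF b, of v w] that by simp
  show "linear (\<lambda>x. a (v(i := x)) + b (v(i := x)))" if "i < r" for i v
    by (intro linear_compose_add alternating_linear[OF a that] alternating_linear[OF b that])
  show "a v + b v = 0" if "i < r" "j < r" "i \<noteq> j \<and> v i = v j" for i j v
    using alternating_eq_0[OF a that(1,2), of v] alternating_eq_0[OF b that(1,2), of v] that(3) by simp
qed

lemma alternating_scale:
  assumes a: "alternating r a"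
  shows "alternating r (\<lambda>v. c * a v)"
  unfolding alternating_def
proof (intro conjI allI impI)
  show "c * a v = c * a w" if "\<forall>i<r. v i = w i" for v w
    using alternating_cong[OF a, of v w] that by simp
  show "linear (\<lambda>x. c * a (v(i := x)))" if "i < r" for i v
    using linear_compose_scale_right[OF alternating_linear[OF a that], of c] by simp
  show "c * a v = 0" if "i < r" "j < r" "i \<noteq> j \<and> v i = v j" for i j v
    using alternating_eq_0[OF a that(1,2), of v] that(3) by simp
qed

lemma alternating_Alt:
  assumes cong: "\<And>v w. (\<And>i. i < n \<Longrightarrow> v i = w i) \<Longrightarrow> T v = T w"
    and lin: "\<And>i v. i < n \<Longrightarrow> linear (\<lambda>x. T (v(i := x)))"
  shows "alternating n (Alt n T)"
  unfolding alternating_def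
proof (intro conjI allI impI)
  show "Alt n T v = Alt n T w" if "\<forall>i<n. v i = w i" for v w
    unfolding Alt_def
  proof (intro sum.cong refl arg_cong2[of _ _ _ _ "(*)"] cong)
    fix \<sigma> and i assume "\<sigma> \<in> {\<sigma>. \<sigma> permutes {..<n}}" "i < n"
    then have "\<sigma> i < n"
      using permutes_in_image[of \<sigma> "{..<n}" i] by simp
    then show "(v \<circ> \<sigma>) i = (w \<circ> \<sigma>) i" using that by simp
  qed
next
  show "Alt n T v = 0" if "i < n" "j < n" "i \<noteq> j \<and> v i = v j" for v i j
    using that by (intro Alt_equal_args_0[of i _ j]) auto
next
  fix i and v :: "nat \<Rightarrow> 'a" assume i: "i < n"
  have "linear (\<lambda>x. sgn_of \<sigma> * T (v(i := x) \<circ> \<sigma>))" if \<sigma>: "\<sigma> permutes {..<n}" for \<sigma>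
  proof -
    obtain k where k: "k < n" "\<sigma> k = i"
      using permutes_image[OF \<sigma>] i by (metis imageE lessThan_iff)
    have "v(i := x) \<circ> \<sigma> = (v \<circ> \<sigma>)(k := x)" for x
      using k permutes_inj[OF \<sigma>] by (auto simp: fun_eq_iff inj_eq)
    then show ?thesis
      using lin[OF k(1), of "v \<circ> \<sigma>"] by (simp add: linear_iff distrib_left)
  qed
  then show "linear (\<lambda>x. Alt n T (v(i := x)))"
    unfolding Alt_def by (intro linear_compose_sum) auto
qed

section \<open>Differential forms on open subsets of a vector space\<close>

lemma smooth_on_transform:
  "smooth_on S f \<Longrightarrow> open S \<Longrightarrow> (\<And>x. x \<in> S \<Longrightarrow> f x = g x) \<Longrightarrow> smooth_on S g"
  using smooth_on_cong by blast

lemma has_derivative_transform_open: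
  "(f has_derivative f') (at x) \<Longrightarrow> open S \<Longrightarrow> x \<in> S \<Longrightarrow> (\<And>y. y \<in> S \<Longrightarrow> f y = g y) \<Longrightarrow> (g has_derivative f') (at x)"
  by (rule has_derivative_transform_within_open)

definition lform :: "nat \<Rightarrow> 'e::real_normed_vector set \<Rightarrow> ('e \<Rightarrow> (nat \<Rightarrow> 'e) \<Rightarrow> real) \<Rightarrow> bool"
  where "lform r S \<alpha> \<longleftrightarrow> open S \<and> (\<forall>u\<in>S. alternating r (\<alpha> u)) \<and> (\<forall>v. smooth_on S (\<lambda>u. \<alpha> u v))"

definition dd :: "('e::real_normed_vector \<Rightarrow> (nat \<Rightarrow> 'f) \<Rightarrow> real) \<Rightarrow> 'e \<Rightarrow> 'e \<Rightarrow> (nat \<Rightarrow> 'f) \<Rightarrow> real"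
  where "dd \<alpha> u x v = frechet_derivative (\<lambda>u. \<alpha> u v) (at u) x"

text \<open>The invariant formula for the exterior derivative, evaluated on constant vector fields,
  whose brackets vanish.\<close>

definition dloc :: "nat \<Rightarrow> ('e::real_normed_vector \<Rightarrow> (nat \<Rightarrow> 'e) \<Rightarrow> real) \<Rightarrow> 'e \<Rightarrow> (nat \<Rightarrow> 'e) \<Rightarrow> real"
  where "dloc r \<alpha> u v = (\<Sum>i\<le>r. (-1) ^ i * dd \<alpha> u (v i) (del i v))"

lemma lform_open: "lform r S \<alpha> \<Longrightarrow> open S"
  and lform_alternating: "lform r S \<alpha> \<Longrightarrow> u \<in> S \<Longrightarrow> alternating r (\<alpha> u)"
  and lform_smooth: "lform r S \<alpha> \<Longrightarrow> smooth_on S (\<lambda>u. \<alpha> u v)"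
  unfolding lform_def by blast+

lemma has_derivative_dd: "lform r S \<alpha> \<Longrightarrow> u \<in> S \<Longrightarrow> ((\<lambda>u. \<alpha> u v) has_derivative (\<lambda>x. dd \<alpha> u x v)) (at u)"
  unfolding dd_def using smooth_on_has_derivative[OF lform_smooth] by blast

lemma linear_dd: "lform r S \<alpha> \<Longrightarrow> u \<in> S \<Longrightarrow> linear (\<lambda>x. dd \<alpha> u x v)"
  using has_derivative_dd has_derivative_linear by blast

lemma frechet_derivative_eqI: "(f has_derivative f') (at x) \<Longrightarrow> frechet_derivative f (at x) = f'"
  using frechet_derivative_at by metis

lemma dd_eqI: "((\<lambda>u. \<alpha> u v) has_derivative f') (at u) \<Longrightarrow> dd \<alpha> u x v = f' x"
  by (simp add: dd_def frechet_derivative_eqI)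

lemma alternating_expand:
  fixes a :: "(nat \<Rightarrow> 'e::{real_inner, heine_borel}) \<Rightarrow> real"
  assumes "alternating r a" "m < r"
  shows "a (v(m := x)) = (\<Sum>b\<in>onb. (x \<bullet> b) * a (v(m := b)))"
  using linear_onb_expand[OF alternating_linear[OF assms], of v x] by simp

lemma alternating_dd:
  assumes \<alpha>: "lform r S \<alpha>" and u: "u \<in> S"
  shows "alternating r (dd \<alpha> u x)"
  unfolding alternating_def
proof (intro conjI allI impI)
  note alt = lform_alternating[OF \<alpha>] and S = lform_open[OF \<alpha>]
  show "dd \<alpha> u x v = dd \<alpha> u x w" if "\<forall>i<r. v i = w i" for v w
    unfolding dd_def
    by (rule fun_cong[OF frechet_derivative_cong_open[OF S u]]) (use alternating_cong[OF alt] that in blast)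
  show "dd \<alpha> u x v = 0" if "i < r" "j < r" "i \<noteq> j \<and> v i = v j" for i j v
  proof -
    have "frechet_derivative (\<lambda>u. \<alpha> u v) (at u) = frechet_derivative (\<lambda>u. 0) (at u)"
      by (rule frechet_derivative_cong_open[OF S u]) (use alternating_eq_0[OF alt] that in blast)
    then show ?thesis by (simp add: dd_def)
  qed
  show "linear (\<lambda>y. dd \<alpha> u x (v(i := y)))" if i: "i < r" for i v
  proof (rule linearI)
    fix y z and c :: real
    have "((\<lambda>u. \<alpha> u (v(i := y)) + \<alpha> u (v(i := z))) has_derivative
       (\<lambda>x. dd \<alpha> u x (v(i := y)) + dd \<alpha> u x (v(i := z)))) (at u)"
      by (intro has_derivative_add has_derivative_dd[OF \<alpha> u])
    moreover have "\<alpha> w (v(i := y)) + \<alpha> w (v(i := z)) = \<alpha> w (v(i := y + z))" if "w \<in> S" for w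
      using linear_add[OF alternating_linear[OF alt[OF that] i]] by simp
    ultimately have "((\<lambda>u. \<alpha> u (v(i := y + z))) has_derivative
       (\<lambda>x. dd \<alpha> u x (v(i := y)) + dd \<alpha> u x (v(i := z)))) (at u)"
      by (rule has_derivative_transform_open[OF _ S u])
    then show "dd \<alpha> u x (v(i := y + z)) = dd \<alpha> u x (v(i := y)) + dd \<alpha> u x (v(i := z))"
      by (rule dd_eqI)
    have "((\<lambda>u. c * \<alpha> u (v(i := y))) has_derivative (\<lambda>x. c * dd \<alpha> u x (v(i := y)))) (at u)"
      by (intro has_derivative_mult_right has_derivative_dd[OF \<alpha> u])
    moreover have "c * \<alpha> w (v(i := y)) = \<alpha> w (v(i := c *\<^sub>R y))" if "w \<in> S" for w
      using linear_scale[OF alternating_linear[OF alt[OF that] i]] by simp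
    ultimately have "((\<lambda>u. \<alpha> u (v(i := c *\<^sub>R y))) has_derivative (\<lambda>x. c * dd \<alpha> u x (v(i := y)))) (at u)"
      by (rule has_derivative_transform_open[OF _ S u])
    then show "dd \<alpha> u x (v(i := c *\<^sub>R y)) = c *\<^sub>R dd \<alpha> u x (v(i := y))"
      unfolding real_scaleR_def by (rule dd_eqI)
  qed
qed

lemma del_upd_same: "del i (v(i := x)) = del i v"
  by (auto simp: del_def fun_eq_iff)

lemma del_upd_other: "i \<noteq> j \<Longrightarrow> del i (v(j := x)) = (del i v)((if j < i then j else j - 1) := x)"
  by (auto simp: del_def fun_eq_iff)

text \<open>If the entries at \<open>j\<close> and \<open>Suc j\<close> agree, a term omitting
  neither of them vanishes, since both remain as arguments. The two other terms omit equal entries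
  and have opposite signs.\<close>

lemma dloc_alternating:
  assumes \<alpha>: "lform r S \<alpha>" and u: "u \<in> S"
  shows "alternating (Suc r) (dloc r \<alpha> u)"
proof (rule alternatingI_adjacent)
  note alt = alternating_dd[OF \<alpha> u]
  show "dloc r \<alpha> u v = dloc r \<alpha> u w" if "\<And>i. i < Suc r \<Longrightarrow> v i = w i" for v w
    unfolding dloc_def
  proof (intro sum.cong refl)
    fix i assume i: "i \<in> {..r}"
    have "dd \<alpha> u x (del i v) = dd \<alpha> u x (del i w)" for x
      by (rule alternating_cong[OF alt]) (use that in \<open>auto simp: del_def\<close>)
    then show "(-1) ^ i * dd \<alpha> u (v i) (del i v) = (-1) ^ i * dd \<alpha> u (w i) (del i w)"
      using that i by simp
  qed
  show "linear (\<lambda>x. dloc r \<alpha> u (v(j := x)))" if j: "j < Suc r" for j v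
    unfolding dloc_def
  proof (intro linear_compose_sum ballI)
    fix i assume i: "i \<in> {..r}"
    show "linear (\<lambda>x. (-1) ^ i * dd \<alpha> u ((v(j := x)) i) (del i (v(j := x))))"
    proof (cases "i = j")
      case True
      then show ?thesis
        using linear_compose_scale_right[OF linear_dd[OF \<alpha> u], of "(-1) ^ i" "del i v"]
        by (simp add: del_upd_same)
    next
      case False
      then have "(if j < i then j else j - 1) < r"
        using i j by auto
      from linear_compose_scale_right[OF alternating_linear[OF alt this], of "(-1) ^ i" "v i" "del i v"]
      show ?thesis
        using False by (simp add: del_upd_other)
    qed
  qed
  show "dloc r \<alpha> u v = 0" if j: "Suc j < Suc r" "v j = v (Suc j)" for j v
  proof -
    let ?t = "\<lambda>i. (-1) ^ i * dd \<alpha> u (v i) (del i v)"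
    have "?t i = 0" if "i \<in> {..r} - {j, Suc j}" for i
    proof -
      have "dd \<alpha> u (v i) (del i v) = 0"
      proof (cases "i < j")
        case True
        then show ?thesis
          using j by (intro alternating_eq_0[OF alt, of "j - 1" j]) (auto simp: del_def)
      next
        case False
        then show ?thesis
          using j that by (intro alternating_eq_0[OF alt, of j "Suc j"]) (auto simp: del_def)
      qed
      then show ?thesis by simp
    qed
    then have "dloc r \<alpha> u v = (\<Sum>i\<in>{j, Suc j}. ?t i)"
      unfolding dloc_def by (intro sum.mono_neutral_right) (use j in auto)
    moreover have "del j v = del (Suc j) v"
      using j(2) by (auto simp: del_def fun_eq_iff less_Suc_eq)
    ultimately show ?thesis
      using j(2) by simp
  qed
qed

lemma smooth_on_dd: "lform r S \<alpha> \<Longrightarrow> smooth_on S (\<lambda>u. dd \<alpha> u x v)"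
  unfolding dd_def by (rule smooth_on_deriv[OF lform_smooth])

lemma lform_dloc: "lform r S \<alpha> \<Longrightarrow> lform (Suc r) S (dloc r \<alpha>)"
  unfolding lform_def[of "Suc r"]
  by (intro conjI ballI allI dloc_alternating lform_open)
    (auto simp: dloc_def intro!: smooth_on_sum smooth_on_mult smooth_on_const smooth_on_dd lform_open)

text \<open>Alternating the alternating map \<open>dloc r \<alpha> u\<close> multiplies it by
  (r+1)!, while each of its r + 1 terms has the alternation on the right by
  \<open>Alt_move_front\<close>; cancel r + 1. In this form d no longer singles out
  positions.\<close>

lemma dloc_Alt:
  assumes \<alpha>: "lform r S \<alpha>" and u: "u \<in> S"
  shows "fact r * dloc r \<alpha> u v = Alt (Suc r) (\<lambda>w. dd \<alpha> u (w 0) (w \<circ> Suc)) v"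
proof -
  have "fact (Suc r) * dloc r \<alpha> u v = Alt (Suc r) (dloc r \<alpha> u) v"
    by (simp only: Alt_alternating[OF dloc_alternating[OF \<alpha> u]])
  also have "\<dots> = (\<Sum>i\<le>r. Alt (Suc r) (\<lambda>w. (-1) ^ i * dd \<alpha> u (w (0 + i)) (del i (\<lambda>j. w (0 + j)))) v)"
    by (subst Alt_sum[symmetric]) (simp add: dloc_def[abs_def])
  also have "\<dots> = (\<Sum>i\<le>r. Alt (Suc r) (\<lambda>w. dd \<alpha> u (w 0) (\<lambda>j. w (Suc (0 + j)))) v)"
    by (intro sum.cong refl Alt_move_front[where T = "\<lambda>w. dd \<alpha> u"]) auto
  also have "\<dots> = real (Suc r) * Alt (Suc r) (\<lambda>w. dd \<alpha> u (w 0) (w \<circ> Suc)) v"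
    by (simp add: comp_def)
  finally have "real (Suc r) * (fact r * dloc r \<alpha> u v) = real (Suc r) * Alt (Suc r) (\<lambda>w. dd \<alpha> u (w 0) (w \<circ> Suc)) v"
    by (simp add: mult.assoc)
  then show ?thesis
    unfolding mult_cancel_left by (simp del: of_nat_Suc)
qed

text \<open>The derivative of a form evaluated at varying vectors: the slots are made variable one at a
  time, each time expanding in an orthonormal basis.\<close>

lemma lform_eval_aux:
  fixes f :: "'a::{real_inner, heine_borel} \<Rightarrow> 'b::{real_inner, heine_borel}"
  assumes \<alpha>: "lform r T \<alpha>" and S: "open S" and f: "f ` S \<subseteq> T" "smooth_on S f"
    and w: "\<And>i. i < r \<Longrightarrow> smooth_on S (w i)" and m: "m \<le> r"
  shows "smooth_on S (\<lambda>u. \<alpha> (f u) (\<lambda>i. if i < m then w i u else v i)) \<and>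
    (\<forall>u\<in>S. ((\<lambda>u. \<alpha> (f u) (\<lambda>i. if i < m then w i u else v i)) has_derivative
      (\<lambda>x. dd \<alpha> (f u) (frechet_derivative f (at u) x) (\<lambda>i. if i < m then w i u else v i) +
         (\<Sum>j<m. \<alpha> (f u) ((\<lambda>i. if i < m then w i u else v i)(j := frechet_derivative (w j) (at u) x))))) (at u))"
  using m
proof (induction m arbitrary: v)
  case 0
  have "smooth_on S (\<lambda>u. \<alpha> (f u) v)"
    by (rule smooth_on_compose[OF S lform_open[OF \<alpha>] f lform_smooth[OF \<alpha>]])
  moreover have "((\<lambda>u. \<alpha> (f u) v) has_derivative (\<lambda>x. dd \<alpha> (f u) (frechet_derivative f (at u) x) v)) (at u)"
    if "u \<in> S" for u
    using has_derivative_compose[OF smooth_on_has_derivative[OF f(2) that] has_derivative_dd[OF \<alpha>]] f(1) that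
    by (auto simp: image_subset_iff)
  ultimately show ?case by simp
next
  case (Suc m)
  let ?W = "\<lambda>v u i. if i < m then w i u else v i"
  let ?W' = "\<lambda>u i. if i < Suc m then w i u else v i"
  have m: "m < r" and mr: "m \<le> r" using Suc.prems by auto
  have W': "?W' u = (?W v u)(m := w m u)" and Wb: "?W (v(m := b)) u = (?W v u)(m := b)" for u b
    by (auto simp: fun_eq_iff)
  have alt: "alternating r (\<alpha> (f u))" "alternating r (dd \<alpha> (f u) x)" if "u \<in> S" for u x
    using lform_alternating[OF \<alpha>] alternating_dd[OF \<alpha>] f(1) that by auto
  have eq: "\<alpha> (f u) (?W' u) = (\<Sum>b\<in>onb. (w m u \<bullet> b) * \<alpha> (f u) (?W (v(m := b)) u))" if "u \<in> S" for u
    unfolding W' Wb by (rule alternating_expand[OF alt(1)[OF that] m])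
  have sm: "smooth_on S (\<lambda>u. w m u \<bullet> b)" for b
    by (rule smooth_on_bounded_linear_comp[OF bounded_linear_inner_left S w[OF m]])
  have "smooth_on S (\<lambda>u. \<Sum>b\<in>onb. (w m u \<bullet> b) * \<alpha> (f u) (?W (v(m := b)) u))"
    using Suc.IH[OF mr] by (intro smooth_on_sum smooth_on_mult S sm) blast
  then have 1: "smooth_on S (\<lambda>u. \<alpha> (f u) (?W' u))"
    by (rule smooth_on_transform[OF _ S]) (simp only: eq)
  have 2: "((\<lambda>u. \<alpha> (f u) (?W' u)) has_derivative
      (\<lambda>x. dd \<alpha> (f u) (frechet_derivative f (at u) x) (?W' u) +
         (\<Sum>j<Suc m. \<alpha> (f u) ((?W' u)(j := frechet_derivative (w j) (at u) x))))) (at u)"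
    if u: "u \<in> S" for u
  proof -
    let ?D = "\<lambda>x b. dd \<alpha> (f u) (frechet_derivative f (at u) x) (?W (v(m := b)) u) +
         (\<Sum>j<m. \<alpha> (f u) ((?W (v(m := b)) u)(j := frechet_derivative (w j) (at u) x)))"
    have "((\<lambda>u. \<Sum>b\<in>onb. (w m u \<bullet> b) * \<alpha> (f u) (?W (v(m := b)) u)) has_derivative
       (\<lambda>x. \<Sum>b\<in>onb. (w m u \<bullet> b) * ?D x b + (frechet_derivative (w m) (at u) x \<bullet> b) * \<alpha> (f u) (?W (v(m := b)) u))) (at u)"
      using Suc.IH[OF mr] u
      by (intro has_derivative_sum has_derivative_mult
          bounded_linear.has_derivative[OF bounded_linear_inner_left smooth_on_has_derivative[OF w[OF m] u]]) blast
    then have *: "((\<lambda>u. \<alpha> (f u) (?W' u)) has_derivative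
       (\<lambda>x. \<Sum>b\<in>onb. (w m u \<bullet> b) * ?D x b + (frechet_derivative (w m) (at u) x \<bullet> b) * \<alpha> (f u) (?W (v(m := b)) u))) (at u)"
      by (rule has_derivative_transform_open[OF _ S u]) (simp only: eq)
    have "(\<Sum>b\<in>onb. (w m u \<bullet> b) * ?D x b + (frechet_derivative (w m) (at u) x \<bullet> b) * \<alpha> (f u) (?W (v(m := b)) u))
      = dd \<alpha> (f u) (frechet_derivative f (at u) x) (?W' u) +
         (\<Sum>j<Suc m. \<alpha> (f u) ((?W' u)(j := frechet_derivative (w j) (at u) x)))" for x
    proof -
      have a: "(\<Sum>b\<in>onb. (w m u \<bullet> b) * dd \<alpha> (f u) (frechet_derivative f (at u) x) (?W (v(m := b)) u))
        = dd \<alpha> (f u) (frechet_derivative f (at u) x) (?W' u)"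
        unfolding W' Wb by (rule alternating_expand[OF alt(2)[OF u] m, symmetric])
      have b: "(\<Sum>b\<in>onb. (w m u \<bullet> b) * \<alpha> (f u) ((?W (v(m := b)) u)(j := y))) = \<alpha> (f u) ((?W' u)(j := y))"
        if "j < m" for j y
      proof -
        have "(?W (v(m := b)) u)(j := y) = ((?W v u)(j := y))(m := b)" for b
          unfolding Wb using that by (simp add: fun_upd_twist)
        moreover have "(?W' u)(j := y) = ((?W v u)(j := y))(m := w m u)"
          unfolding W' using that by (simp add: fun_upd_twist)
        ultimately show ?thesis
          using alternating_expand[OF alt(1)[OF u] m, symmetric] by (simp only:)
      qed
      have c: "(\<Sum>b\<in>onb. (y \<bullet> b) * \<alpha> (f u) (?W (v(m := b)) u)) = \<alpha> (f u) ((?W' u)(m := y))" for y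
        unfolding W' Wb fun_upd_upd by (rule alternating_expand[OF alt(1)[OF u] m, symmetric])
      have "(\<Sum>b\<in>onb. (w m u \<bullet> b) * (\<Sum>j<m. \<alpha> (f u) ((?W (v(m := b)) u)(j := frechet_derivative (w j) (at u) x))))
        = (\<Sum>j<m. \<Sum>b\<in>onb. (w m u \<bullet> b) * \<alpha> (f u) ((?W (v(m := b)) u)(j := frechet_derivative (w j) (at u) x)))"
        unfolding sum_distrib_left by (rule sum.swap)
      also have "\<dots> = (\<Sum>j<m. \<alpha> (f u) ((?W' u)(j := frechet_derivative (w j) (at u) x)))"
        by (intro sum.cong refl b) simp
      finally show ?thesis
        unfolding distrib_left sum.distrib a c by simp
    qed
    then show ?thesis
      using * by simp
  qed
  show ?case using 1 2 by blast
qed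

lemma lform_eval:
  fixes f :: "'a::{real_inner, heine_borel} \<Rightarrow> 'b::{real_inner, heine_borel}"
  assumes \<alpha>: "lform r T \<alpha>" and S: "open S" and f: "f ` S \<subseteq> T" "smooth_on S f"
    and w: "\<And>i. smooth_on S (w i)"
  shows "smooth_on S (\<lambda>u. \<alpha> (f u) (\<lambda>i. w i u))"
    "u \<in> S \<Longrightarrow> frechet_derivative (\<lambda>u. \<alpha> (f u) (\<lambda>i. w i u)) (at u) x
      = dd \<alpha> (f u) (frechet_derivative f (at u) x) (\<lambda>i. w i u) +
         (\<Sum>j<r. \<alpha> (f u) ((\<lambda>i. w i u)(j := frechet_derivative (w j) (at u) x)))"
proof -
  let ?W = "\<lambda>u i. if i < r then w i u else 0"
  have fu: "f u \<in> T" if "u \<in> S" for u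
    using f(1) that by auto
  have eq: "\<alpha> (f u) (?W u) = \<alpha> (f u) (\<lambda>i. w i u)" if "u \<in> S" for u
    by (rule alternating_cong[OF lform_alternating[OF \<alpha> fu[OF that]]]) simp
  have A: "smooth_on S (\<lambda>u. \<alpha> (f u) (?W u)) \<and>
    (\<forall>u\<in>S. ((\<lambda>u. \<alpha> (f u) (?W u)) has_derivative
      (\<lambda>x. dd \<alpha> (f u) (frechet_derivative f (at u) x) (?W u) +
         (\<Sum>j<r. \<alpha> (f u) ((?W u)(j := frechet_derivative (w j) (at u) x))))) (at u))"
    by (rule lform_eval_aux[OF \<alpha> S f w order_refl])
  from this[THEN conjunct1] show "smooth_on S (\<lambda>u. \<alpha> (f u) (\<lambda>i. w i u))"
    by (rule smooth_on_transform[OF _ S]) (simp only: eq)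
  assume u: "u \<in> S"
  have "frechet_derivative (\<lambda>u. \<alpha> (f u) (\<lambda>i. w i u)) (at u) = frechet_derivative (\<lambda>u. \<alpha> (f u) (?W u)) (at u)"
    by (rule frechet_derivative_cong_open[OF S u]) (simp only: eq)
  then have "frechet_derivative (\<lambda>u. \<alpha> (f u) (\<lambda>i. w i u)) (at u) x
    = dd \<alpha> (f u) (frechet_derivative f (at u) x) (?W u) +
         (\<Sum>j<r. \<alpha> (f u) ((?W u)(j := frechet_derivative (w j) (at u) x)))"
    using frechet_derivative_eqI[OF A[THEN conjunct2, rule_format, OF u]] by simp
  also have "dd \<alpha> (f u) y (?W u) = dd \<alpha> (f u) y (\<lambda>i. w i u)" for y
    by (rule alternating_cong[OF alternating_dd[OF \<alpha> fu[OF u]]]) simp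
  also have "(\<Sum>j<r. \<alpha> (f u) ((?W u)(j := frechet_derivative (w j) (at u) x)))
    = (\<Sum>j<r. \<alpha> (f u) ((\<lambda>i. w i u)(j := frechet_derivative (w j) (at u) x)))"
    by (intro sum.cong refl alternating_cong[OF lform_alternating[OF \<alpha> fu[OF u]]]) simp
  finally show "frechet_derivative (\<lambda>u. \<alpha> (f u) (\<lambda>i. w i u)) (at u) x
      = dd \<alpha> (f u) (frechet_derivative f (at u) x) (\<lambda>i. w i u) +
         (\<Sum>j<r. \<alpha> (f u) ((\<lambda>i. w i u)(j := frechet_derivative (w j) (at u) x)))" .
qed

definition pullback :: "('a::real_normed_vector \<Rightarrow> 'b::real_normed_vector) \<Rightarrow> ('b \<Rightarrow> (nat \<Rightarrow> 'b) \<Rightarrow> real) \<Rightarrow>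
    'a \<Rightarrow> (nat \<Rightarrow> 'a) \<Rightarrow> real"
  where "pullback f \<alpha> u v = \<alpha> (f u) (\<lambda>i. frechet_derivative f (at u) (v i))"

lemma alternating_linear_comp:
  assumes a: "alternating r a" and L: "linear L"
  shows "alternating r (\<lambda>v. a (\<lambda>i. L (v i)))"
  unfolding alternating_def
proof (intro conjI allI impI)
  show "a (\<lambda>i. L (v i)) = a (\<lambda>i. L (w i))" if "\<forall>i<r. v i = w i" for v w
    by (rule alternating_cong[OF a]) (use that in simp)
  show "a (\<lambda>i. L (v i)) = 0" if "i < r" "j < r" "i \<noteq> j \<and> v i = v j" for i j v
    by (rule alternating_eq_0[OF a that(1,2)]) (use that in auto)
  show "linear (\<lambda>x. a (\<lambda>j. L ((v(i := x)) j)))" if "i < r" for i v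
  proof -
    have "(\<lambda>j. L ((v(i := x)) j)) = (\<lambda>j. L (v j))(i := L x)" for x
      by (auto simp: fun_eq_iff)
    then show ?thesis
      using linear_compose[OF L alternating_linear[OF a that]] by (simp add: o_def)
  qed
qed

lemma lform_pullback:
  fixes f :: "'a::{real_inner, heine_borel} \<Rightarrow> 'b::{real_inner, heine_borel}"
  assumes \<alpha>: "lform r T \<alpha>" and S: "open S" and f: "f ` S \<subseteq> T" "smooth_on S f"
  shows "lform r S (pullback f \<alpha>)"
  unfolding lform_def
proof (intro conjI ballI allI S)
  show "alternating r (pullback f \<alpha> u)" if "u \<in> S" for u
    unfolding pullback_def
    by (rule alternating_linear_comp[OF lform_alternating[OF \<alpha>] smooth_on_linear_deriv[OF f(2) that]]) (use f that in auto)
  show "smooth_on S (\<lambda>u. pullback f \<alpha> u v)" for v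
    unfolding pullback_def by (rule lform_eval(1)[OF \<alpha> S f]) (rule smooth_on_deriv[OF f(2)])
qed

text \<open>The second derivatives of f contribute terms that are symmetric in two of the arguments, so
  they disappear under alternation.\<close>

lemma dloc_pullback:
  fixes f :: "'a::{real_inner, heine_borel} \<Rightarrow> 'b::{real_inner, heine_borel}"
  assumes \<alpha>: "lform r T \<alpha>" and S: "open S" and f: "f ` S \<subseteq> T" "smooth_on S f" and u: "u \<in> S"
  shows "dloc r (pullback f \<alpha>) u v = pullback f (dloc r \<alpha>) u v"
proof -
  let ?Df = "frechet_derivative f (at u)"
  let ?D2 = "\<lambda>x y. frechet_derivative (\<lambda>u. frechet_derivative f (at u) y) (at u) x"
  have fu: "f u \<in> T" using f(1) u by auto
  have *: "dd (pullback f \<alpha>) u x y = dd \<alpha> (f u) (?Df x) (\<lambda>i. ?Df (y i)) +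
      (\<Sum>j<r. \<alpha> (f u) ((\<lambda>i. ?Df (y i))(j := ?D2 x (y j))))" for x y
    unfolding dd_def[of "pullback f \<alpha>"] pullback_def
    by (rule lform_eval(2)[OF \<alpha> S f smooth_on_deriv[OF f(2)] u])
  have zero: "Alt (Suc r) (\<lambda>w. \<alpha> (f u) ((\<lambda>i. ?Df ((w \<circ> Suc) i))(j := ?D2 (w 0) ((w \<circ> Suc) j)))) v = 0"
    if j: "j < r" for j
  proof (rule Alt_symmetric_0[of 0 _ "Suc j"])
    fix w :: "nat \<Rightarrow> 'a"
    have "(\<lambda>i. ?Df ((w \<circ> Transposition.transpose 0 (Suc j) \<circ> Suc) i))
        (j := ?D2 ((w \<circ> Transposition.transpose 0 (Suc j)) 0) ((w \<circ> Transposition.transpose 0 (Suc j) \<circ> Suc) j))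
      = (\<lambda>i. ?Df ((w \<circ> Suc) i))(j := ?D2 (w 0) ((w \<circ> Suc) j))"
      using symmetric_second_deriv_vec[OF f(2) S u, of "w 0" "w (Suc j)"]
      by (auto simp: fun_eq_iff Transposition.transpose_def)
    then show "\<alpha> (f u) ((\<lambda>i. ?Df ((w \<circ> Transposition.transpose 0 (Suc j) \<circ> Suc) i))
        (j := ?D2 ((w \<circ> Transposition.transpose 0 (Suc j)) 0) ((w \<circ> Transposition.transpose 0 (Suc j) \<circ> Suc) j)))
      = \<alpha> (f u) ((\<lambda>i. ?Df ((w \<circ> Suc) i))(j := ?D2 (w 0) ((w \<circ> Suc) j)))"
      by (simp only:)
  qed (use j in auto)
  have "fact r * dloc r (pullback f \<alpha>) u v = Alt (Suc r) (\<lambda>w. dd (pullback f \<alpha>) u (w 0) (w \<circ> Suc)) v"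
    by (rule dloc_Alt[OF lform_pullback[OF \<alpha> S f] u])
  also have "\<dots> = Alt (Suc r) (\<lambda>w. dd \<alpha> (f u) (?Df (w 0)) (\<lambda>i. ?Df ((w \<circ> Suc) i))) v"
    unfolding * by (subst Alt_add, subst Alt_sum, subst sum.neutral) (use zero in auto)
  also have "\<dots> = Alt (Suc r) (\<lambda>w. dd \<alpha> (f u) (w 0) (w \<circ> Suc)) (\<lambda>i. ?Df (v i))"
    by (simp add: Alt_def comp_def)
  also have "\<dots> = fact r * dloc r \<alpha> (f u) (\<lambda>i. ?Df (v i))"
    by (rule dloc_Alt[OF \<alpha> fu, symmetric])
  finally show ?thesis
    by (simp add: pullback_def)
qed

text \<open>Up to factorials, d d is the alternation of the second derivatives of the coefficients,
  which are symmetric in the first two slots. The inner alternation coming from the first d is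
  absorbed by \<open>Alt_nested_Suc\<close>.\<close>

lemma dloc_dloc:
  fixes \<alpha> :: "'a::{real_inner, heine_borel} \<Rightarrow> (nat \<Rightarrow> 'a) \<Rightarrow> real"
  assumes \<alpha>: "lform r S \<alpha>" and u: "u \<in> S"
  shows "dloc (Suc r) (dloc r \<alpha>) u v = 0"
proof -
  note S = lform_open[OF \<alpha>]
  let ?T = "\<lambda>x y. frechet_derivative (\<lambda>u. dd \<alpha> u (y 0) (y \<circ> Suc)) (at u) x"
  have D: "fact r * dd (dloc r \<alpha>) u x y = (\<Sum>\<tau> | \<tau> permutes {..<Suc r}. sgn_of \<tau> * ?T x (y \<circ> \<tau>))" for x y
  proof -
    have "((\<lambda>u. \<Sum>\<tau> | \<tau> permutes {..<Suc r}. sgn_of \<tau> * dd \<alpha> u ((y \<circ> \<tau>) 0) ((y \<circ> \<tau>) \<circ> Suc)) has_derivative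
        (\<lambda>x. \<Sum>\<tau> | \<tau> permutes {..<Suc r}. sgn_of \<tau> * ?T x (y \<circ> \<tau>))) (at u)"
      by (intro has_derivative_sum has_derivative_mult_right smooth_on_has_derivative[OF smooth_on_dd[OF \<alpha>] u])
    then have "((\<lambda>u. fact r * dloc r \<alpha> u y) has_derivative
        (\<lambda>x. \<Sum>\<tau> | \<tau> permutes {..<Suc r}. sgn_of \<tau> * ?T x (y \<circ> \<tau>))) (at u)"
      by (rule has_derivative_transform_open[OF _ S u]) (simp only: dloc_Alt[OF \<alpha>] Alt_def)
    moreover have "((\<lambda>u. fact r * dloc r \<alpha> u y) has_derivative (\<lambda>x. fact r * dd (dloc r \<alpha>) u x y)) (at u)"
      by (intro has_derivative_mult_right has_derivative_dd[OF lform_dloc[OF \<alpha>] u])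
    ultimately show ?thesis
      by (intro fun_cong[OF has_derivative_unique])
  qed
  have zero: "Alt (Suc (Suc r)) (\<lambda>w. ?T (w 0) (w \<circ> Suc)) v = 0"
  proof (rule Alt_symmetric_0[of 0 _ 1])
    fix w :: "nat \<Rightarrow> 'a"
    let ?w = "w \<circ> Transposition.transpose 0 1"
    have "?w \<circ> Suc \<circ> Suc = w \<circ> Suc \<circ> Suc"
      by (auto simp: fun_eq_iff Transposition.transpose_def)
    then have "?T (?w 0) (?w \<circ> Suc) = frechet_derivative (\<lambda>u. dd \<alpha> u (w 0) (w \<circ> Suc \<circ> Suc)) (at u) (w 1)"
      by simp
    also have "\<dots> = frechet_derivative (\<lambda>u. dd \<alpha> u (w 1) (w \<circ> Suc \<circ> Suc)) (at u) (w 0)"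
      unfolding dd_def by (rule symmetric_second_deriv[OF lform_smooth[OF \<alpha>] S u])
    finally show "?T (?w 0) (?w \<circ> Suc) = ?T (w 0) (w \<circ> Suc)"
      by simp
  qed auto
  have "fact r * (fact (Suc r) * dloc (Suc r) (dloc r \<alpha>) u v)
    = Alt (Suc (Suc r)) (\<lambda>w. fact r * dd (dloc r \<alpha>) u (w 0) (w \<circ> Suc)) v"
    by (simp only: dloc_Alt[OF lform_dloc[OF \<alpha>] u] Alt_scale)
  also have "\<dots> = fact (Suc r) * Alt (Suc (Suc r)) (\<lambda>w. ?T (w 0) (w \<circ> Suc)) v"
    unfolding D by (rule Alt_nested_Suc[of "Suc r" ?T])
  finally show ?thesis
    unfolding zero by simp
qed

section \<open>The exterior product and its product rule\<close>

definition wloc :: "nat \<Rightarrow> nat \<Rightarrow> ('a \<Rightarrow> (nat \<Rightarrow> 'e) \<Rightarrow> real) \<Rightarrow> ('a \<Rightarrow> (nat \<Rightarrow> 'e) \<Rightarrow> real) \<Rightarrow>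
    'a \<Rightarrow> (nat \<Rightarrow> 'e) \<Rightarrow> real"
  where "wloc r s \<alpha> \<beta> u v = Alt (r + s) (\<lambda>w. \<alpha> u w * \<beta> u (\<lambda>i. w (r + i))) v / (fact r * fact s)"

lemma linear_times_const: "linear f \<Longrightarrow> linear (\<lambda>x. f x * c :: real)"
  by (simp add: linear_iff distrib_right)

lemma alternating_wedge:
  assumes a: "alternating r a" and b: "alternating s b"
  shows "alternating (r + s) (\<lambda>v. Alt (r + s) (\<lambda>w. a w * b (\<lambda>i. w (r + i))) v / (fact r * fact s))"
proof -
  have "alternating (r + s) (Alt (r + s) (\<lambda>w. a w * b (\<lambda>i. w (r + i))))"
  proof (rule alternating_Alt)
    show "a v * b (\<lambda>i. v (r + i)) = a w * b (\<lambda>i. w (r + i))" if "\<And>i. i < r + s \<Longrightarrow> v i = w i" for v w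
      using alternating_cong[OF a, of v w] alternating_cong[OF b, of "\<lambda>i. v (r + i)" "\<lambda>i. w (r + i)"] that by simp
    show "linear (\<lambda>x. a (v(i := x)) * b (\<lambda>j. (v(i := x)) (r + j)))" if i: "i < r + s" for i v
    proof (cases "i < r")
      case True
      then have "(\<lambda>j. (v(i := x)) (r + j)) = (\<lambda>j. v (r + j))" for x
        by auto
      then show ?thesis
        using linear_times_const[OF alternating_linear[OF a True]] by simp
    next
      case False
      have "a (v(i := x)) = a v" for x
        by (rule alternating_cong[OF a]) (use False in auto)
      moreover have "(\<lambda>j. (v(i := x)) (r + j)) = (\<lambda>j. v (r + j))(i - r := x)" for x
        using False by (auto simp: fun_eq_iff)
      moreover have "i - r < s" using i False by auto
      ultimately show ?thesis
        using linear_times_const[OF alternating_linear[OF b, of "i - r" "\<lambda>j. v (r + j)"], of "a v"]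
        by (simp add: mult.commute)
    qed
  qed
  from alternating_scale[OF this, of "inverse (fact r * fact s)"] show ?thesis
    by (simp add: divide_inverse mult.commute)
qed

lemma lform_wloc:
  assumes \<alpha>: "lform r S \<alpha>" and \<beta>: "lform s S \<beta>"
  shows "lform (r + s) S (wloc r s \<alpha> \<beta>)"
  unfolding lform_def
proof (intro conjI ballI allI)
  note S = lform_open[OF \<alpha>]
  show "open S" by (rule S)
  show "alternating (r + s) (wloc r s \<alpha> \<beta> u)" if "u \<in> S" for u
    unfolding wloc_def by (rule alternating_wedge[OF lform_alternating[OF \<alpha> that] lform_alternating[OF \<beta> that]])
  show "smooth_on S (\<lambda>u. wloc r s \<alpha> \<beta> u v)" for v
    unfolding wloc_def Alt_def divide_inverse
    by (intro smooth_on_mult smooth_on_sum smooth_on_const lform_smooth[OF \<alpha>] lform_smooth[OF \<beta>] S)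
qed

text \<open>Differentiating the product of coefficients gives \<open>A1\<close>, where the
  derivative falls on \<open>\<alpha>\<close>, and \<open>A2\<close>, where it falls on
  \<open>\<beta>\<close>. In both of them the direction of differentiation sits in the first slot.
  For \<open>A1\<close> this is where d \<open>\<alpha>\<close> expects it; for \<open>A2\<close> it
  has to pass the slots of \<open>\<alpha>\<close>, hence the sign.\<close>

lemma dloc_wloc:
  assumes \<alpha>: "lform r S \<alpha>" and \<beta>: "lform s S \<beta>" and u: "u \<in> S"
  shows "dloc (r + s) (wloc r s \<alpha> \<beta>) u v
    = wloc (Suc r) s (dloc r \<alpha>) \<beta> u v + (-1) ^ r * wloc r (Suc s) \<alpha> (dloc s \<beta>) u v"
proof -
  note S = lform_open[OF \<alpha>] and a = lform_alternating[OF \<alpha> u]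
  let ?n = "r + s" and ?c = "fact r * fact s :: real"
  let ?T = "\<lambda>x y. dd \<alpha> u x y * \<beta> u (\<lambda>i. y (r + i)) + \<alpha> u y * dd \<beta> u x (\<lambda>i. y (r + i))"
  define A1 where "A1 = Alt (Suc ?n) (\<lambda>w. dd \<alpha> u (w 0) (w \<circ> Suc) * \<beta> u (\<lambda>i. (w \<circ> Suc) (r + i))) v"
  define A2 where "A2 = Alt (Suc ?n) (\<lambda>w. \<alpha> u (w \<circ> Suc) * dd \<beta> u (w 0) (\<lambda>i. (w \<circ> Suc) (r + i))) v"
  have D: "?c * dd (wloc r s \<alpha> \<beta>) u x y = (\<Sum>\<tau> | \<tau> permutes {..<?n}. sgn_of \<tau> * ?T x (y \<circ> \<tau>))" for x y
  proof -
    have "((\<lambda>u. \<Sum>\<tau> | \<tau> permutes {..<?n}. sgn_of \<tau> * (\<alpha> u (y \<circ> \<tau>) * \<beta> u (\<lambda>i. (y \<circ> \<tau>) (r + i)))) has_derivative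
        (\<lambda>x. \<Sum>\<tau> | \<tau> permutes {..<?n}. sgn_of \<tau> *
           (\<alpha> u (y \<circ> \<tau>) * dd \<beta> u x (\<lambda>i. (y \<circ> \<tau>) (r + i)) + dd \<alpha> u x (y \<circ> \<tau>) * \<beta> u (\<lambda>i. (y \<circ> \<tau>) (r + i))))) (at u)"
      by (intro has_derivative_sum has_derivative_mult_right has_derivative_mult has_derivative_dd[OF \<alpha> u] has_derivative_dd[OF \<beta> u])
    then have "((\<lambda>u. ?c * wloc r s \<alpha> \<beta> u y) has_derivative
        (\<lambda>x. \<Sum>\<tau> | \<tau> permutes {..<?n}. sgn_of \<tau> *
           (\<alpha> u (y \<circ> \<tau>) * dd \<beta> u x (\<lambda>i. (y \<circ> \<tau>) (r + i)) + dd \<alpha> u x (y \<circ> \<tau>) * \<beta> u (\<lambda>i. (y \<circ> \<tau>) (r + i))))) (at u)"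
      by (rule has_derivative_transform_open[OF _ S u]) (simp add: wloc_def Alt_def)
    moreover have "((\<lambda>u. ?c * wloc r s \<alpha> \<beta> u y) has_derivative (\<lambda>x. ?c * dd (wloc r s \<alpha> \<beta>) u x y)) (at u)"
      by (intro has_derivative_mult_right has_derivative_dd[OF lform_wloc[OF \<alpha> \<beta>] u])
    ultimately have "(\<lambda>x. ?c * dd (wloc r s \<alpha> \<beta>) u x y) = (\<lambda>x. \<Sum>\<tau> | \<tau> permutes {..<?n}. sgn_of \<tau> *
           (\<alpha> u (y \<circ> \<tau>) * dd \<beta> u x (\<lambda>i. (y \<circ> \<tau>) (r + i)) + dd \<alpha> u x (y \<circ> \<tau>) * \<beta> u (\<lambda>i. (y \<circ> \<tau>) (r + i))))"
      by (rule has_derivative_unique[rotated])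
    from fun_cong[OF this, of x] show ?thesis
      by (simp only: add.commute)
  qed
  have "?c * (fact ?n * dloc ?n (wloc r s \<alpha> \<beta>) u v) = Alt (Suc ?n) (\<lambda>w. ?c * dd (wloc r s \<alpha> \<beta>) u (w 0) (w \<circ> Suc)) v"
    by (simp only: dloc_Alt[OF lform_wloc[OF \<alpha> \<beta>] u] Alt_scale)
  also have "\<dots> = fact ?n * Alt (Suc ?n) (\<lambda>w. ?T (w 0) (w \<circ> Suc)) v"
    unfolding D by (rule Alt_nested_Suc[of ?n ?T])
  also have "Alt (Suc ?n) (\<lambda>w. ?T (w 0) (w \<circ> Suc)) v = A1 + A2"
    unfolding A1_def A2_def by (rule Alt_add)
  finally have "fact ?n * (?c * dloc ?n (wloc r s \<alpha> \<beta>) u v) = fact ?n * (A1 + A2)"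
    by (simp only: mult.left_commute)
  then have L: "?c * dloc ?n (wloc r s \<alpha> \<beta>) u v = A1 + A2"
    unfolding mult_cancel_left by simp
  have R1: "?c * wloc (Suc r) s (dloc r \<alpha>) \<beta> u v = A1"
  proof -
    have "Alt (Suc r + s) (\<lambda>w. dloc r \<alpha> u w * \<beta> u (\<lambda>i. w (Suc r + i))) v
      = (\<Sum>i\<le>r. Alt (Suc ?n) (\<lambda>w. (-1) ^ i * (dd \<alpha> u (w (0 + i)) (del i (\<lambda>j. w (0 + j))) * \<beta> u (\<lambda>i. w (Suc r + i)))) v)"
      by (subst Alt_sum[symmetric]) (simp add: dloc_def sum_distrib_right mult.assoc)
    also have "\<dots> = (\<Sum>i\<le>r. Alt (Suc ?n) (\<lambda>w. dd \<alpha> u (w 0) (\<lambda>j. w (Suc (0 + j))) * \<beta> u (\<lambda>i. w (Suc r + i))) v)"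
    proof (intro sum.cong refl Alt_move_front[where T = "\<lambda>w x y. dd \<alpha> u x y * \<beta> u (\<lambda>i. w (Suc r + i))"])
      fix i x and w w' y :: "nat \<Rightarrow> 'a" assume "i \<in> {..r}" "\<And>j. j < 0 \<or> 0 + i < j \<Longrightarrow> w j = w' j"
      then have "(\<lambda>i. w (Suc r + i)) = (\<lambda>i. w' (Suc r + i))"
        by auto
      then show "dd \<alpha> u x y * \<beta> u (\<lambda>i. w (Suc r + i)) = dd \<alpha> u x y * \<beta> u (\<lambda>i. w' (Suc r + i))"
        by simp
    qed auto
    also have "\<dots> = real (Suc r) * A1"
      by (simp add: A1_def comp_def)
    finally have "wloc (Suc r) s (dloc r \<alpha>) \<beta> u v = (real (Suc r) * A1) / (real (Suc r) * ?c)"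
      unfolding wloc_def by (simp only: fact_Suc of_nat_mult of_nat_fact mult.assoc)
    then show ?thesis
      by (simp del: of_nat_Suc)
  qed
  have R2: "?c * wloc r (Suc s) \<alpha> (dloc s \<beta>) u v = (-1) ^ r * A2"
  proof -
    let ?B = "\<lambda>w. \<alpha> u w * dd \<beta> u (w r) (\<lambda>j. w (Suc (r + j)))"
    have "Alt (r + Suc s) (\<lambda>w. \<alpha> u w * dloc s \<beta> u (\<lambda>i. w (r + i))) v
      = (\<Sum>i\<le>s. Alt (Suc ?n) (\<lambda>w. (-1) ^ i * (\<alpha> u w * dd \<beta> u (w (r + i)) (del i (\<lambda>j. w (r + j))))) v)"
      by (subst Alt_sum[symmetric]) (simp add: dloc_def sum_distrib_left mult.left_commute)
    also have "\<dots> = (\<Sum>i\<le>s. Alt (Suc ?n) ?B v)"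
    proof (intro sum.cong refl Alt_move_front[where T = "\<lambda>w x y. \<alpha> u w * dd \<beta> u x y"])
      fix i x and w w' y :: "nat \<Rightarrow> 'a" assume "\<And>j. j < r \<or> r + i < j \<Longrightarrow> w j = w' j"
      then have "\<alpha> u w = \<alpha> u w'"
        by (intro alternating_cong[OF a]) auto
      then show "\<alpha> u w * dd \<beta> u x y = \<alpha> u w' * dd \<beta> u x y"
        by simp
    qed auto
    also have "\<dots> = real (Suc s) * Alt (Suc ?n) ?B v"
      by simp
    \<comment> \<open>The cycle moves the slot of differentiation from position \<open>r\<close> to
      the front, past the \<open>r\<close> slots of \<open>\<alpha>\<close>, at the cost of
      \<open>(-1) ^ r\<close>.\<close>
    also have "Alt (Suc ?n) ?B v = Alt (Suc ?n) (\<lambda>w. (\<lambda>w. \<alpha> u (w \<circ> Suc) * dd \<beta> u (w 0) (\<lambda>i. (w \<circ> Suc) (r + i))) (w \<circ> cyc 0 r)) v"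
    proof (rule Alt_cong)
      fix w :: "nat \<Rightarrow> 'a"
      have "\<alpha> u (w \<circ> cyc 0 r \<circ> Suc) = \<alpha> u w"
        by (rule alternating_cong[OF a]) (auto simp: cyc_def)
      then show "?B w = \<alpha> u (w \<circ> cyc 0 r \<circ> Suc) * dd \<beta> u ((w \<circ> cyc 0 r) 0) (\<lambda>i. (w \<circ> cyc 0 r \<circ> Suc) (r + i))"
        by (simp add: cyc_def)
    qed
    also have "\<dots> = (-1) ^ r * A2"
      unfolding A2_def using cyc[of 0 r "Suc ?n"] by (subst Alt_perm_slots) auto
    finally have "wloc r (Suc s) \<alpha> (dloc s \<beta>) u v = (real (Suc s) * ((-1) ^ r * A2)) / (real (Suc s) * ?c)"
      unfolding wloc_def by (simp only: fact_Suc of_nat_mult of_nat_fact mult.left_commute)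
    then show ?thesis
      by (simp del: of_nat_Suc)
  qed
  have "?c * dloc ?n (wloc r s \<alpha> \<beta>) u v
    = ?c * (wloc (Suc r) s (dloc r \<alpha>) \<beta> u v + (-1) ^ r * wloc r (Suc s) \<alpha> (dloc s \<beta>) u v)"
  proof -
    have "?c * ((-1) ^ r * wloc r (Suc s) \<alpha> (dloc s \<beta>) u v) = (-1) ^ r * (?c * wloc r (Suc s) \<alpha> (dloc s \<beta>) u v)"
      by (rule mult.left_commute)
    also have "\<dots> = (-1) ^ r * (-1) ^ r * A2"
      unfolding R2 by (rule mult.assoc[symmetric])
    also have "\<dots> = A2"
      by (simp flip: power_mult_distrib)
    finally show ?thesis
      unfolding L distrib_left R1 by simp
  qed
  then show ?thesis
    unfolding mult_cancel_left by simp
qed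

lemma lform_add:
  assumes "lform r S \<alpha>" "lform r S \<beta>"
  shows "lform r S (\<lambda>u v. \<alpha> u v + \<beta> u v)"
  using assms unfolding lform_def
  by (intro conjI ballI allI alternating_add smooth_on_add) auto

lemma dloc_add:
  assumes \<alpha>: "lform r S \<alpha>" and \<beta>: "lform r S \<beta>" and u: "u \<in> S"
  shows "dloc r (\<lambda>u v. \<alpha> u v + \<beta> u v) u v = dloc r \<alpha> u v + dloc r \<beta> u v"
proof -
  have "dd (\<lambda>u v. \<alpha> u v + \<beta> u v) u x w = dd \<alpha> u x w + dd \<beta> u x w" for x w
    by (rule dd_eqI[OF has_derivative_add[OF has_derivative_dd[OF \<alpha> u] has_derivative_dd[OF \<beta> u]]])
  then show ?thesis
    by (simp add: dloc_def distrib_left sum.distrib)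
qed

lemma lform_scale:
  assumes "lform r S \<alpha>"
  shows "lform r S (\<lambda>u v. c * \<alpha> u v)"
  using assms unfolding lform_def
  by (intro conjI ballI allI alternating_scale smooth_on_mult smooth_on_const) auto

lemma dloc_scale:
  assumes \<alpha>: "lform r S \<alpha>" and u: "u \<in> S"
  shows "dloc r (\<lambda>u v. c * \<alpha> u v) u v = c * dloc r \<alpha> u v"
proof -
  have "dd (\<lambda>u v. c * \<alpha> u v) u x w = c * dd \<alpha> u x w" for x w
    by (rule dd_eqI[OF has_derivative_mult_right[OF has_derivative_dd[OF \<alpha> u]]])
  then show ?thesis
    by (simp add: dloc_def sum_distrib_left mult.left_commute)
qed

lemma dloc_cong:
  assumes "open S" "u \<in> S" "\<And>u v. u \<in> S \<Longrightarrow> \<alpha> u v = \<beta> u v"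
  shows "dloc r \<alpha> u v = dloc r \<beta> u v"
  unfolding dloc_def dd_def
  by (intro sum.cong refl arg_cong2[of _ _ _ _ "(*)"] fun_cong[OF frechet_derivative_cong_open[OF assms(1,2)]] assms(3))

lemma lform_cong:
  assumes "open S" "\<And>u v. u \<in> S \<Longrightarrow> \<alpha> u v = \<beta> u v"
  shows "lform r S \<alpha> \<longleftrightarrow> lform r S \<beta>"
proof -
  have "\<alpha> u = \<beta> u" if "u \<in> S" for u
    using assms(2)[OF that] by blast
  moreover have "smooth_on S (\<lambda>u. \<alpha> u v) \<longleftrightarrow> smooth_on S (\<lambda>u. \<beta> u v)" for v
    by (rule smooth_on_cong[OF assms(1)]) (rule assms(2))
  ultimately show ?thesis
    by (auto simp: lform_def)
qed

lemma lform_local: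
  assumes S: "open S" and "\<And>u. u \<in> S \<Longrightarrow> \<exists>T. u \<in> T \<and> lform r T \<alpha>"
  shows "lform r S \<alpha>"
  unfolding lform_def
proof (intro conjI ballI allI S)
  show "alternating r (\<alpha> u)" if "u \<in> S" for u
    using assms(2)[OF that] by (auto simp: lform_def)
  show "smooth_on S (\<lambda>u. \<alpha> u v)" for v
  proof (rule smooth_on_local)
    fix x assume "x \<in> S"
    then obtain T where "x \<in> T" "lform r T \<alpha>"
      using assms(2) by blast
    then show "\<exists>T. open T \<and> x \<in> T \<and> smooth_on T (\<lambda>u. \<alpha> u v)"
      using lform_open[of r T \<alpha>] lform_smooth[of r T \<alpha> v] by auto
  qed
qed

section \<open>The homotopy formula\<close>

definition emb :: "(nat \<Rightarrow> 'e) \<Rightarrow> nat \<Rightarrow> 'e \<times> real"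
  where "emb v = (\<lambda>i. (v i, 0))"

text \<open>Feeding \<open>emb0 v\<close> to a form on the product with the line contracts it with
  the time direction \<open>(0, 1)\<close>.\<close>

definition emb0 :: "(nat \<Rightarrow> 'e::zero) \<Rightarrow> nat \<Rightarrow> 'e \<times> real"
  where "emb0 v = case_nat (0, 1) (emb v)"

definition fibre_integral :: "('e::{real_inner, heine_borel} \<times> real \<Rightarrow> (nat \<Rightarrow> 'e \<times> real) \<Rightarrow> real) \<Rightarrow>
    'e \<Rightarrow> (nat \<Rightarrow> 'e) \<Rightarrow> real"
  where "fibre_integral \<beta> u v = integral {0..1} (\<lambda>t. \<beta> (u, t) (emb0 v))"

lemma del_Suc_emb0: "del (Suc i) (emb0 v) = emb0 (del i v)"
  by (auto simp: del_def emb0_def emb_def fun_eq_iff split: nat.split)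

lemma integrable_param:
  assumes "smooth_on (S \<times> UNIV) (g :: 'e::{real_inner, heine_borel} \<times> real \<Rightarrow> real)" "u \<in> S"
  shows "(\<lambda>t. g (u, t)) integrable_on {0..1}"
  by (rule Ck_on_param_cont(2)[OF smooth_on_continuous[OF assms(1)] assms(2)])

lemma lform_fibre_integral:
  assumes S: "open S" and \<beta>: "lform (Suc r) (S \<times> UNIV) \<beta>"
  shows "lform r S (fibre_integral \<beta>)"
  unfolding lform_def
proof (intro conjI ballI allI S)
  show "smooth_on S (\<lambda>u. fibre_integral \<beta> u v)" for v
    unfolding fibre_integral_def by (rule smooth_on_param_integral[OF S lform_smooth[OF \<beta>]])
  show "alternating r (fibre_integral \<beta> u)" if u: "u \<in> S" for u
    unfolding alternating_def
  proof (intro conjI allI impI)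
    have alt: "alternating (Suc r) (\<beta> (u, t))" for t
      using lform_alternating[OF \<beta>] u by simp
    show "fibre_integral \<beta> u v = fibre_integral \<beta> u w" if "\<forall>i<r. v i = w i" for v w
    proof -
      have "\<beta> (u, t) (emb0 v) = \<beta> (u, t) (emb0 w)" for t
        by (rule alternating_cong[OF alt]) (use that in \<open>auto simp: emb0_def emb_def split: nat.split\<close>)
      then show ?thesis by (simp add: fibre_integral_def)
    qed
    show "fibre_integral \<beta> u v = 0" if "i < r" "j < r" "i \<noteq> j \<and> v i = v j" for i j v
    proof -
      have "\<beta> (u, t) (emb0 v) = 0" for t
        by (rule alternating_eq_0[OF alt, of "Suc i" "Suc j"]) (use that in \<open>auto simp: emb0_def emb_def\<close>)
      then show ?thesis by (simp add: fibre_integral_def)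
    qed
    show "linear (\<lambda>x. fibre_integral \<beta> u (v(i := x)))" if i: "i < r" for i v
    proof (rule linearI)
      have upd: "emb0 (v(i := x)) = (emb0 v)(Suc i := (x, 0))" for x
        by (auto simp: emb0_def emb_def fun_eq_iff split: nat.split)
      have lin: "linear (\<lambda>x. \<beta> (u, t) ((emb0 v)(Suc i := x)))" for t
        by (rule alternating_linear[OF alt]) (use i in simp)
      note int = integrable_param[OF lform_smooth[OF \<beta>] u]
      show "fibre_integral \<beta> u (v(i := x + y)) = fibre_integral \<beta> u (v(i := x)) + fibre_integral \<beta> u (v(i := y))" for x y
        using linear_add[OF lin, of _ "(x, 0)" "(y, 0)"]
        by (simp add: fibre_integral_def upd integral_add[OF int int, symmetric])
      show "fibre_integral \<beta> u (v(i := c *\<^sub>R x)) = c *\<^sub>R fibre_integral \<beta> u (v(i := x))" for c x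
        using linear_scale[OF lin, of _ c "(x, 0)"] by (simp add: fibre_integral_def upd)
    qed
  qed
qed

text \<open>In d \<open>\<beta>\<close> at \<open>emb0 v\<close> the term of position 0 is a time
  derivative, and it integrates to the difference of the end values. The other terms stand one
  position later than in \<open>dloc r (fibre_integral \<beta>)\<close>, so they have the opposite
  sign and cancel it.\<close>

lemma homotopy_formula:
  assumes S: "open S" and \<beta>: "lform (Suc r) (S \<times> UNIV) \<beta>" and u: "u \<in> S"
  shows "dloc r (fibre_integral \<beta>) u v + fibre_integral (dloc (Suc r) \<beta>) u v
    = \<beta> (u, 1) (emb v) - \<beta> (u, 0) (emb v)"
proof -
  have z: "(u, t) \<in> S \<times> UNIV" for t
    using u by simp
  note int = integrable_param[OF smooth_on_dd[OF \<beta>] u]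
  have "dd (fibre_integral \<beta>) u x w = integral {0..1} (\<lambda>t. dd \<beta> (u, t) (x, 0) (emb0 w))" for x w
  proof -
    have "Ck_on (Suc 0) (S \<times> UNIV) (\<lambda>z. \<beta> z (emb0 w))"
      using lform_smooth[OF \<beta>] unfolding smooth_on_def by blast
    from dd_eqI[of "fibre_integral \<beta>", OF has_derivative_param_integral[OF S u this, folded fibre_integral_def]]
    show ?thesis
      by (simp add: dd_def)
  qed
  then have A: "dloc r (fibre_integral \<beta>) u v
    = (\<Sum>i\<le>r. (-1) ^ i * integral {0..1} (\<lambda>t. dd \<beta> (u, t) (v i, 0) (emb0 (del i v))))"
    by (simp add: dloc_def)
  have "dloc (Suc r) \<beta> (u, t) (emb0 v) = dd \<beta> (u, t) (0, 1) (emb v) -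
      (\<Sum>i\<le>r. (-1) ^ i * dd \<beta> (u, t) (v i, 0) (emb0 (del i v)))" for t
  proof -
    have "del 0 (emb0 v) = emb v"
      by (auto simp: del_0 emb0_def)
    then have "dloc (Suc r) \<beta> (u, t) (emb0 v) = dd \<beta> (u, t) (0, 1) (emb v) +
      (\<Sum>i\<le>r. (-1) ^ Suc i * dd \<beta> (u, t) (emb0 v (Suc i)) (del (Suc i) (emb0 v)))"
      unfolding dloc_def by (subst sum.atMost_Suc_shift) (simp add: emb0_def)
    then show ?thesis
      by (simp add: del_Suc_emb0 sum_negf) (simp add: emb0_def emb_def)
  qed
  then have B: "fibre_integral (dloc (Suc r) \<beta>) u v = integral {0..1} (\<lambda>t. dd \<beta> (u, t) (0, 1) (emb v)) -
      (\<Sum>i\<le>r. (-1) ^ i * integral {0..1} (\<lambda>t. dd \<beta> (u, t) (v i, 0) (emb0 (del i v))))"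
  proof -
    assume *: "\<And>t. dloc (Suc r) \<beta> (u, t) (emb0 v) = dd \<beta> (u, t) (0, 1) (emb v) -
      (\<Sum>i\<le>r. (-1) ^ i * dd \<beta> (u, t) (v i, 0) (emb0 (del i v)))"
    have i: "(\<lambda>t. (-1) ^ i * dd \<beta> (u, t) (v i, 0) (emb0 (del i v))) integrable_on {0..1}" for i
      using integrable_cmul[OF int, of "(-1) ^ i"] by simp
    have "fibre_integral (dloc (Suc r) \<beta>) u v = integral {0..1} (\<lambda>t. dd \<beta> (u, t) (0, 1) (emb v)) -
      integral {0..1} (\<lambda>t. \<Sum>i\<le>r. (-1) ^ i * dd \<beta> (u, t) (v i, 0) (emb0 (del i v)))"
      unfolding fibre_integral_def * by (rule integral_diff[OF int integrable_sum]) (use i in auto)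
    also have "integral {0..1} (\<lambda>t. \<Sum>i\<le>r. (-1) ^ i * dd \<beta> (u, t) (v i, 0) (emb0 (del i v)))
      = (\<Sum>i\<le>r. integral {0..1} (\<lambda>t. (-1) ^ i * dd \<beta> (u, t) (v i, 0) (emb0 (del i v))))"
      by (rule integral_sum) (use i in auto)
    finally show ?thesis
      by (simp only: integral_mult_right)
  qed
  have "((\<lambda>t. \<beta> (u, t) (emb v)) has_real_derivative dd \<beta> (u, t) (0, 1) (emb v)) (at t within {0..1})" for t
  proof -
    have "((\<lambda>t. (u, t)) has_derivative (\<lambda>s. (0, s))) (at t within {0..1})"
      by (auto intro!: derivative_eq_intros)
    from has_derivative_compose[OF this has_derivative_dd[OF \<beta> z]]
    have "((\<lambda>t. \<beta> (u, t) (emb v)) has_derivative (\<lambda>s. dd \<beta> (u, t) (0, s) (emb v))) (at t within {0..1})" .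
    moreover have "(\<lambda>s. dd \<beta> (u, t) (0, s) (emb v)) = (*) (dd \<beta> (u, t) (0, 1) (emb v))"
    proof
      show "dd \<beta> (u, t) (0, s) (emb v) = dd \<beta> (u, t) (0, 1) (emb v) * s" for s
        using linear_scale[OF linear_dd[OF \<beta> z], of t s "(0, 1)" "emb v"] by simp
    qed
    ultimately show ?thesis
      unfolding has_field_derivative_def by (simp only:)
  qed
  then have "((\<lambda>t. dd \<beta> (u, t) (0, 1) (emb v)) has_integral \<beta> (u, 1) (emb v) - \<beta> (u, 0) (emb v)) {0..1}"
    by (intro fundamental_theorem_of_calculus) (auto simp: has_real_derivative_iff_has_vector_derivative[symmetric])
  then show ?thesis
    unfolding A B by (simp add: integral_unique)
qed

section \<open>Foliated manifolds\<close>

text \<open>Subtracting the orthogonal projection onto \<open>V\<close> has kernel \<open>V\<close>.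
  Two points are then in one coset of \<open>V\<close> iff a continuous function takes the same
  value at them, which is what the connectedness arguments on leaves require.\<close>

lemma subspace_kernel:
  fixes V :: "'e::{real_inner, heine_borel} set"
  assumes "subspace V"
  obtains \<pi> :: "'e \<Rightarrow> 'e" where "bounded_linear \<pi>" "\<And>x. \<pi> x = 0 \<longleftrightarrow> x \<in> V"
proof -
  obtain B where B: "B \<subseteq> V" "independent B" "V \<subseteq> span B"
    using maximal_independent_subset[of V] by blast
  have "B \<subseteq> span onb"
  proof
    fix x assume "x \<in> B"
    have "(\<Sum>b\<in>onb. (x \<bullet> b) *\<^sub>R b) \<in> span onb"
      by (intro span_sum span_scale span_base)
    then show "x \<in> span onb"
      using onb_expand[of x] by simp
  qed
  then have "finite B"
    using independent_span_bound[OF finite_onb B(2)] by blast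
  then obtain C where C: "finite C" "span C = span B" "pairwise orthogonal C"
    using basis_orthogonal by blast
  have sC: "span C = V"
    using C(2) B assms span_minimal by blast
  define \<pi> where "\<pi> x = x - (\<Sum>c\<in>C. (x \<bullet> c / (c \<bullet> c)) *\<^sub>R c)" for x
  have lin: "linear \<pi>"
    unfolding \<pi>_def
    by (rule linearI)
      (simp_all add: inner_add_left add_divide_distrib scaleR_add_left sum.distrib scaleR_diff_right scaleR_sum_right)
  have inV: "(\<Sum>c\<in>C. (x \<bullet> c / (c \<bullet> c)) *\<^sub>R c) \<in> V" for x
    unfolding sC[symmetric] by (intro span_sum span_scale span_base)
  have "\<pi> c = 0" if "c \<in> C" for c
  proof -
    have "(\<Sum>b\<in>C. (c \<bullet> b / (b \<bullet> b)) *\<^sub>R b) = (\<Sum>b\<in>C. if b = c then c else 0)"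
      using C(3) that by (intro sum.cong) (auto simp: pairwise_def orthogonal_def)
    then show ?thesis
      using that C(1) by (simp add: \<pi>_def)
  qed
  then have "\<pi> x = 0" if "x \<in> V" for x
    using linear_eq_0_on_span[OF lin, of C x] that sC by auto
  moreover have "x \<in> V" if "\<pi> x = 0" for x
    using that inV[of x] by (simp add: \<pi>_def)
  ultimately show thesis
    using that bounded_linear_finite_dim[OF lin] by blast
qed

text \<open>The common source of all tangency statements: if \<open>g\<close> stays in one coset of
  \<open>V\<close> along a short segment, its derivative in that direction lies in
  \<open>V\<close>.\<close>

lemma derivative_in_subspace:
  fixes g :: "'a::real_normed_vector \<Rightarrow> 'e::real_normed_vector"
  assumes \<pi>: "bounded_linear \<pi>" "\<And>x. \<pi> x = 0 \<longleftrightarrow> x \<in> V" and g: "(g has_derivative g') (at u)"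
    and const: "\<forall>\<^sub>F s in nhds (0::real). \<pi> (g (u + s *\<^sub>R v)) = \<pi> (g u)"
  shows "g' v \<in> V"
proof -
  have "((\<lambda>s. u + s *\<^sub>R v) has_derivative (\<lambda>s. s *\<^sub>R v)) (at (0::real))"
    by (auto intro!: derivative_eq_intros)
  moreover have "(g has_derivative g') (at (u + 0 *\<^sub>R v))"
    using g by simp
  ultimately have "((\<lambda>s. g (u + s *\<^sub>R v)) has_derivative (\<lambda>s. g' (s *\<^sub>R v))) (at (0::real))"
    by (rule has_derivative_compose)
  from bounded_linear.has_derivative[OF \<pi>(1) this]
  have 1: "((\<lambda>s. \<pi> (g (u + s *\<^sub>R v))) has_derivative (\<lambda>s. \<pi> (g' (s *\<^sub>R v)))) (at (0::real))" .
  obtain S where S: "open S" "(0::real) \<in> S" "\<And>s. s \<in> S \<Longrightarrow> \<pi> (g (u + s *\<^sub>R v)) = \<pi> (g u)"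
    using const unfolding eventually_nhds by blast
  have "((\<lambda>s. \<pi> (g u)) has_derivative (\<lambda>s. \<pi> (g' (s *\<^sub>R v)))) (at (0::real))"
    by (rule has_derivative_transform_open[OF 1 S])
  then have "(\<lambda>s::real. \<pi> (g' (s *\<^sub>R v))) = (\<lambda>s. 0)"
    by (rule has_derivative_unique) (rule has_derivative_const)
  from fun_cong[OF this, of 1] show ?thesis
    using \<pi>(2) by simp
qed

definition lrep :: "('m, 'e) form \<Rightarrow> ('m, 'e) chart \<Rightarrow> 'e \<Rightarrow> (nat \<Rightarrow> 'e) \<Rightarrow> real"
  where "lrep \<omega> c u v = \<omega> c (chart_inv c u) v"

locale foliation =
  fixes A :: "('m::{second_countable_topology, t2_space}, 'e::{real_inner, heine_borel}) chart set"
    and V :: "'e set"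
  assumes foliated: "foliated_atlas A V"
begin

lemma subspace_V: "subspace V"
  using foliated by (simp add: foliated_atlas_def)

section \<open>Charts, transition maps and the leaf directions\<close>

lemma charts:
  assumes "c \<in> A"
  shows open_dom: "open (chart_dom c)" and open_im: "open (chart_map c ` chart_dom c)"
    and chart_homeo: "homeomorphism (chart_dom c) (chart_map c ` chart_dom c) (chart_map c) (chart_inv c)"
  using foliated assms by (auto simp: foliated_atlas_def smooth_atlas_def)

lemma chart_inv_map [simp]: "c \<in> A \<Longrightarrow> x \<in> chart_dom c \<Longrightarrow> chart_inv c (chart_map c x) = x"
  using chart_homeo by (simp add: homeomorphism_def)

lemma chart_map_inv [simp]: "c \<in> A \<Longrightarrow> u \<in> chart_map c ` chart_dom c \<Longrightarrow> chart_map c (chart_inv c u) = u"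
  by (rule homeomorphism_apply2[OF chart_homeo])

lemma chart_inv_in [simp]: "c \<in> A \<Longrightarrow> u \<in> chart_map c ` chart_dom c \<Longrightarrow> chart_inv c u \<in> chart_dom c"
  by auto

lemma continuous_chart_map: "c \<in> A \<Longrightarrow> continuous_on (chart_dom c) (chart_map c)"
  and continuous_chart_inv: "c \<in> A \<Longrightarrow> continuous_on (chart_map c ` chart_dom c) (chart_inv c)"
  using chart_homeo by (simp_all add: homeomorphism_def)

lemma chart_image_eq:
  assumes "c \<in> A"
  shows "chart_map c ` (chart_dom c \<inter> X) = chart_map c ` chart_dom c \<inter> chart_inv c -` X"
  using assms by auto

lemma open_chart_image: "c \<in> A \<Longrightarrow> open X \<Longrightarrow> open (chart_map c ` (chart_dom c \<inter> X))"
  unfolding chart_image_eq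
  by (rule continuous_open_preimage[OF continuous_chart_inv open_im])

abbreviation ov :: "('m, 'e) chart \<Rightarrow> ('m, 'e) chart \<Rightarrow> 'e set"
  where "ov c d \<equiv> chart_map c ` (chart_dom c \<inter> chart_dom d)"

lemma open_ov: "c \<in> A \<Longrightarrow> d \<in> A \<Longrightarrow> open (ov c d)"
  by (rule open_chart_image[OF _ open_dom])

lemma transition_at [simp]: "c \<in> A \<Longrightarrow> x \<in> chart_dom c \<Longrightarrow> transition c d (chart_map c x) = chart_map d x"
  by (simp add: transition_def)

lemma smooth_transition: "c \<in> A \<Longrightarrow> d \<in> A \<Longrightarrow> smooth_on (ov c d) (transition c d)"
  using foliated by (auto simp: foliated_atlas_def smooth_atlas_def)

lemma transition_image: "c \<in> A \<Longrightarrow> transition c d ` ov c d = ov d c"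
  by (force simp: image_iff)

lemma D_transition_derivative:
  assumes "c \<in> A" "d \<in> A" "x \<in> chart_dom c" "x \<in> chart_dom d"
  shows "(transition c d has_derivative D_transition c d x) (at (chart_map c x))"
  unfolding D_transition_def using assms by (intro smooth_on_has_derivative[OF smooth_transition]) auto

lemma D_transition_linear:
  assumes "c \<in> A" "d \<in> A" "x \<in> chart_dom c" "x \<in> chart_dom d"
  shows "linear (D_transition c d x)"
  using D_transition_derivative[OF assms] by (rule has_derivative_linear)

lemma D_transition_compose:
  assumes "c \<in> A" "d \<in> A" "e \<in> A" "x \<in> chart_dom c" "x \<in> chart_dom d" "x \<in> chart_dom e"
  shows "D_transition d e x (D_transition c d x v) = D_transition c e x v"
proof -
  let ?S = "chart_map c ` (chart_dom c \<inter> (chart_dom d \<inter> chart_dom e))"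
  have S: "open ?S" "chart_map c x \<in> ?S"
    using assms by (auto intro!: open_chart_image open_Int open_dom)
  have "((\<lambda>u. transition d e (transition c d u)) has_derivative (\<lambda>v. D_transition d e x (D_transition c d x v)))
      (at (chart_map c x))"
    by (rule has_derivative_compose[OF D_transition_derivative]) (use assms D_transition_derivative in auto)
  then have "(transition c e has_derivative (\<lambda>v. D_transition d e x (D_transition c d x v))) (at (chart_map c x))"
    by (rule has_derivative_transform_open[OF _ S]) (use assms in auto)
  from fun_cong[OF has_derivative_unique[OF this D_transition_derivative[OF assms(1,3,4,6)]], of v]
  show ?thesis .
qed

lemma D_transition_self [simp]:
  assumes "c \<in> A" "x \<in> chart_dom c"
  shows "D_transition c c x v = v"
proof -
  have "((\<lambda>u. u) has_derivative (\<lambda>v. v)) (at (chart_map c x))"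
    by (rule has_derivative_ident)
  then have "(transition c c has_derivative (\<lambda>v. v)) (at (chart_map c x))"
    by (rule has_derivative_transform_open[OF _ open_im[OF assms(1)]]) (use assms in auto)
  from fun_cong[OF has_derivative_unique[OF this D_transition_derivative[OF assms(1,1,2,2)]], of v]
  show ?thesis by simp
qed

lemma transition_local:
  assumes "c \<in> A" "d \<in> A" "x \<in> chart_dom c" "x \<in> chart_dom d"
  obtains W where "open W" "chart_map c x \<in> W" "W \<subseteq> ov c d"
    "\<And>u w. u \<in> W \<Longrightarrow> w \<in> W \<Longrightarrow> u - w \<in> V \<Longrightarrow> transition c d u - transition c d w \<in> V"
proof -
  have "chart_map c x \<in> ov c d" using assms by auto
  from foliated[unfolded foliated_atlas_def, THEN conjunct2, THEN conjunct2, rule_format, OF assms(1,2) this]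
  show thesis
    by (elim exE conjE) (rule that, auto)
qed

definition proj :: "'e \<Rightarrow> 'e"
  where "proj = (SOME \<pi>. bounded_linear \<pi> \<and> (\<forall>x. \<pi> x = 0 \<longleftrightarrow> x \<in> V))"

lemma bounded_linear_proj: "bounded_linear proj" and proj_eq_0: "proj x = 0 \<longleftrightarrow> x \<in> V"
proof -
  have "\<exists>\<pi> :: 'e \<Rightarrow> 'e. bounded_linear \<pi> \<and> (\<forall>x. \<pi> x = 0 \<longleftrightarrow> x \<in> V)"
    using subspace_kernel[OF subspace_V] by metis
  from someI_ex[OF this] show "bounded_linear proj" "proj x = 0 \<longleftrightarrow> x \<in> V"
    unfolding proj_def by blast+
qed

lemma proj_eq_iff: "proj x = proj y \<longleftrightarrow> x - y \<in> V"
  using proj_eq_0[of "x - y"] linear_diff[OF bounded_linear.linear[OF bounded_linear_proj], of x y] by simp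

text \<open>A short segment parallel to \<open>V\<close> is mapped into one coset of
  \<open>V\<close>; that is the last clause of \<open>foliated_atlas\<close>.\<close>

lemma D_transition_V:
  assumes "c \<in> A" "d \<in> A" "x \<in> chart_dom c" "x \<in> chart_dom d" and v: "v \<in> V"
  shows "D_transition c d x v \<in> V"
proof (rule derivative_in_subspace[OF bounded_linear_proj proj_eq_0 D_transition_derivative[OF assms(1-4)]])
  obtain W where W: "open W" "chart_map c x \<in> W"
    "\<And>u w. u \<in> W \<Longrightarrow> w \<in> W \<Longrightarrow> u - w \<in> V \<Longrightarrow> transition c d u - transition c d w \<in> V"
    using transition_local[OF assms(1-4)] by metis
  have "((\<lambda>s. chart_map c x + s *\<^sub>R v) \<longlongrightarrow> chart_map c x + 0 *\<^sub>R v) (nhds (0::real))"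
    by (intro tendsto_add tendsto_const tendsto_scaleR filterlim_ident)
  then have "\<forall>\<^sub>F s in nhds (0::real). chart_map c x + s *\<^sub>R v \<in> W"
    using W(1,2) by (intro topological_tendstoD) auto
  then show "\<forall>\<^sub>F s in nhds (0::real). proj (transition c d (chart_map c x + s *\<^sub>R v)) = proj (transition c d (chart_map c x))"
    by eventually_elim (use W v subspace_V in \<open>simp add: proj_eq_iff subspace_scale\<close>)
qed

section \<open>Differential forms on the manifold and their local representatives\<close>

lemma forms_lform: "\<omega> \<in> forms A r \<Longrightarrow> c \<in> A \<Longrightarrow> lform r (chart_map c ` chart_dom c) (lrep \<omega> c)"
  unfolding forms_def lform_def lrep_def[abs_def] using open_im by auto

lemma forms_outside: "\<omega> \<in> forms A r \<Longrightarrow> \<not> (c \<in> A \<and> x \<in> chart_dom c) \<Longrightarrow> \<omega> c x v = 0"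
  unfolding forms_def by blast

lemma forms_alternating: "\<omega> \<in> forms A r \<Longrightarrow> c \<in> A \<Longrightarrow> x \<in> chart_dom c \<Longrightarrow> alternating r (\<omega> c x)"
  unfolding forms_def by blast

lemma forms_transform:
  "\<omega> \<in> forms A r \<Longrightarrow> c \<in> A \<Longrightarrow> d \<in> A \<Longrightarrow> x \<in> chart_dom c \<Longrightarrow> x \<in> chart_dom d \<Longrightarrow>
   \<omega> d x (\<lambda>i. D_transition c d x (v i)) = \<omega> c x v"
  unfolding forms_def by blast

lemma formsI:
  assumes "\<And>c x v. \<not> (c \<in> A \<and> x \<in> chart_dom c) \<Longrightarrow> \<omega> c x v = 0"
    and "\<And>c. c \<in> A \<Longrightarrow> lform r (chart_map c ` chart_dom c) (lrep \<omega> c)"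
    and "\<And>c d x v. c \<in> A \<Longrightarrow> d \<in> A \<Longrightarrow> x \<in> chart_dom c \<Longrightarrow> x \<in> chart_dom d \<Longrightarrow>
       \<omega> d x (\<lambda>i. D_transition c d x (v i)) = \<omega> c x v"
  shows "\<omega> \<in> forms A r"
  unfolding forms_def
proof (intro CollectI conjI allI ballI impI)
  show "alternating r (\<omega> c x)" if "c \<in> A" "x \<in> chart_dom c" for c x
  proof -
    have "alternating r (lrep \<omega> c (chart_map c x))"
      by (rule lform_alternating[OF assms(2)]) (use that in auto)
    then show ?thesis
      using that by (simp add: lrep_def[abs_def])
  qed
  show "smooth_on (chart_map c ` chart_dom c) (\<lambda>u. \<omega> c (chart_inv c u) v)" if "c \<in> A" for c v
    using lform_smooth[OF assms(2)[OF that]] by (simp add: lrep_def)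
qed (use assms in auto)

lemma lrep_pullback:
  assumes \<omega>: "\<omega> \<in> forms A r" and "c \<in> A" "d \<in> A" "u \<in> ov c d"
  shows "lrep \<omega> c u v = pullback (transition c d) (lrep \<omega> d) u v"
proof -
  obtain x where x: "x \<in> chart_dom c" "x \<in> chart_dom d" "u = chart_map c x"
    using assms(4) by auto
  then show ?thesis
    using forms_transform[OF \<omega> assms(2,3) x(1,2)] assms
    by (simp add: lrep_def pullback_def D_transition_def)
qed

lemma ext_d_at: "c \<in> A \<Longrightarrow> x \<in> chart_dom c \<Longrightarrow> ext_d A r \<omega> c x v = dloc r (lrep \<omega> c) (chart_map c x) v"
  by (simp add: ext_d_def dloc_def dd_def lrep_def del_def)

lemma lrep_ext_d: "c \<in> A \<Longrightarrow> u \<in> chart_map c ` chart_dom c \<Longrightarrow> lrep (ext_d A r \<omega>) c u v = dloc r (lrep \<omega> c) u v"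
  by (simp add: lrep_def ext_d_at)

text \<open>The derivative is computed in each chart separately. The results fit together because d
  commutes with the pullback by a transition map.\<close>

lemma ext_d_forms:
  assumes \<omega>: "\<omega> \<in> forms A r"
  shows "ext_d A r \<omega> \<in> forms A (Suc r)"
proof (rule formsI)
  show "ext_d A r \<omega> c x v = 0" if "\<not> (c \<in> A \<and> x \<in> chart_dom c)" for c x v
    using that by (auto simp: ext_d_def)
  show "lform (Suc r) (chart_map c ` chart_dom c) (lrep (ext_d A r \<omega>) c)" if c: "c \<in> A" for c
    by (rule lform_cong[THEN iffD2, OF open_im[OF c] lrep_ext_d[OF c] lform_dloc[OF forms_lform[OF \<omega> c]]])
  show "ext_d A r \<omega> d x (\<lambda>i. D_transition c d x (v i)) = ext_d A r \<omega> c x v"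
    if c: "c \<in> A" and d: "d \<in> A" and x: "x \<in> chart_dom c" "x \<in> chart_dom d" for c d x v
  proof -
    have u: "chart_map c x \<in> ov c d"
      using x by auto
    have "ext_d A r \<omega> c x v = dloc r (pullback (transition c d) (lrep \<omega> d)) (chart_map c x) v"
      unfolding ext_d_at[OF c x(1)] by (rule dloc_cong[OF open_ov[OF c d] u lrep_pullback[OF \<omega> c d]])
    also have "\<dots> = pullback (transition c d) (dloc r (lrep \<omega> d)) (chart_map c x) v"
      by (rule dloc_pullback[OF forms_lform[OF \<omega> d] open_ov[OF c d] _ smooth_transition[OF c d] u])
        (use transition_image[OF c] in auto)
    also have "\<dots> = ext_d A r \<omega> d x (\<lambda>i. D_transition c d x (v i))"
      using c d x by (simp add: pullback_def ext_d_at D_transition_def)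
    finally show ?thesis by simp
  qed
qed

lemma wedge_at: "wedge r s \<alpha> \<beta> c x v = Alt (r + s) (\<lambda>w. \<alpha> c x w * \<beta> c x (\<lambda>i. w (r + i))) v / (fact r * fact s)"
  by (simp add: wedge_def Alt_def comp_def mult.assoc)

lemma lrep_wedge: "lrep (wedge r s \<alpha> \<beta>) c u v = wloc r s (lrep \<alpha> c) (lrep \<beta> c) u v"
  by (simp add: lrep_def wedge_at wloc_def)

lemma wedge_forms:
  assumes \<alpha>: "\<alpha> \<in> forms A r" and \<beta>: "\<beta> \<in> forms A s"
  shows "wedge r s \<alpha> \<beta> \<in> forms A (r + s)"
proof (rule formsI)
  show "wedge r s \<alpha> \<beta> c x v = 0" if "\<not> (c \<in> A \<and> x \<in> chart_dom c)" for c x v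
    using forms_outside[OF \<alpha> that] by (simp add: wedge_at Alt_def)
  show "lform (r + s) (chart_map c ` chart_dom c) (lrep (wedge r s \<alpha> \<beta>) c)" if c: "c \<in> A" for c
    using lform_wloc[OF forms_lform[OF \<alpha> c] forms_lform[OF \<beta> c]]
    by (simp add: lrep_wedge[abs_def] lform_cong[OF open_im[OF c] lrep_wedge])
  show "wedge r s \<alpha> \<beta> d x (\<lambda>i. D_transition c d x (v i)) = wedge r s \<alpha> \<beta> c x v"
    if "c \<in> A" "d \<in> A" "x \<in> chart_dom c" "x \<in> chart_dom d" for c d x v
    using forms_transform[OF \<alpha> that] forms_transform[OF \<beta> that] by (simp add: wedge_at Alt_def comp_def)
qed

lemma ext_d_wedge:
  assumes \<alpha>: "\<alpha> \<in> forms A r" and \<beta>: "\<beta> \<in> forms A s"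
  shows "ext_d A (r + s) (wedge r s \<alpha> \<beta>) c x v =
    wedge (Suc r) s (ext_d A r \<alpha>) \<beta> c x v + (-1) ^ r * wedge r (Suc s) \<alpha> (ext_d A s \<beta>) c x v"
proof (cases "c \<in> A \<and> x \<in> chart_dom c")
  case True
  then have c: "c \<in> A" and x: "x \<in> chart_dom c" by auto
  have u: "chart_map c x \<in> chart_map c ` chart_dom c"
    using x by auto
  have "wedge (Suc r) s (ext_d A r \<alpha>) \<beta> c x v = wloc (Suc r) s (dloc r (lrep \<alpha> c)) (lrep \<beta> c) (chart_map c x) v"
    "wedge r (Suc s) \<alpha> (ext_d A s \<beta>) c x v = wloc r (Suc s) (lrep \<alpha> c) (dloc s (lrep \<beta> c)) (chart_map c x) v"
    using c x by (simp_all add: wedge_at wloc_def ext_d_at lrep_def)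
  moreover have "ext_d A (r + s) (wedge r s \<alpha> \<beta>) c x v = dloc (r + s) (wloc r s (lrep \<alpha> c) (lrep \<beta> c)) (chart_map c x) v"
    unfolding ext_d_at[OF c x] by (rule dloc_cong[OF open_im[OF c] u lrep_wedge])
  ultimately show ?thesis
    using dloc_wloc[OF forms_lform[OF \<alpha> c] forms_lform[OF \<beta> c] u] by simp
next
  case False
  have "ext_d A r \<alpha> c x w = 0" for w
    using False by (auto simp: ext_d_def)
  then have "wedge (Suc r) s (ext_d A r \<alpha>) \<beta> c x v = 0"
    by (simp add: wedge_at Alt_def)
  moreover have "wedge r (Suc s) \<alpha> (ext_d A s \<beta>) c x v = 0"
    using forms_outside[OF \<alpha> False] by (simp add: wedge_at Alt_def)
  moreover have "ext_d A (r + s) (wedge r s \<alpha> \<beta>) c x v = 0"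
    using False by (auto simp: ext_d_def)
  ultimately show ?thesis by simp
qed

lemma ext_d_ext_d:
  assumes \<omega>: "\<omega> \<in> forms A r"
  shows "ext_d A (Suc r) (ext_d A r \<omega>) = (\<lambda>c x v. 0)"
proof (intro ext)
  fix c x v
  show "ext_d A (Suc r) (ext_d A r \<omega>) c x v = 0"
  proof (cases "c \<in> A \<and> x \<in> chart_dom c")
    case True
    then have c: "c \<in> A" and x: "x \<in> chart_dom c" by auto
    have u: "chart_map c x \<in> chart_map c ` chart_dom c"
      using x by auto
    show ?thesis
      unfolding ext_d_at[OF c x]
      by (rule trans[OF dloc_cong[OF open_im[OF c] u lrep_ext_d[OF c]] dloc_dloc[OF forms_lform[OF \<omega> c] u]])
  qed (auto simp: ext_d_def)
qed

lemma forms_0: "(\<lambda>c x v. 0) \<in> forms A r"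
  by (rule formsI) (auto simp: lform_def lrep_def[abs_def] alternating_0 open_im smooth_on_const)

lemma forms_add:
  assumes \<alpha>: "\<alpha> \<in> forms A r" and \<beta>: "\<beta> \<in> forms A r"
  shows "(\<lambda>c x v. \<alpha> c x v + \<beta> c x v) \<in> forms A r"
proof (rule formsI)
  show "lform r (chart_map c ` chart_dom c) (lrep (\<lambda>c x v. \<alpha> c x v + \<beta> c x v) c)" if c: "c \<in> A" for c
    using lform_add[OF forms_lform[OF \<alpha> c] forms_lform[OF \<beta> c]] by (simp add: lrep_def[abs_def])
qed (simp_all add: forms_outside[OF \<alpha>] forms_outside[OF \<beta>] forms_transform[OF \<alpha>] forms_transform[OF \<beta>])

lemma forms_scale:
  assumes \<alpha>: "\<alpha> \<in> forms A r"
  shows "(\<lambda>c x v. k * \<alpha> c x v) \<in> forms A r"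
proof (rule formsI)
  show "lform r (chart_map c ` chart_dom c) (lrep (\<lambda>c x v. k * \<alpha> c x v) c)" if c: "c \<in> A" for c
    using lform_scale[OF forms_lform[OF \<alpha> c], of k] by (simp add: lrep_def[abs_def])
qed (simp_all add: forms_outside[OF \<alpha>] forms_transform[OF \<alpha>])

lemma ext_d_add:
  assumes \<alpha>: "\<alpha> \<in> forms A r" and \<beta>: "\<beta> \<in> forms A r"
  shows "ext_d A r (\<lambda>c x v. \<alpha> c x v + \<beta> c x v) = (\<lambda>c x v. ext_d A r \<alpha> c x v + ext_d A r \<beta> c x v)"
proof (intro ext)
  fix c x v
  show "ext_d A r (\<lambda>c x v. \<alpha> c x v + \<beta> c x v) c x v = ext_d A r \<alpha> c x v + ext_d A r \<beta> c x v"
  proof (cases "c \<in> A \<and> x \<in> chart_dom c")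
    case True
    then have c: "c \<in> A" and x: "x \<in> chart_dom c" by auto
    have u: "chart_map c x \<in> chart_map c ` chart_dom c"
      using x by auto
    show ?thesis
      using dloc_add[OF forms_lform[OF \<alpha> c] forms_lform[OF \<beta> c] u]
      by (simp add: ext_d_at[OF c x] lrep_def[abs_def])
  qed (auto simp: ext_d_def)
qed

lemma ext_d_scale:
  assumes \<alpha>: "\<alpha> \<in> forms A r"
  shows "ext_d A r (\<lambda>c x v. k * \<alpha> c x v) = (\<lambda>c x v. k * ext_d A r \<alpha> c x v)"
proof (intro ext)
  fix c x v
  show "ext_d A r (\<lambda>c x v. k * \<alpha> c x v) c x v = k * ext_d A r \<alpha> c x v"
  proof (cases "c \<in> A \<and> x \<in> chart_dom c")
    case True
    then have c: "c \<in> A" and x: "x \<in> chart_dom c" by auto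
    have u: "chart_map c x \<in> chart_map c ` chart_dom c"
      using x by auto
    show ?thesis
      using dloc_scale[OF forms_lform[OF \<alpha> c] u, of k]
      by (simp add: ext_d_at[OF c x] lrep_def[abs_def])
  qed (auto simp: ext_d_def)
qed

section \<open>Smooth functions, tangent fields and the filtration\<close>

definition sm :: "'m set \<Rightarrow> ('m \<Rightarrow> real) \<Rightarrow> bool"
  where "sm N f \<longleftrightarrow> (\<forall>c\<in>A. smooth_on (chart_map c ` (chart_dom c \<inter> N)) (\<lambda>u. f (chart_inv c u)))"

lemma chart_image_mem: "c \<in> A \<Longrightarrow> u \<in> chart_map c ` (chart_dom c \<inter> N) \<Longrightarrow> chart_inv c u \<in> N"
  by auto

lemma sm_cong: "open N \<Longrightarrow> (\<And>x. x \<in> N \<Longrightarrow> f x = g x) \<Longrightarrow> sm N f \<longleftrightarrow> sm N g"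
  unfolding sm_def by (intro ball_cong refl smooth_on_cong open_chart_image) (auto dest: chart_image_mem)

text \<open>Only charts test smoothness, so points of the type outside \<open>manifold_set A\<close>
  need no neighbourhood.\<close>

lemma sm_local:
  assumes "\<And>x. x \<in> N \<Longrightarrow> x \<in> manifold_set A \<Longrightarrow> \<exists>N. open N \<and> x \<in> N \<and> sm N f"
  shows "sm N f"
  unfolding sm_def
proof (intro ballI smooth_on_local)
  fix c u assume c: "c \<in> A" and "u \<in> chart_map c ` (chart_dom c \<inter> N)"
  then obtain x where x: "x \<in> chart_dom c" "x \<in> N" "u = chart_map c x"
    by auto
  then have "x \<in> manifold_set A"
    using c by (auto simp: manifold_set_def)
  then obtain X where X: "open X" "x \<in> X" "sm X f"
    using assms[OF x(2)] by blast
  show "\<exists>T. open T \<and> u \<in> T \<and> smooth_on T (\<lambda>u. f (chart_inv c u))"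
    using X c x by (intro exI[of _ "chart_map c ` (chart_dom c \<inter> X)"] conjI open_chart_image) (auto simp: sm_def)
qed

lemma sm_const: "open N \<Longrightarrow> sm N (\<lambda>x. a)"
  unfolding sm_def by (intro ballI smooth_on_const open_chart_image)

lemma sm_diff: "open N \<Longrightarrow> sm N f \<Longrightarrow> sm N g \<Longrightarrow> sm N (\<lambda>x. f x - g x)"
  unfolding sm_def by (intro ballI smooth_on_diff open_chart_image) auto

lemma sm_mult: "open N \<Longrightarrow> sm N f \<Longrightarrow> sm N g \<Longrightarrow> sm N (\<lambda>x. f x * g x)"
  unfolding sm_def by (intro ballI smooth_on_mult open_chart_image) auto

lemma sm_sum: "open N \<Longrightarrow> (\<And>i. i \<in> I \<Longrightarrow> sm N (f i)) \<Longrightarrow> sm N (\<lambda>x. \<Sum>i\<in>I. f i x)"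
  unfolding sm_def by (intro ballI smooth_on_sum open_chart_image) auto

lemma sm_prod: "open N \<Longrightarrow> (\<And>i. i \<in> I \<Longrightarrow> sm N (f i)) \<Longrightarrow> sm N (\<lambda>x. \<Prod>i\<in>I. f i x)"
  unfolding sm_def by (intro ballI smooth_on_prod open_chart_image) auto

lemma sm_step: "open N \<Longrightarrow> sm N f \<Longrightarrow> sm N (\<lambda>x. step (f x))"
  unfolding sm_def by (intro ballI smooth_on_step_comp open_chart_image) auto

lemma sm_subset: "sm N f \<Longrightarrow> N' \<subseteq> N \<Longrightarrow> sm N' f"
  unfolding sm_def using smooth_on_subset[of "chart_map c ` (chart_dom c \<inter> N)" _ "chart_map c ` (chart_dom c \<inter> N')" for c]
  by (meson Int_mono image_mono order_refl)

lemma sm_continuous: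
  assumes "sm UNIV f" "x \<in> manifold_set A"
  shows "isCont f x"
proof -
  obtain c where c: "c \<in> A" "x \<in> chart_dom c"
    using assms(2) by (auto simp: manifold_set_def)
  have "continuous_on (chart_map c ` chart_dom c) (\<lambda>u. f (chart_inv c u))"
    using assms(1) c(1) by (auto simp: sm_def intro: smooth_on_continuous)
  then have "continuous_on (chart_dom c) (\<lambda>x. f (chart_inv c (chart_map c x)))"
    by (rule continuous_on_compose2[OF _ continuous_chart_map[OF c(1)]]) simp
  then have "continuous_on (chart_dom c) f"
    by (rule continuous_on_eq) (use c in simp)
  then show ?thesis
    using open_dom[OF c(1)] c(2) by (simp add: continuous_on_eq_continuous_at)
qed

text \<open>The extension by zero is smooth because \<open>K\<close>, the image of a compact ball,
  is closed in a Hausdorff space: the function is smooth on the chart domain and zero on the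
  complement of \<open>K\<close>, and these two open sets cover everything.\<close>

lemma bump_on_manifold:
  assumes c: "c \<in> A" and p: "p \<in> chart_dom c" and U: "open U" "p \<in> U"
  obtains b N K where "sm UNIV b" "open N" "p \<in> N" "\<And>x. x \<in> N \<Longrightarrow> b x = 1"
    "closed K" "K \<subseteq> chart_dom c" "K \<subseteq> U" "\<And>x. x \<notin> K \<Longrightarrow> b x = 0"
proof -
  let ?W = "chart_map c ` (chart_dom c \<inter> U)" and ?p = "chart_map c p"
  have W: "open ?W" "?p \<in> ?W"
    using assms by (auto intro: open_chart_image)
  then obtain e where e: "e > 0" "cball ?p e \<subseteq> ?W"
    unfolding open_contains_cball by meson
  \<comment> \<open>The bump function vanishes from distance \<open>2 * r\<close> on, that is,
    outside the ball of radius \<open>e\<close>.\<close>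
  define r where "r = e / 2"
  have r: "r > 0" using e by (simp add: r_def)
  have "\<exists>b :: 'e \<Rightarrow> real. smooth_on UNIV b \<and> (\<forall>u. dist u ?p \<le> r \<longrightarrow> b u = 1) \<and> (\<forall>u. dist u ?p \<ge> 2 * r \<longrightarrow> b u = 0)"
    by (rule bump_exists[OF r, of ?p]) auto
  then obtain b :: "'e \<Rightarrow> real" where b: "smooth_on UNIV b"
    "\<And>u. dist u ?p \<le> r \<Longrightarrow> b u = 1" "\<And>u. dist u ?p \<ge> 2 * r \<Longrightarrow> b u = 0"
    by auto
  define f where "f x = (if x \<in> chart_dom c then b (chart_map c x) else 0)" for x
  define K where "K = chart_inv c ` cball ?p e"
  define N where "N = chart_dom c \<inter> chart_map c -` ball ?p r"
  have im: "cball ?p e \<subseteq> chart_map c ` chart_dom c"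
    using e(2) by auto
  have "compact K"
    unfolding K_def
    by (intro compact_continuous_image continuous_on_subset[OF continuous_chart_inv[OF c] im]) simp
  then have K: "closed K"
    by (rule compact_imp_closed)
  have KW: "K \<subseteq> chart_dom c" "K \<subseteq> U"
    using e(2) c by (auto simp: K_def)
  have f0: "f x = 0" if "x \<notin> K" for x
  proof (cases "x \<in> chart_dom c")
    case True
    have "chart_map c x \<notin> cball ?p e"
      using that c True unfolding K_def by (metis chart_inv_map image_eqI)
    then show ?thesis
      using b(3)[of "chart_map c x"] by (simp add: f_def r_def dist_commute)
  qed (simp add: f_def)
  have f1: "f x = 1" if "x \<in> N" for x
    using that b(2)[of "chart_map c x"] by (auto simp: N_def f_def dist_commute)
  have N: "open N" "p \<in> N"
    unfolding N_def using p r continuous_open_preimage[OF continuous_chart_map[OF c] open_dom[OF c] open_ball] by auto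
  have 1: "sm (chart_dom c) f"
    unfolding sm_def
  proof
    fix d assume d: "d \<in> A"
    have "smooth_on (ov d c) (\<lambda>u. b (transition d c u))"
      by (rule smooth_on_compose[OF open_ov[OF d c] open_UNIV _ smooth_transition[OF d c] b(1)]) simp
    then show "smooth_on (ov d c) (\<lambda>u. f (chart_inv d u))"
      by (rule smooth_on_transform[OF _ open_ov[OF d c]]) (use d in \<open>auto simp: f_def\<close>)
  qed
  have 2: "sm (- K) f"
    using sm_cong[of "- K" f "\<lambda>x. 0"] f0 K sm_const[of "- K"] by auto
  have "sm UNIV f"
  proof (rule sm_local)
    fix x
    show "\<exists>N. open N \<and> x \<in> N \<and> sm N f"
      using 1 2 KW(1) K open_dom[OF c] by (cases "x \<in> K") blast+
  qed
  then show thesis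
    using that N f1 K KW f0 by blast
qed

text \<open>The field that is constantly \<open>w\<close> in the chart \<open>c\<close>, cut off by
  a bump function at \<open>p\<close>. It supplies enough global fields to test the filtration at a
  single point.\<close>

lemma tangent_field_exists:
  assumes c: "c \<in> A" and p: "p \<in> chart_dom c" and w: "w \<in> V"
  obtains X where "X \<in> tangent_fields A V" "X c p = w"
proof -
  obtain f N K where f: "sm UNIV f" "p \<in> N" "\<And>x. x \<in> N \<Longrightarrow> f x = 1"
    "closed K" "K \<subseteq> chart_dom c" "\<And>x. x \<notin> K \<Longrightarrow> f x = (0::real)"
    using bump_on_manifold[OF c p open_UNIV UNIV_I] by metis
  define X where "X d y = (if d \<in> A \<and> y \<in> chart_dom d \<and> y \<in> chart_dom c then f y *\<^sub>R D_transition c d y w else 0)" for d y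
  have inV: "X d y \<in> V" for d y
    using subspace_V D_transition_V[OF c _ _ _ w] by (simp add: X_def subspace_scale subspace_0)
  have tr: "X e y = D_transition d e y (X d y)"
    if "d \<in> A" "e \<in> A" "y \<in> chart_dom d" "y \<in> chart_dom e" for d e y
    using that linear_scale[OF D_transition_linear[OF that]] linear_0[OF D_transition_linear[OF that]] c
    by (simp add: X_def D_transition_compose)
  have sm: "smooth_on (chart_map d ` chart_dom d) (\<lambda>u. X d (chart_inv d u))" if d: "d \<in> A" for d
  proof (rule smooth_on_local)
    fix u assume u: "u \<in> chart_map d ` chart_dom d"
    show "\<exists>T. open T \<and> u \<in> T \<and> smooth_on T (\<lambda>u. X d (chart_inv d u))"
    proof (cases "chart_inv d u \<in> K")
      case True
      then have uc: "u \<in> ov d c"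
        using f(5) u d by auto
      have "smooth_on (ov d c) (\<lambda>u. frechet_derivative (transition c d) (at (transition d c u)) w)"
        by (rule smooth_on_compose[OF open_ov[OF d c] open_ov[OF c d] _ smooth_transition[OF d c]
              smooth_on_deriv[OF smooth_transition[OF c d]]]) (simp add: transition_image[OF d])
      moreover have "smooth_on (ov d c) (\<lambda>u. f (chart_inv d u))"
        using sm_subset[OF f(1) subset_UNIV] d unfolding sm_def by blast
      ultimately have "smooth_on (ov d c) (\<lambda>u. f (chart_inv d u) *\<^sub>R frechet_derivative (transition c d) (at (transition d c u)) w)"
        by (intro smooth_on_scaleR open_ov c d)
      then have "smooth_on (ov d c) (\<lambda>u. X d (chart_inv d u))"
        by (rule smooth_on_transform[OF _ open_ov[OF d c]]) (use d in \<open>auto simp: X_def D_transition_def\<close>)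
      then show ?thesis
        using uc open_ov[OF d c] by blast
    next
      case False
      let ?T = "chart_map d ` (chart_dom d \<inter> - K)"
      have T: "open ?T"
        using f(4) d by (intro open_chart_image) auto
      have "smooth_on ?T (\<lambda>u. X d (chart_inv d u))"
        by (rule smooth_on_transform[OF smooth_on_const[OF T, of 0] T]) (use f(6) d in \<open>auto simp: X_def\<close>)
      moreover have "u \<in> ?T"
        using u d False by auto
      ultimately show ?thesis
        using T by blast
    qed
  qed
  have "X \<in> tangent_fields A V"
    unfolding tangent_fields_def vector_fields_def
  proof (intro CollectI conjI allI ballI impI)
    show "X d y = 0" if "\<not> (d \<in> A \<and> y \<in> chart_dom d)" for d y
      using that by (auto simp: X_def)
    show "X e y = D_transition d e y (X d y)" if "d \<in> A" "e \<in> A" "y \<in> chart_dom d \<inter> chart_dom e" for d e y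
      using that by (intro tr) auto
    show "smooth_on (chart_map d ` chart_dom d) (\<lambda>u. X d (chart_inv d u))" if "d \<in> A" for d
      by (rule sm[OF that])
    show "X d y \<in> V" for d y
      by (rule inV)
  qed
  moreover have "X c p = w"
    using c p f by (simp add: X_def)
  ultimately show thesis
    using that by blast
qed

section \<open>The filtration as a condition at each point\<close>

definition vdeg :: "nat \<Rightarrow> (nat \<Rightarrow> 'e) \<Rightarrow> nat"
  where "vdeg r v = card {i. i < r \<and> v i \<in> V}"

text \<open>The condition of F^p at one point: more than \<open>r - p\<close> leafwise arguments
  kill \<open>a\<close>. With addition instead of subtraction it also covers \<open>p > r\<close>,
  where it forces \<open>a = 0\<close>.\<close>

definition fvan :: "nat \<Rightarrow> nat \<Rightarrow> ((nat \<Rightarrow> 'e) \<Rightarrow> real) \<Rightarrow> bool"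
  where "fvan p r a \<longleftrightarrow> (\<forall>v. r < p + vdeg r v \<longrightarrow> a v = 0)"

text \<open>The argument list produced by iterated contraction. The field contracted first, the last
  of the list, ends up as the first argument, so the fields appear in reverse order.\<close>

fun front :: "('m, 'e) chart \<Rightarrow> 'm \<Rightarrow> ('m, 'e) vfield list \<Rightarrow> (nat \<Rightarrow> 'e) \<Rightarrow> nat \<Rightarrow> 'e"
  where "front c x [] v = v"
  | "front c x (X # Xs) v = front c x Xs (case_nat (X c x) v)"

lemma contracts_front:
  "length Xs \<le> r \<Longrightarrow> contracts r Xs \<omega> c x v = \<omega> c x (front c x Xs v)"
  by (induction Xs arbitrary: v) (simp_all add: contract_def)

text \<open>For \<open>p = 0\<close> the filtration asks for \<open>r + 1\<close> contractions of an
  r-form; the outermost one meets degree 0.\<close>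

lemma contracts_long: "r < length Xs \<Longrightarrow> contracts r Xs \<omega> c x v = 0"
proof (induction Xs arbitrary: v)
  case (Cons X Xs)
  then show ?case
    by (cases "r < length Xs") (simp_all add: contract_def)
qed simp

lemma front_nth: "front c x Xs v i = (if i < length Xs then (rev Xs ! i) c x else v (i - length Xs))"
proof (induction Xs arbitrary: v)
  case (Cons X Xs)
  show ?case
    by (simp add: Cons nth_append split: nat.split) (metis Suc_diff_Suc Suc_lessI diff_self_eq_0 less_irrefl linorder_neqE_nat nat.inject not_less_eq)
qed simp

text \<open>Contractions insert fields at the front only, so leafwise arguments elsewhere have to be
  brought there.\<close>

lemma permute_to_front:
  assumes "I \<subseteq> {..<r}" "m \<le> card I"
  obtains \<sigma> where "\<sigma> permutes {..<r}" "\<And>i. i < m \<Longrightarrow> \<sigma> i \<in> I"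
proof -
  obtain J where J: "J \<subseteq> I" "card J = m" "finite J"
    using obtain_subset_with_card_n[OF assms(2)] by blast
  have mr: "m \<le> r"
    using assms card_mono[of "{..<r}" I] by simp
  have "card {..<m} = card J" "card {m..<r} = card ({..<r} - J)"
    using J assms(1) mr by (auto simp: card_Diff_subset)
  then obtain f g where f: "bij_betw f {..<m} J" and g: "bij_betw g {m..<r} ({..<r} - J)"
    using J(3) finite_same_card_bij[of "{..<m}" J] finite_same_card_bij[of "{m..<r}" "{..<r} - J"] by auto
  define \<sigma> where "\<sigma> i = (if i < m then f i else if i < r then g i else i)" for i
  have "bij_betw \<sigma> {..<m} J" "bij_betw \<sigma> {m..<r} ({..<r} - J)"
    using f g bij_betw_cong[of "{..<m}" f \<sigma> J] bij_betw_cong[of "{m..<r}" g \<sigma> "{..<r} - J"]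
    by (auto simp: \<sigma>_def)
  then have "bij_betw \<sigma> ({..<m} \<union> {m..<r}) (J \<union> ({..<r} - J))"
    by (rule bij_betw_combine) auto
  moreover have "{..<m} \<union> {m..<r} = {..<r}" "J \<union> ({..<r} - J) = {..<r}"
    using mr J(1) assms(1) by auto
  ultimately have "bij_betw \<sigma> {..<r} {..<r}"
    by simp
  then have "\<sigma> permutes {..<r}"
    using mr by (intro bij_imp_permutes) (auto simp: \<sigma>_def)
  moreover have "\<sigma> i \<in> I" if "i < m" for i
    using that f J(1) by (auto simp: \<sigma>_def dest: bij_betwE)
  ultimately show thesis
    using that by blast
qed

text \<open>A permutation, which costs only a sign, puts \<open>r - p + 1\<close> leafwise arguments
  in front. They extend to tangent fields, and contraction with these fields gives zero by
  hypothesis.\<close>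

lemma fvan_if_filt:
  assumes \<omega>: "\<omega> \<in> filt A V p r" and c: "c \<in> A" and x: "x \<in> chart_dom c"
  shows "fvan p r (\<omega> c x)"
  unfolding fvan_def
proof (intro allI impI)
  fix v assume v: "r < p + vdeg r v"
  show "\<omega> c x v = 0"
  proof (cases "p \<le> r")
    case False
    then show ?thesis using \<omega> by (simp add: filt_def)
  next
    case True
    then have form: "\<omega> \<in> forms A r"
      and *: "\<And>Xs. length Xs = r - p + 1 \<Longrightarrow> set Xs \<subseteq> tangent_fields A V \<Longrightarrow> contracts r Xs \<omega> = (\<lambda>c x v. 0)"
      using \<omega> by (auto simp: filt_def)
    let ?m = "r - p + 1" and ?I = "{i. i < r \<and> v i \<in> V}"
    have I: "?I \<subseteq> {..<r}" and m: "?m \<le> card ?I"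
      using v True by (auto simp: vdeg_def)
    have mr: "?m \<le> r"
      using m card_mono[OF _ I] by simp
    obtain \<sigma> where \<sigma>: "\<sigma> permutes {..<r}" "\<And>i. i < ?m \<Longrightarrow> \<sigma> i \<in> ?I"
      using permute_to_front[OF I m] by blast
    have "\<exists>X. X \<in> tangent_fields A V \<and> X c x = v (\<sigma> i)" if "i < ?m" for i
      using tangent_field_exists[OF c x, of "v (\<sigma> i)"] \<sigma>(2)[OF that] by blast
    then obtain X where X: "\<And>i. i < ?m \<Longrightarrow> X i \<in> tangent_fields A V \<and> X i c x = v (\<sigma> i)"
      by metis
    define Xs where "Xs = rev (map X [0..<?m])"
    have Xs: "length Xs = ?m" "set Xs \<subseteq> tangent_fields A V" "\<And>i. i < ?m \<Longrightarrow> rev Xs ! i = X i"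
      using X by (auto simp: Xs_def simp del: upt_Suc)
    let ?v' = "\<lambda>j. v (\<sigma> (?m + j))"
    have "\<omega> c x (v \<circ> \<sigma>) = \<omega> c x (front c x Xs ?v')"
      by (rule arg_cong[of _ _ "\<omega> c x"]) (auto simp: fun_eq_iff front_nth Xs X simp del: One_nat_def)
    also have "\<dots> = contracts r Xs \<omega> c x ?v'"
      using contracts_front[of Xs r] Xs(1) mr by simp
    also have "\<dots> = 0"
      using *[OF Xs(1,2)] by simp
    finally show ?thesis
      using alternating_perm[OF forms_alternating[OF form c x] \<sigma>(1), of v] by simp
  qed
qed

lemma filt_forms: "\<omega> \<in> filt A V p r \<Longrightarrow> \<omega> \<in> forms A r"
  by (auto simp: filt_def forms_0 split: if_splits)

lemma filtI:
  assumes \<omega>: "\<omega> \<in> forms A r" and van: "\<And>c x. c \<in> A \<Longrightarrow> x \<in> chart_dom c \<Longrightarrow> fvan p r (\<omega> c x)"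
  shows "\<omega> \<in> filt A V p r"
proof (cases "p \<le> r")
  case True
  have "contracts r Xs \<omega> c x v = 0" if Xs: "length Xs = r - p + 1" "set Xs \<subseteq> tangent_fields A V" for Xs c x v
  proof (cases "r < length Xs")
    case True
    then show ?thesis by (rule contracts_long)
  next
    case False
    have "\<omega> c x (front c x Xs v) = 0"
    proof (cases "c \<in> A \<and> x \<in> chart_dom c")
      case True
      have "front c x Xs v i \<in> V" if "i < length Xs" for i
      proof -
        have "rev Xs ! i \<in> set Xs"
          using that by (metis length_rev nth_mem set_rev)
        then show ?thesis
          using Xs(2) True that by (auto simp: front_nth tangent_fields_def)
      qed
      then have "{..<length Xs} \<subseteq> {i. i < r \<and> front c x Xs v i \<in> V}"
        using False by auto
      from card_mono[OF _ this] have "length Xs \<le> vdeg r (front c x Xs v)"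
        by (simp add: vdeg_def)
      then show ?thesis
        using van[of c x] True Xs(1) \<open>p \<le> r\<close> unfolding fvan_def by auto
    qed (rule forms_outside[OF \<omega>])
    then show ?thesis
      using contracts_front[of Xs r] False by simp
  qed
  then show ?thesis
    using \<omega> True by (simp add: filt_def fun_eq_iff)
next
  case False
  have "\<omega> c x v = 0" for c x v
    using van[of c x] forms_outside[OF \<omega>, of c x v] False unfolding fvan_def by (cases "c \<in> A \<and> x \<in> chart_dom c") auto
  then have "\<omega> = (\<lambda>c x v. 0)"
    by (simp add: fun_eq_iff)
  then show ?thesis
    using False by (simp add: filt_def)
qed

lemma filt_iff: "\<omega> \<in> filt A V p r \<longleftrightarrow> \<omega> \<in> forms A r \<and> (\<forall>c\<in>A. \<forall>x\<in>chart_dom c. fvan p r (\<omega> c x))"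
  using filtI filt_forms fvan_if_filt by blast

lemma fvan_Suc: "fvan (Suc p) r a \<Longrightarrow> fvan p r a"
  unfolding fvan_def by auto

lemma fvan_add: "fvan p r a \<Longrightarrow> fvan p r b \<Longrightarrow> fvan p r (\<lambda>v. a v + b v)"
  unfolding fvan_def by simp

lemma fvan_scale: "fvan p r a \<Longrightarrow> fvan p r (\<lambda>v. k * a v)"
  unfolding fvan_def by simp

lemma fvan_0: "fvan p r (\<lambda>v. 0)"
  unfolding fvan_def by simp

lemma filt_Suc: "\<omega> \<in> filt A V (Suc p) r \<Longrightarrow> \<omega> \<in> filt A V p r"
  unfolding filt_iff using fvan_Suc by blast

lemma filt_add: "\<alpha> \<in> filt A V p r \<Longrightarrow> \<beta> \<in> filt A V p r \<Longrightarrow> (\<lambda>c x v. \<alpha> c x v + \<beta> c x v) \<in> filt A V p r"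
  unfolding filt_iff using fvan_add forms_add by simp

lemma filt_scale: "\<alpha> \<in> filt A V p r \<Longrightarrow> (\<lambda>c x v. k * \<alpha> c x v) \<in> filt A V p r"
  unfolding filt_iff using fvan_scale forms_scale by simp

lemma filt_0: "(\<lambda>c x v. 0) \<in> filt A V p r"
  unfolding filt_iff using fvan_0 forms_0 by simp

lemma vdeg_del:
  assumes "i \<le> r"
  shows "vdeg (Suc r) v \<le> Suc (vdeg r (del i v))"
proof -
  let ?f = "\<lambda>j. if j < i then j else Suc j"
  have "{j. j < Suc r \<and> v j \<in> V} \<subseteq> insert i (?f ` {j. j < r \<and> del i v j \<in> V})"
  proof
    fix j assume j: "j \<in> {j. j < Suc r \<and> v j \<in> V}"
    consider "j < i" | "j = i" | "i < j" by linarith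
    then show "j \<in> insert i (?f ` {j. j < r \<and> del i v j \<in> V})"
    proof cases
      case 1
      then show ?thesis
        using j assms by (intro insertI2 image_eqI[of _ _ j]) (auto simp: del_def)
    next
      case 3
      then show ?thesis
        using j by (intro insertI2 image_eqI[of _ _ "j - 1"]) (auto simp: del_def)
    qed simp
  qed
  then have "vdeg (Suc r) v \<le> card (insert i (?f ` {j. j < r \<and> del i v j \<in> V}))"
    unfolding vdeg_def by (intro card_mono) auto
  also have "\<dots> \<le> Suc (card (?f ` {j. j < r \<and> del i v j \<in> V}))"
    by (rule card_insert_le_m1) auto
  also have "\<dots> \<le> Suc (vdeg r (del i v))"
    unfolding vdeg_def by (intro Suc_le_mono[THEN iffD2] card_image_le) auto
  finally show ?thesis .
qed

text \<open>A term of d uses one argument as direction, so the coefficient that is differentiated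
  retains all leafwise arguments but at most one. As \<open>V\<close> is the same subspace at all
  points of a chart, this coefficient vanishes identically there, not just at
  \<open>x\<close>.\<close>

lemma ext_d_filt:
  assumes \<omega>: "\<omega> \<in> filt A V p r"
  shows "ext_d A r \<omega> \<in> filt A V p (Suc r)"
  unfolding filt_iff
proof (intro conjI ballI)
  show "ext_d A r \<omega> \<in> forms A (Suc r)"
    by (rule ext_d_forms[OF filt_forms[OF \<omega>]])
  fix c x assume c: "c \<in> A" and x: "x \<in> chart_dom c"
  have u: "chart_map c x \<in> chart_map c ` chart_dom c"
    using x by auto
  show "fvan p (Suc r) (ext_d A r \<omega> c x)"
    unfolding fvan_def
  proof (intro allI impI)
    fix v assume v: "Suc r < p + vdeg (Suc r) v"
    have "dd (lrep \<omega> c) (chart_map c x) (v i) (del i v) = 0" if i: "i \<le> r" for i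
    proof -
      have "r < p + vdeg r (del i v)"
        using v vdeg_del[OF i, of v] by linarith
      then have "lrep \<omega> c w (del i v) = 0" if "w \<in> chart_map c ` chart_dom c" for w
        using fvan_if_filt[OF \<omega> c, of "chart_inv c w"] that c unfolding fvan_def lrep_def by simp
      then have "frechet_derivative (\<lambda>u. lrep \<omega> c u (del i v)) (at (chart_map c x)) = frechet_derivative (\<lambda>u. 0) (at (chart_map c x))"
        by (rule frechet_derivative_cong_open[OF open_im[OF c] u])
      then show ?thesis
        by (simp add: dd_def)
    qed
    then show "ext_d A r \<omega> c x v = 0"
      by (simp add: ext_d_at[OF c x] dloc_def)
  qed
qed

lemma vdeg_perm:
  assumes "\<sigma> permutes {..<r}"
  shows "vdeg r (v \<circ> \<sigma>) = vdeg r v"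
proof -
  have "bij_betw \<sigma> {i. i < r \<and> (v \<circ> \<sigma>) i \<in> V} {i. i < r \<and> v i \<in> V}"
  proof (rule bij_betw_imageI)
    show "inj_on \<sigma> {i. i < r \<and> (v \<circ> \<sigma>) i \<in> V}"
      using permutes_inj[OF assms] by (auto intro: inj_on_subset)
    show "\<sigma> ` {i. i < r \<and> (v \<circ> \<sigma>) i \<in> V} = {i. i < r \<and> v i \<in> V}"
    proof (intro equalityI subsetI)
      fix j assume "j \<in> {i. i < r \<and> v i \<in> V}"
      moreover then obtain i where "j = \<sigma> i" "i < r"
        using permutes_image[OF assms] by (metis (no_types, lifting) imageE lessThan_iff mem_Collect_eq)
      ultimately show "j \<in> \<sigma> ` {i. i < r \<and> (v \<circ> \<sigma>) i \<in> V}"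
        by auto
    qed (use permutes_in_image[OF assms] in auto)
  qed
  then show ?thesis
    unfolding vdeg_def by (rule bij_betw_same_card)
qed

lemma vdeg_split: "vdeg (r + s) v \<le> vdeg r v + vdeg s (\<lambda>i. v (r + i))"
proof -
  have "{i. i < r + s \<and> v i \<in> V} \<subseteq> {i. i < r \<and> v i \<in> V} \<union> (+) r ` {i. i < s \<and> v (r + i) \<in> V}"
  proof
    fix i assume i: "i \<in> {i. i < r + s \<and> v i \<in> V}"
    show "i \<in> {i. i < r \<and> v i \<in> V} \<union> (+) r ` {i. i < s \<and> v (r + i) \<in> V}"
    proof (cases "i < r")
      case False
      then show ?thesis
        using i by (intro UnI2 image_eqI[of _ _ "i - r"]) auto
    qed (use i in auto)
  qed
  then have "vdeg (r + s) v \<le> card ({i. i < r \<and> v i \<in> V} \<union> (+) r ` {i. i < s \<and> v (r + i) \<in> V})"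
    unfolding vdeg_def by (intro card_mono) auto
  also have "\<dots> \<le> vdeg r v + card ((+) r ` {i. i < s \<and> v (r + i) \<in> V})"
    unfolding vdeg_def by (rule card_Un_le)
  also have "\<dots> \<le> vdeg r v + vdeg s (\<lambda>i. v (r + i))"
    unfolding vdeg_def by (intro add_left_mono card_image_le) auto
  finally show ?thesis .
qed

text \<open>Pigeonhole: however the arguments are distributed, more than (r + s) - (p + q) leafwise
  ones give more than r - p to \<open>\<alpha>\<close> or more than s - q to
  \<open>\<beta>\<close>.\<close>

lemma fvan_wedge:
  assumes \<alpha>: "fvan p r (\<alpha> c x)" and \<beta>: "fvan q s (\<beta> c x)"
  shows "fvan (p + q) (r + s) (wedge r s \<alpha> \<beta> c x)"
  unfolding fvan_def
proof (intro allI impI)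
  fix v assume v: "r + s < p + q + vdeg (r + s) v"
  have "\<alpha> c x (v \<circ> \<sigma>) * \<beta> c x (\<lambda>i. (v \<circ> \<sigma>) (r + i)) = 0" if \<sigma>: "\<sigma> permutes {..<r + s}" for \<sigma>
  proof -
    have "r + s < p + q + (vdeg r (v \<circ> \<sigma>) + vdeg s (\<lambda>i. (v \<circ> \<sigma>) (r + i)))"
      using v vdeg_split[of r s "v \<circ> \<sigma>"] vdeg_perm[OF \<sigma>, of v] by linarith
    then have "r < p + vdeg r (v \<circ> \<sigma>) \<or> s < q + vdeg s (\<lambda>i. (v \<circ> \<sigma>) (r + i))"
      by linarith
    then show ?thesis
      using \<alpha> \<beta> unfolding fvan_def by auto
  qed
  then show "wedge r s \<alpha> \<beta> c x v = 0"
    unfolding wedge_at Alt_def by (simp add: sum.neutral)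
qed

lemma wedge_filt:
  "\<alpha> \<in> filt A V p r \<Longrightarrow> \<beta> \<in> filt A V q s \<Longrightarrow> wedge r s \<alpha> \<beta> \<in> filt A V (p + q) (r + s)"
  unfolding filt_iff by (simp add: wedge_forms fvan_wedge)

section \<open>Cut-off functions\<close>

text \<open>Countably many bump functions, each vanishing outside some \<open>U i\<close>, yield
  functions \<open>f i\<close> with sum 1 that vanish outside \<open>U i\<close>. Among k + 1 of
  them one is at least 1/(k + 1) at any given point. The vanishing of \<open>f i\<close> need not
  extend to a neighbourhood of a boundary point of \<open>U i\<close>; composing with a shifted
  \<open>step\<close> gives values that are locally 0 there, and locally 1 where \<open>f i\<close>
  is large.\<close>

lemma cutoff_functions:
  fixes U :: "nat \<Rightarrow> 'm set" and k :: nat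
  assumes U: "\<And>i. i \<le> k \<Longrightarrow> open (U i)" "(\<Union>i\<le>k. U i) = manifold_set A"
  obtains \<phi> :: "nat \<Rightarrow> 'm \<Rightarrow> real" where "\<And>i. sm UNIV (\<phi> i)"
    "\<And>i x. x \<in> manifold_set A \<Longrightarrow> x \<notin> U i \<Longrightarrow> \<exists>N. open N \<and> x \<in> N \<and> (\<forall>y\<in>N. \<phi> i y = 0)"
    "\<And>x. x \<in> manifold_set A \<Longrightarrow> \<exists>i\<le>k. \<exists>N. open N \<and> x \<in> N \<and> (\<forall>y\<in>N. \<phi> i y = 1)"
proof (cases "manifold_set A = {}")
  case True
  then have "sm UNIV (\<lambda>x. 0)"
    by (intro sm_const) simp
  then show thesis
    using True that[of "\<lambda>i x. 0"] by auto
next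
  case False
  let ?M = "manifold_set A"
  have "\<exists>b N K i. sm UNIV b \<and> open N \<and> p \<in> N \<and> (\<forall>x\<in>N. b x = 1) \<and> i \<le> k \<and> K \<subseteq> U i \<and> (\<forall>x. x \<notin> K \<longrightarrow> b x = 0) \<and> N \<subseteq> ?M"
    if p: "p \<in> ?M" for p
  proof -
    obtain c where c: "c \<in> A" "p \<in> chart_dom c"
      using p unfolding manifold_set_def by blast
    obtain i where i: "i \<le> k" "p \<in> U i"
      using p U(2) by auto
    obtain b N K where b: "sm UNIV b" "open N" "p \<in> N" "\<And>x. x \<in> N \<Longrightarrow> b x = 1"
      "closed K" "K \<subseteq> chart_dom c" "K \<subseteq> U i" "\<And>x. x \<notin> K \<Longrightarrow> b x = 0"
      using bump_on_manifold[OF c U(1)[OF i(1)] i(2)] by blast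
    have "N \<inter> chart_dom c \<subseteq> ?M" "open (N \<inter> chart_dom c)"
      using c(1) b(2) open_dom[OF c(1)] by (auto simp: manifold_set_def)
    then show ?thesis
      using b c i by (intro exI[of _ b] exI[of _ "N \<inter> chart_dom c"] exI[of _ K] exI[of _ i]) auto
  qed
  then obtain b N K ix where b: "\<And>p. p \<in> ?M \<Longrightarrow> sm UNIV (b p) \<and> open (N p) \<and> p \<in> N p \<and> (\<forall>x\<in>N p. b p x = 1) \<and>
      ix p \<le> k \<and> K p \<subseteq> U (ix p) \<and> (\<forall>x. x \<notin> K p \<longrightarrow> b p x = (0::real)) \<and> N p \<subseteq> ?M"
    by metis
  obtain \<F> where \<F>: "\<F> \<subseteq> N ` ?M" "countable \<F>" "\<Union>\<F> = \<Union>(N ` ?M)"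
    using Lindelof[of "N ` ?M"] b by blast
  obtain P where P: "countable P" "P \<subseteq> ?M" "\<F> = N ` P"
    using \<F>(1,2) countable_subset_image[of \<F> N ?M] by auto
  have "?M \<subseteq> \<Union>(N ` ?M)"
    using b by blast
  then have cov: "?M \<subseteq> (\<Union>p\<in>P. N p)"
    using \<F>(3) P(3) by simp
  then have "P \<noteq> {}"
    using False by auto
  define e where "e = from_nat_into P"
  have e: "e n \<in> ?M" for n
    using from_nat_into[OF \<open>P \<noteq> {}\<close>, of n] P(2) by (auto simp: e_def)
  have eP: "\<exists>n. p = e n" if "p \<in> P" for p
    using from_nat_into_surj[OF P(1) that] by (auto simp: e_def)
  define B where "B n = b (e n)" for n
  define I where "I n = ix (e n)" for n
  have sB: "sm UNIV (B n)" and oN: "open (N (e n))" and B1: "x \<in> N (e n) \<Longrightarrow> B n x = 1" and Ik: "I n \<le> k"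
    and B0: "x \<notin> U (I n) \<Longrightarrow> B n x = 0" for n x
    using b[OF e] by (auto simp: B_def I_def)
  have ex: "\<exists>n. x \<in> N (e n)" if "x \<in> ?M" for x
    using cov that eP by blast
  \<comment> \<open>The sums of \<open>g\<close> telescope, and \<open>g n\<close> vanishes on
    \<open>N (e m)\<close> for \<open>n > m\<close>. So the family is locally finite without any
    refinement of the cover.\<close>
  define g where "g n x = B n x * (\<Prod>j<n. 1 - B j x)" for n x
  have sg: "sm UNIV (g n)" for n
    unfolding g_def by (intro sm_mult sm_prod sm_diff sm_const sB open_UNIV)
  have g0: "g n x = 0" if "x \<in> N (e m)" "m < n" for n m x
    using that B1[of x m] unfolding g_def by (intro mult_eq_0_iff[THEN iffD2] disjI2 prod_zero) auto
  have tele: "(\<Sum>n<m. g n x) = 1 - (\<Prod>j<m. 1 - B j x)" for m x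
    by (induction m) (auto simp: g_def algebra_simps)
  define L where "L x = (LEAST m. x \<in> N (e m))" for x
  have L: "x \<in> N (e (L x))" if "x \<in> ?M" for x
    using ex[OF that] unfolding L_def by (rule LeastI_ex)
  \<comment> \<open>The series is stopped at the first index whose set contains \<open>x\<close>. By
    \<open>feq\<close> any other index whose set contains \<open>x\<close> gives the same value, so
    near a point the number of terms can be kept fixed, which yields smoothness.\<close>
  define f where "f i x = (\<Sum>n<Suc (L x). if I n = i then g n x else 0)" for i x
  have feq: "f i x = (\<Sum>n<Suc m. if I n = i then g n x else 0)" if "x \<in> N (e m)" for i x m
    unfolding f_def
  proof (rule sum.mono_neutral_left)
    have "L x \<le> m"
      unfolding L_def using that by (rule Least_le)
    then show "{..<Suc (L x)} \<subseteq> {..<Suc m}"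
      by auto
    have "x \<in> ?M"
      using that b[OF e] by blast
    then show "\<forall>n\<in>{..<Suc m} - {..<Suc (L x)}. (if I n = i then g n x else 0) = 0"
      using g0[OF L] by auto
  qed simp
  have sf: "sm UNIV (f i)" for i
  proof (rule sm_local)
    fix x assume "x \<in> ?M"
    then obtain m where m: "x \<in> N (e m)"
      using ex by blast
    have "sm (N (e m)) (\<lambda>x. \<Sum>n<Suc m. if I n = i then g n x else 0)"
    proof (intro sm_sum oN)
      show "sm (N (e m)) (\<lambda>x. if I n = i then g n x else 0)" for n
        using sm_subset[OF sg subset_UNIV] sm_const[OF oN] by (cases "I n = i") auto
    qed
    then have "sm (N (e m)) (f i)"
      using sm_cong[OF oN feq] by simp
    then show "\<exists>N. open N \<and> x \<in> N \<and> sm N (f i)"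
      using m oN by blast
  qed
  have f0: "f i x = 0" if "x \<notin> U i" for i x
    unfolding f_def using that B0[of x] by (intro sum.neutral) (auto simp: g_def)
  have f1: "(\<Sum>i\<le>k. f i x) = 1" if "x \<in> ?M" for x
  proof -
    have "(\<Sum>i\<le>k. f i x) = (\<Sum>n<Suc (L x). \<Sum>i\<le>k. if I n = i then g n x else 0)"
      unfolding f_def by (rule sum.swap)
    also have "\<dots> = (\<Sum>n<Suc (L x). g n x)"
      using Ik by (intro sum.cong refl) simp
    also have "\<dots> = 1"
      unfolding tele using B1[OF L[OF that]] by (simp add: prod_zero)
    finally show ?thesis .
  qed
  have fbig: "\<exists>i\<le>k. f i x \<ge> 1 / (real k + 1)" if "x \<in> ?M" for x
  proof (rule ccontr)
    assume "\<not> ?thesis"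
    then have "f i x < 1 / (real k + 1)" if "i \<le> k" for i
      using that by (meson not_le)
    then have "(\<Sum>i\<le>k. f i x) < (\<Sum>i\<le>k. 1 / (real k + 1))"
      by (intro sum_strict_mono) auto
    then show False
      using f1[OF that] by simp
  qed
  \<comment> \<open>The argument of \<open>step\<close> is at most 0 where \<open>f i\<close> is at
    most 1/(3(k + 1)), and at least 1 where it is at least 2/(3(k + 1)). Both thresholds lie
    strictly between 0 and 1/(k + 1), which makes the two conditions open.\<close>
  define \<phi> where "\<phi> i x = step (3 * (real k + 1) * f i x - 1)" for i x
  show thesis
  proof (rule that[of \<phi>])
    show "sm UNIV (\<phi> i)" for i
      unfolding \<phi>_def by (intro sm_step sm_diff sm_mult sm_const sf open_UNIV)
    have nb: "\<exists>N. open N \<and> x \<in> N \<and> (\<forall>y\<in>N. f i y \<in> T)" if x: "x \<in> ?M" and T: "open T" "f i x \<in> T" for i x T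
      using sm_continuous[OF sf x, of i] T unfolding continuous_at_open by blast
    show "\<exists>N. open N \<and> x \<in> N \<and> (\<forall>y\<in>N. \<phi> i y = 0)" if x: "x \<in> ?M" "x \<notin> U i" for i x
    proof -
      have "\<exists>N. open N \<and> x \<in> N \<and> (\<forall>y\<in>N. f i y \<in> {..<1 / (3 * (real k + 1))})"
        using f0[OF x(2)] by (intro nb x) auto
      moreover have "\<phi> i y = 0" if "f i y \<in> {..<1 / (3 * (real k + 1))}" for y
        using that unfolding \<phi>_def by (intro step_0) (simp add: field_simps)
      ultimately show ?thesis by meson
    qed
    show "\<exists>i\<le>k. \<exists>N. open N \<and> x \<in> N \<and> (\<forall>y\<in>N. \<phi> i y = 1)" if x: "x \<in> ?M" for x
    proof -
      obtain i where i: "i \<le> k" "f i x \<ge> 1 / (real k + 1)"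
        using fbig[OF x] by blast
      have "2 / (3 * (real k + 1)) < 1 / (real k + 1)"
        by (simp add: field_simps)
      then have "\<exists>N. open N \<and> x \<in> N \<and> (\<forall>y\<in>N. f i y \<in> {2 / (3 * (real k + 1))<..})"
        using i(2) by (intro nb x) auto
      moreover have "\<phi> i y = 1" if "f i y \<in> {2 / (3 * (real k + 1))<..}" for y
        using that unfolding \<phi>_def by (intro step_1) (simp add: field_simps)
      ultimately show ?thesis
        using i(1) by meson
    qed
  qed
qed

section \<open>Leaves\<close>

text \<open>The cosets of V met by a leaf in the charts of a countable atlas are obtained from those of
  one point by countably many partial transition maps.\<close>

lemma leaf_countable_cosets:
  assumes A0: "A0 \<subseteq> A" "countable A0" "manifold_set A \<subseteq> (\<Union>c\<in>A0. chart_dom c)"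
    and x0: "x0 \<in> manifold_set A"
  obtains S where "countable S"
    "\<And>y c. (same_plaque A V)\<^sup>*\<^sup>* x0 y \<Longrightarrow> c \<in> A0 \<Longrightarrow> y \<in> chart_dom c \<Longrightarrow> (c, proj (chart_map c y)) \<in> S"
proof -
  obtain \<B> :: "'m set set" where \<B>: "countable \<B>" "topological_basis \<B>"
    using ex_countable_basis by blast
  define good where "good X c d \<longleftrightarrow> X \<subseteq> chart_dom c \<inter> chart_dom d \<and>
      (\<forall>y\<in>X. \<forall>z\<in>X. proj (chart_map c y) = proj (chart_map c z) \<longrightarrow> proj (chart_map d y) = proj (chart_map d z))"
    for X and c d :: "('m, 'e) chart"
  have good_ex: "\<exists>X\<in>\<B>. y \<in> X \<and> good X c d"
    if cd: "c \<in> A" "d \<in> A" "y \<in> chart_dom c" "y \<in> chart_dom d" for c d y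
  proof -
    obtain W where W: "open W" "chart_map c y \<in> W" "W \<subseteq> ov c d"
      "\<And>u w. u \<in> W \<Longrightarrow> w \<in> W \<Longrightarrow> u - w \<in> V \<Longrightarrow> transition c d u - transition c d w \<in> V"
      using transition_local[OF cd] by metis
    let ?X = "chart_dom d \<inter> (chart_dom c \<inter> chart_map c -` W)"
    have "open ?X" "y \<in> ?X"
      using continuous_open_preimage[OF continuous_chart_map[OF cd(1)] open_dom[OF cd(1)] W(1)] open_dom[OF cd(2)] cd W(2)
      by auto
    then obtain X where X: "X \<in> \<B>" "y \<in> X" "X \<subseteq> ?X"
      using topological_basisE[OF \<B>(2), of ?X y] by metis
    have "proj (chart_map d p) = proj (chart_map d q)"
      if "p \<in> X" "q \<in> X" "proj (chart_map c p) = proj (chart_map c q)" for p q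
    proof -
      have "p \<in> ?X" "q \<in> ?X"
        using that X(3) by auto
      then show ?thesis
        using W(4)[of "chart_map c p" "chart_map c q"] that(3) cd by (simp add: proj_eq_iff)
    qed
    then show ?thesis
      using X unfolding good_def by blast
  qed
  \<comment> \<open>For given \<open>(c, s)\<close>, \<open>d\<close> and \<open>X\<close> there is
    at most one \<open>t\<close>, so the image of a countable set under \<open>R\<close> is
    countable.\<close>
  define R where "R = {((c, s), (d, t)). d \<in> A0 \<and> (\<exists>X\<in>\<B>. good X c d \<and> (\<exists>y\<in>X. proj (chart_map c y) = s \<and> proj (chart_map d y) = t))}"
  have "countable (R `` Y)" if "countable Y" for Y
  proof -
    let ?Z = "\<lambda>(c, s) d X. {(d, t) | t. good X c d \<and> (\<exists>y\<in>X. proj (chart_map c y) = s \<and> proj (chart_map d y) = t)}"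
    have "countable (?Z cs d X)" for cs d X
    proof -
      have "finite (?Z cs d X)"
      proof (cases "?Z cs d X = {}")
        case False
        obtain c s where cs: "cs = (c, s)"
          by (cases cs)
        obtain p where p: "p \<in> ?Z cs d X"
          using False by blast
        then obtain t y where t: "p = (d, t)" "good X c d" "y \<in> X" "proj (chart_map c y) = s" "proj (chart_map d y) = t"
          unfolding cs by auto
        have "?Z cs d X \<subseteq> {p}"
        proof
          fix q assume "q \<in> ?Z cs d X"
          then obtain t' y' where "q = (d, t')" "y' \<in> X" "proj (chart_map c y') = s" "proj (chart_map d y') = t'"
            unfolding cs by auto
          moreover from this have "proj (chart_map d y') = proj (chart_map d y)"
            using t(2)[unfolded good_def, THEN conjunct2, rule_format, OF _ t(3)] t(4) by simp
          ultimately show "q \<in> {p}"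
            unfolding singleton_iff t(1) t(5)[symmetric] by (simp only:)
        qed
        then show ?thesis
          by (rule finite_subset) simp
      qed (simp only: finite.emptyI)
      then show ?thesis
        by (rule countable_finite)
    qed
    then have "countable (\<Union>cs\<in>Y. \<Union>d\<in>A0. \<Union>X\<in>\<B>. ?Z cs d X)"
      using that A0(2) \<B>(1) by (intro countable_UN)
    moreover have "R `` Y \<subseteq> (\<Union>cs\<in>Y. \<Union>d\<in>A0. \<Union>X\<in>\<B>. ?Z cs d X)"
    proof
      fix q assume "q \<in> R `` Y"
      then obtain p where p: "p \<in> Y" "(p, q) \<in> R"
        by blast
      obtain c s d t where cs: "p = (c, s)" "q = (d, t)"
        by (cases p, cases q) blast
      then obtain X where X: "d \<in> A0" "X \<in> \<B>" "good X c d" "\<exists>y\<in>X. proj (chart_map c y) = s \<and> proj (chart_map d y) = t"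
        using p(2) unfolding R_def by blast
      then have "q \<in> ?Z p d X"
        unfolding cs by simp
      then show "q \<in> (\<Union>cs\<in>Y. \<Union>d\<in>A0. \<Union>X\<in>\<B>. ?Z cs d X)"
        using p(1) X(1,2) by blast
    qed
    ultimately show ?thesis
      by (rule countable_subset[rotated])
  qed
  then have S: "countable (R\<^sup>* `` ((\<lambda>c. (c, proj (chart_map c x0))) ` A0))" (is "countable ?S")
    using A0(2) by (intro countable_rtrancl) auto
  \<comment> \<open>By \<open>Tiff\<close> a single chart of \<open>A0\<close> around
    \<open>y\<close> decides \<open>T y\<close>. This makes \<open>T\<close> locally constant along
    a plaque, hence constant on connected subsets of it, and so it spreads from \<open>x0\<close>
    over the whole leaf.\<close>
  define T where "T y \<longleftrightarrow> (\<forall>c\<in>A0. y \<in> chart_dom c \<longrightarrow> (c, proj (chart_map c y)) \<in> ?S)" for y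
  have Tiff: "T y \<longleftrightarrow> (c, proj (chart_map c y)) \<in> ?S" if c: "c \<in> A0" "y \<in> chart_dom c" for y c
  proof
    assume *: "(c, proj (chart_map c y)) \<in> ?S"
    show "T y"
      unfolding T_def
    proof (intro ballI impI)
      fix d assume d: "d \<in> A0" "y \<in> chart_dom d"
      obtain X where "X \<in> \<B>" "y \<in> X" "good X c d"
        using good_ex[of c d y] c d A0(1) by blast
      then have "((c, proj (chart_map c y)), (d, proj (chart_map d y))) \<in> R"
        unfolding R_def using d(1) by blast
      then show "(d, proj (chart_map d y)) \<in> ?S"
        using * by (meson Image_iff rtrancl.rtrancl_into_rtrancl)
    qed
  qed (use c T_def in auto)
  have step: "T y \<longleftrightarrow> T z" if sp: "same_plaque A V y z" for y z
  proof -
    obtain e where e: "e \<in> A" "y \<in> chart_dom e" "z \<in> chart_dom e"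
      "connected_component (chart_map e ` chart_dom e \<inter> (+) (chart_map e y) ` V) (chart_map e y) (chart_map e z)"
      using sp unfolding same_plaque_def by blast
    obtain C where C: "connected C" "C \<subseteq> chart_map e ` chart_dom e \<inter> (+) (chart_map e y) ` V"
      "chart_map e y \<in> C" "chart_map e z \<in> C"
      using e(4) unfolding connected_component_def by blast
    have pC: "proj w = proj (chart_map e y)" if "w \<in> C" for w
      using C(2) that by (auto simp: proj_eq_iff)
    have "T (chart_inv e (chart_map e y)) = T (chart_inv e (chart_map e z))"
    proof (rule connected_local_const[OF C(1,3,4)], intro ballI)
      fix w assume w: "w \<in> C"
      then have we: "w \<in> chart_map e ` chart_dom e"
        using C(2) by auto
      let ?p = "chart_inv e w"
      have p: "?p \<in> chart_dom e" "chart_map e ?p = w"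
        using we e(1) by auto
      then have "?p \<in> manifold_set A"
        using e(1) unfolding manifold_set_def by blast
      then obtain c where c: "c \<in> A0" "?p \<in> chart_dom c"
        using A0(3) by blast
      then obtain X where X: "X \<in> \<B>" "?p \<in> X" "good X e c"
        using good_ex[of e c ?p] p e(1) A0(1) by blast
      have N: "open (chart_map e ` (chart_dom e \<inter> X))" "w \<in> chart_map e ` (chart_dom e \<inter> X)"
        using open_chart_image[OF e(1) topological_basis_open[OF \<B>(2) X(1)]] p X(2)
        by (auto intro: image_eqI[of _ _ ?p])
      have "T ?p = T (chart_inv e w')" if w': "w' \<in> C" "w' \<in> chart_map e ` (chart_dom e \<inter> X)" for w'
      proof -
        obtain q where q: "q \<in> chart_dom e" "q \<in> X" "w' = chart_map e q"
          using w'(2) by auto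
        have "proj (chart_map e ?p) = proj (chart_map e q)"
          using pC[OF w] pC[OF w'(1)] p(2) q(3) by simp
        then have "proj (chart_map c ?p) = proj (chart_map c q)"
          using X(2,3) q(2) unfolding good_def by blast
        moreover have "q \<in> chart_dom c"
          using X(3) q(2) unfolding good_def by blast
        ultimately show ?thesis
          using Tiff[OF c] Tiff[OF c(1), of q] q e(1) by simp
      qed
      then show "\<forall>\<^sub>F w' in at w within C. T ?p = T (chart_inv e w')"
        unfolding eventually_at_topological using N by blast
    qed
    then show ?thesis
      using e by simp
  qed
  have "T x0"
    unfolding T_def by blast
  have "T y" if "(same_plaque A V)\<^sup>*\<^sup>* x0 y" for y
    using that by (induction rule: rtranclp_induct) (use step \<open>T x0\<close> in auto)
  then show thesis
    using that[OF S] unfolding T_def by blast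
qed

text \<open>Plaques of one leaf may accumulate on each other, so continuity in M does not by itself
  keep the curve in a plaque. Modulo \<open>V\<close>, however, its image is connected and
  countable, hence a point. The counting is done in a chart \<open>c\<close> of a countable
  subatlas, and the result is then carried over to the given chart \<open>d\<close>.\<close>

lemma curve_in_leaf:
  fixes \<gamma> :: "real \<Rightarrow> 'm"
  assumes L: "L \<in> leaves A V" and I: "open I" "s0 \<in> I" "continuous_on I \<gamma>" "\<gamma> ` I \<subseteq> L"
    and d: "d \<in> A" "\<gamma> s0 \<in> chart_dom d"
  shows "\<forall>\<^sub>F s in nhds s0. proj (chart_map d (\<gamma> s)) = proj (chart_map d (\<gamma> s0))"
proof -
  obtain x0 where x0: "x0 \<in> manifold_set A" "L = {y. (same_plaque A V)\<^sup>*\<^sup>* x0 y}"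
    using L unfolding leaves_def by blast
  obtain \<F> where \<F>: "\<F> \<subseteq> chart_dom ` A" "countable \<F>" "\<Union>\<F> = \<Union>(chart_dom ` A)"
    using Lindelof[of "chart_dom ` A"] open_dom by blast
  obtain A0 where A0: "countable A0" "A0 \<subseteq> A" "\<F> = chart_dom ` A0"
    using \<F>(1,2) countable_subset_image[of \<F> chart_dom A] by auto
  have cov: "manifold_set A \<subseteq> (\<Union>c\<in>A0. chart_dom c)"
    using \<F>(3) A0(3) by (simp add: manifold_set_def)
  obtain S where S: "countable S"
    "\<And>y c. (same_plaque A V)\<^sup>*\<^sup>* x0 y \<Longrightarrow> c \<in> A0 \<Longrightarrow> y \<in> chart_dom c \<Longrightarrow> (c, proj (chart_map c y)) \<in> S"
    using leaf_countable_cosets[OF A0(2,1) cov x0(1)] by metis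
  have "\<gamma> s0 \<in> manifold_set A"
    using d unfolding manifold_set_def by blast
  then obtain c where c: "c \<in> A0" "\<gamma> s0 \<in> chart_dom c"
    using cov by blast
  have cA: "c \<in> A" using c A0 by blast
  obtain W where W: "open W" "chart_map c (\<gamma> s0) \<in> W" "W \<subseteq> ov c d"
    "\<And>u w. u \<in> W \<Longrightarrow> w \<in> W \<Longrightarrow> u - w \<in> V \<Longrightarrow> transition c d u - transition c d w \<in> V"
    using transition_local[OF cA d(1) c(2) d(2)] by metis
  let ?X = "chart_dom c \<inter> chart_map c -` W"
  have X: "open ?X"
    by (rule continuous_open_preimage[OF continuous_chart_map[OF cA] open_dom[OF cA] W(1)])
  have "open (I \<inter> \<gamma> -` ?X)"
    by (rule continuous_open_preimage[OF I(3,1) X])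
  then obtain e where e: "e > 0" "ball s0 e \<subseteq> I \<inter> \<gamma> -` ?X"
    using I(2) c(2) W(2) unfolding open_contains_ball by blast
  let ?f = "\<lambda>s. proj (chart_map c (\<gamma> s))"
  have "continuous_on (ball s0 e) ?f"
    using e(2)
    by (intro bounded_linear.continuous_on[OF bounded_linear_proj] continuous_on_compose2[OF continuous_chart_map[OF cA]]
        continuous_on_subset[OF I(3)]) auto
  then have conn: "connected (?f ` ball s0 e)"
    by (rule connected_continuous_image) simp
  have "?f ` ball s0 e \<subseteq> snd ` S"
  proof
    fix y assume "y \<in> ?f ` ball s0 e"
    then obtain s where s: "s \<in> ball s0 e" "y = ?f s" by blast
    have "\<gamma> s \<in> L" "\<gamma> s \<in> chart_dom c"
      using s(1) e(2) I(4) by blast+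
    then have "(c, ?f s) \<in> S"
      using S(2)[OF _ c(1)] x0(2) by blast
    then show "y \<in> snd ` S"
      using s(2) by force
  qed
  then have cnt: "countable (?f ` ball s0 e)"
    using S(1) by (meson countable_image countable_subset)
  have "proj (chart_map d (\<gamma> s)) = proj (chart_map d (\<gamma> s0))" if s: "s \<in> ball s0 e" for s
  proof -
    have "?f s = ?f s0"
    proof (rule ccontr)
      assume ne: "?f s \<noteq> ?f s0"
      have "uncountable (?f ` ball s0 e)"
        by (rule connected_uncountable[OF conn _ _ ne]) (use s e(1) in auto)
      then show False
        using cnt by blast
    qed
    moreover have "s \<in> I \<inter> \<gamma> -` ?X"
      using s e(2) by blast
    ultimately show ?thesis
      using W(2) W(4)[of "chart_map c (\<gamma> s)" "chart_map c (\<gamma> s0)"] c cA by (simp add: proj_eq_iff)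
  qed
  moreover have "\<forall>\<^sub>F s in nhds s0. s \<in> ball s0 e"
    using e(1) by (intro eventually_nhds_in_open) auto
  ultimately show ?thesis
    by (rule eventually_mono[rotated])
qed

end

section \<open>The homotopy operator of a tangential contraction\<close>

locale tangential_homotopy = foliation A V
  for A :: "('m::{second_countable_topology, t2_space}, 'e::{real_inner, heine_borel}) chart set" and V +
  fixes U :: "'m set" and H :: "'m \<times> real \<Rightarrow> 'm"
  assumes open_U: "open U" and U_subset: "U \<subseteq> manifold_set A"
    and H_smooth: "smooth_map (times_line (restrict_atlas A U)) A H"
    and H_0: "\<And>x. x \<in> U \<Longrightarrow> H (x, 0) = x"
    and H_leaf: "\<And>L'. L' \<in> leaves (restrict_atlas A U) V \<Longrightarrow> \<exists>L\<in>leaves A V. H ` (L' \<times> UNIV) \<subseteq> L"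
    and H_1: "\<And>L'. L' \<in> leaves (restrict_atlas A U) V \<Longrightarrow> \<exists>z. \<forall>x\<in>L'. H (x, 1) = z"
begin

definition UI :: "('m, 'e) chart \<Rightarrow> 'e set"
  where "UI c = chart_map c ` (chart_dom c \<inter> U)"

definition Hc :: "('m, 'e) chart \<Rightarrow> 'e \<times> real \<Rightarrow> 'm"
  where "Hc c z = H (chart_inv c (fst z), snd z)"

definition HS :: "('m, 'e) chart \<Rightarrow> ('m, 'e) chart \<Rightarrow> ('e \<times> real) set"
  where "HS c d = {z \<in> UI c \<times> UNIV. Hc c z \<in> chart_dom d}"

definition Hcd :: "('m, 'e) chart \<Rightarrow> ('m, 'e) chart \<Rightarrow> 'e \<times> real \<Rightarrow> 'e"
  where "Hcd c d z = chart_map d (Hc c z)"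

definition DH :: "('m, 'e) chart \<Rightarrow> ('m, 'e) chart \<Rightarrow> 'e \<times> real \<Rightarrow> 'e \<times> real \<Rightarrow> 'e"
  where "DH c d z = frechet_derivative (Hcd c d) (at z)"

lemma open_UI: "c \<in> A \<Longrightarrow> open (UI c)"
  unfolding UI_def by (rule open_chart_image[OF _ open_U])

lemma UI_inv: "c \<in> A \<Longrightarrow> u \<in> UI c \<Longrightarrow> chart_inv c u \<in> chart_dom c \<and> chart_inv c u \<in> U \<and> chart_map c (chart_inv c u) = u"
  unfolding UI_def by auto

lemma manifold_times: "manifold_set (times_line (restrict_atlas A U)) = U \<times> UNIV"
  using U_subset by (auto simp: manifold_set_def times_line_def restrict_atlas_def)

lemma Hc_continuous: "c \<in> A \<Longrightarrow> continuous_on (UI c \<times> UNIV) (Hc c)"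
proof -
  assume c: "c \<in> A"
  have "continuous_on (U \<times> UNIV) H"
    using H_smooth unfolding smooth_map_def manifold_times by blast
  moreover have "continuous_on (UI c \<times> (UNIV :: real set)) (\<lambda>z. (chart_inv c (fst z), snd z))"
    by (intro continuous_on_Pair continuous_on_compose2[OF continuous_chart_inv[OF c]] continuous_intros) (auto simp: UI_def)
  ultimately show ?thesis
    unfolding Hc_def by (rule continuous_on_compose2) (use UI_inv[OF c] in auto)
qed

lemma open_HS: "c \<in> A \<Longrightarrow> d \<in> A \<Longrightarrow> open (HS c d)"
proof -
  assume cd: "c \<in> A" "d \<in> A"
  have "HS c d = UI c \<times> UNIV \<inter> Hc c -` chart_dom d"
    by (auto simp: HS_def)
  then show ?thesis
    using continuous_open_preimage[OF Hc_continuous[OF cd(1)] open_Times[OF open_UI[OF cd(1)] open_UNIV] open_dom[OF cd(2)]]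
    by simp
qed

lemma HS_cover:
  assumes "c \<in> A" "z \<in> UI c \<times> UNIV"
  shows "\<exists>d\<in>A. z \<in> HS c d"
proof -
  have "(chart_inv c (fst z), snd z) \<in> U \<times> UNIV"
    using UI_inv[OF assms(1)] assms(2) by auto
  then have "Hc c z \<in> manifold_set A"
    using H_smooth unfolding smooth_map_def manifold_times Hc_def by blast
  then show ?thesis
    using assms(2) by (auto simp: manifold_set_def HS_def)
qed

lemma smooth_Hcd:
  assumes c: "c \<in> A" and d: "d \<in> A"
  shows "smooth_on (HS c d) (Hcd c d)"
proof -
  define c' :: "('m \<times> real, 'e \<times> real) chart" where "c' = ((chart_dom c \<inter> U) \<times> UNIV, map_prod (chart_map c) id)"
  have c': "c' \<in> times_line (restrict_atlas A U)"
    unfolding c'_def times_line_def restrict_atlas_def using c by (force simp: image_iff)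
  have inj: "inj_on (chart_map c) (chart_dom c)"
    using chart_inv_map[OF c] by (rule inj_on_inverseI)
  \<comment> \<open>\<open>chart_inv\<close> is an \<open>inv_into\<close> of the domain, here a
    restricted one; injectivity on the larger domain shows that the two inverses agree.\<close>
  have inv: "chart_inv c' z = (chart_inv c (fst z), snd z)" if "z \<in> UI c \<times> UNIV" for z
    unfolding chart_inv_def[of c']
  proof (rule inv_into_f_eq)
    show "inj_on (chart_map c') (chart_dom c')"
      using inj by (auto simp: c'_def inj_on_def)
    show "(chart_inv c (fst z), snd z) \<in> chart_dom c'" "chart_map c' (chart_inv c (fst z), snd z) = z"
      using UI_inv[OF c, of "fst z"] that by (auto simp: c'_def prod_eq_iff)
  qed
  have "chart_map c' ` (chart_dom c' \<inter> H -` chart_dom d) = HS c d"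
  proof (intro equalityI subsetI)
    fix z assume "z \<in> chart_map c' ` (chart_dom c' \<inter> H -` chart_dom d)"
    then obtain x t where "x \<in> chart_dom c" "x \<in> U" "H (x, t) \<in> chart_dom d" "z = (chart_map c x, t)"
      by (auto simp: c'_def)
    then show "z \<in> HS c d"
      using c by (auto simp: HS_def UI_def Hc_def)
  next
    fix z assume "z \<in> HS c d"
    then show "z \<in> chart_map c' ` (chart_dom c' \<inter> H -` chart_dom d)"
      using UI_inv[OF c, of "fst z"]
      by (intro image_eqI[of _ _ "(chart_inv c (fst z), snd z)"]) (auto simp: HS_def Hc_def c'_def prod_eq_iff)
  qed
  then have "smooth_on (HS c d) (chart_map d \<circ> H \<circ> chart_inv c')"
    using H_smooth c' d unfolding smooth_map_def by metis
  then show ?thesis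
    by (rule smooth_on_transform[OF _ open_HS[OF c d]]) (auto simp: HS_def inv Hcd_def Hc_def)
qed

lemma Hcd_derivative: "c \<in> A \<Longrightarrow> d \<in> A \<Longrightarrow> z \<in> HS c d \<Longrightarrow> (Hcd c d has_derivative DH c d z) (at z)"
  unfolding DH_def by (rule smooth_on_has_derivative[OF smooth_Hcd])

lemma DH_change_target:
  assumes cd: "c \<in> A" "d \<in> A" "e \<in> A" and z: "z \<in> HS c d" "z \<in> HS c e"
  shows "DH c e z w = D_transition d e (Hc c z) (DH c d z w)"
proof -
  have "((\<lambda>z. transition d e (Hcd c d z)) has_derivative (\<lambda>w. D_transition d e (Hc c z) (DH c d z w))) (at z)"
    by (rule has_derivative_compose[OF Hcd_derivative[OF cd(1,2) z(1)]])
      (use D_transition_derivative[OF cd(2,3), of "Hc c z"] z in \<open>auto simp: Hcd_def HS_def\<close>)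
  then have "(Hcd c e has_derivative (\<lambda>w. D_transition d e (Hc c z) (DH c d z w))) (at z)"
    by (rule has_derivative_transform_open[OF _ open_HS[OF cd(1,2)] z(1)]) (use cd in \<open>auto simp: Hcd_def HS_def\<close>)
  from fun_cong[OF has_derivative_unique[OF Hcd_derivative[OF cd(1,3) z(2)] this], of w] show ?thesis .
qed

lemma DH_change_source:
  assumes cd: "c \<in> A" "c' \<in> A" "d \<in> A" and x: "x \<in> chart_dom c" "x \<in> chart_dom c'" and z: "(chart_map c x, t) \<in> HS c d"
  shows "(chart_map c' x, t) \<in> HS c' d"
    "DH c d (chart_map c x, t) w = DH c' d (chart_map c' x, t) (D_transition c c' x (fst w), snd w)"
proof -
  let ?z = "(chart_map c x, t)"
  have xU: "x \<in> U"
    using z x cd(1) by (auto simp: HS_def UI_def) (metis chart_inv_map cd(1))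
  show z': "(chart_map c' x, t) \<in> HS c' d"
    using z x cd xU by (auto simp: HS_def UI_def Hc_def)
  let ?T = "HS c d \<inter> (ov c c' \<times> UNIV)"
  have T: "open ?T" "?z \<in> ?T"
    using z x cd by (auto intro!: open_Int open_HS open_Times open_ov)
  have "((\<lambda>z. (transition c c' (fst z), snd z)) has_derivative (\<lambda>w. (D_transition c c' x (fst w), snd w))) (at ?z)"
  proof (intro has_derivative_Pair has_derivative_snd has_derivative_ident)
    show "((\<lambda>z. transition c c' (fst z)) has_derivative (\<lambda>w. D_transition c c' x (fst w))) (at ?z)"
      by (rule has_derivative_compose[OF has_derivative_fst[OF has_derivative_ident]])
        (use D_transition_derivative[OF cd(1,2) x] in simp)
  qed
  then have "((\<lambda>z. Hcd c' d (transition c c' (fst z), snd z)) has_derivative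
      (\<lambda>w. DH c' d (chart_map c' x, t) (D_transition c c' x (fst w), snd w))) (at ?z)"
    by (rule has_derivative_compose) (use Hcd_derivative[OF cd(2,3) z'] cd x in simp)
  then have "(Hcd c d has_derivative (\<lambda>w. DH c' d (chart_map c' x, t) (D_transition c c' x (fst w), snd w))) (at ?z)"
    by (rule has_derivative_transform_open[OF _ T]) (use cd in \<open>auto simp: Hcd_def Hc_def\<close>)
  from fun_cong[OF has_derivative_unique[OF Hcd_derivative[OF cd(1,3) z] this], of w]
  show "DH c d ?z w = DH c' d (chart_map c' x, t) (D_transition c c' x (fst w), snd w)" .
qed

text \<open>A short segment parallel to \<open>V\<close> is a connected subset of one coset inside
  the chart image of \<open>U\<close>, so its points lie in a common plaque of
  \<open>U\<close>.\<close>

lemma local_leaf: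
  assumes c: "c \<in> A" and u: "u \<in> UI c" and v: "v \<in> V"
  obtains L' e where "L' \<in> leaves (restrict_atlas A U) V" "e > 0"
    "\<And>s. \<bar>s\<bar> < e \<Longrightarrow> u + s *\<^sub>R v \<in> UI c \<and> chart_inv c (u + s *\<^sub>R v) \<in> L'"
proof -
  let ?x = "chart_inv c u" and ?c = "(chart_dom c \<inter> U, chart_map c)"
  have x: "?x \<in> chart_dom c" "?x \<in> U" "chart_map c ?x = u"
    using UI_inv[OF c u] by auto
  have rc: "?c \<in> restrict_atlas A U"
    using c by (force simp: restrict_atlas_def)
  obtain r where r: "r > 0" "ball u r \<subseteq> UI c"
    using open_UI[OF c] u by (auto simp: open_contains_ball)
  define e where "e = r / (norm v + 1)"
  have np: "norm v + 1 > 0"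
    by (simp add: add_nonneg_pos)
  have e: "e > 0"
    using r np by (simp add: e_def)
  have inb: "u + s *\<^sub>R v \<in> ball u r" if "\<bar>s\<bar> < e" for s
  proof -
    have "\<bar>s\<bar> * norm v \<le> \<bar>s\<bar> * (norm v + 1)"
      by (intro mult_left_mono) auto
    also have "\<dots> < r"
      using that np by (simp add: e_def field_simps)
    finally show ?thesis by (simp add: dist_norm)
  qed
  define L' where "L' = {y. (same_plaque (restrict_atlas A U) V)\<^sup>*\<^sup>* ?x y}"
  have "?x \<in> manifold_set (restrict_atlas A U)"
    unfolding manifold_set_def by (rule UN_I[OF rc]) (use x in simp)
  then have L': "L' \<in> leaves (restrict_atlas A U) V"
    unfolding leaves_def L'_def by blast
  have "u + s *\<^sub>R v \<in> UI c \<and> chart_inv c (u + s *\<^sub>R v) \<in> L'" if s: "\<bar>s\<bar> < e" for s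
  proof -
    let ?y = "chart_inv c (u + s *\<^sub>R v)"
    have us: "u + s *\<^sub>R v \<in> UI c"
      using inb[OF s] r(2) by auto
    have y: "?y \<in> chart_dom c" "?y \<in> U" "chart_map c ?y = u + s *\<^sub>R v"
      using UI_inv[OF c us] by auto
    have "closed_segment u (u + s *\<^sub>R v) \<subseteq> chart_map ?c ` chart_dom ?c \<inter> (+) (chart_map ?c ?x) ` V"
    proof
      fix w assume "w \<in> closed_segment u (u + s *\<^sub>R v)"
      then obtain a where a: "0 \<le> a" "a \<le> 1" "w = (1 - a) *\<^sub>R u + a *\<^sub>R (u + s *\<^sub>R v)"
        unfolding closed_segment_def by blast
      then have w: "w = u + (a * s) *\<^sub>R v"
        by (simp add: algebra_simps)
      have "\<bar>a * s\<bar> \<le> 1 * \<bar>s\<bar>"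
        unfolding abs_mult using a by (intro mult_right_mono) auto
      then have "\<bar>a * s\<bar> < e"
        using s by simp
      from inb[OF this] have "w \<in> UI c"
        using r(2) w by auto
      moreover have "w \<in> (+) u ` V"
        unfolding w using subspace_scale[OF subspace_V v] by blast
      ultimately show "w \<in> chart_map ?c ` chart_dom ?c \<inter> (+) (chart_map ?c ?x) ` V"
        using x(3) by (simp add: UI_def)
    qed
    then have "connected_component (chart_map ?c ` chart_dom ?c \<inter> (+) (chart_map ?c ?x) ` V) (chart_map ?c ?x) (chart_map ?c ?y)"
      unfolding connected_component_def using x(3) y(3)
      by (intro exI[of _ "closed_segment u (u + s *\<^sub>R v)"]) auto
    then have "same_plaque (restrict_atlas A U) V ?x ?y"
      unfolding same_plaque_def using rc x y by (intro bexI[OF _ rc]) auto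
    then show ?thesis
      using us unfolding L'_def by blast
  qed
  then show thesis
    using that[OF L' e] by blast
qed

text \<open>Apply \<open>curve_in_leaf\<close> to the image under \<open>H\<close> of the segment
  from \<open>z\<close> in direction \<open>w\<close>. The time component of \<open>w\<close> is
  arbitrary, since \<open>H\<close> keeps all times of a leaf of \<open>U\<close> in one leaf. In
  particular the pure time direction is mapped into \<open>V\<close>.\<close>

lemma DH_in_V:
  assumes cd: "c \<in> A" "d \<in> A" and z: "z \<in> HS c d" and v: "fst w \<in> V"
  shows "DH c d z w \<in> V"
proof (rule derivative_in_subspace[OF bounded_linear_proj proj_eq_0 Hcd_derivative[OF cd z]])
  obtain u t where ut: "z = (u, t)" by (cases z)
  obtain v \<tau> where w: "w = (v, \<tau>)" by (cases w)
  have u: "u \<in> UI c"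
    using z ut by (simp add: HS_def)
  obtain L' e where L': "L' \<in> leaves (restrict_atlas A U) V" "e > 0"
    "\<And>s. \<bar>s\<bar> < e \<Longrightarrow> u + s *\<^sub>R v \<in> UI c \<and> chart_inv c (u + s *\<^sub>R v) \<in> L'"
    using local_leaf[OF cd(1) u, of v] v w by auto
  obtain L where L: "L \<in> leaves A V" "H ` (L' \<times> UNIV) \<subseteq> L"
    using H_leaf[OF L'(1)] by blast
  let ?\<gamma> = "\<lambda>s. Hc c (z + s *\<^sub>R w)"
  have in_UI: "z + s *\<^sub>R w \<in> UI c \<times> UNIV" if "s \<in> ball 0 e" for s
    using L'(3)[of s] that by (simp add: ut w dist_norm)
  have "\<forall>\<^sub>F s in nhds 0. proj (chart_map d (?\<gamma> s)) = proj (chart_map d (?\<gamma> 0))"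
  proof (rule curve_in_leaf[OF L(1), of "ball 0 e"])
    show "continuous_on (ball 0 e) ?\<gamma>"
    proof (rule continuous_on_compose2[OF Hc_continuous[OF cd(1)]])
      show "continuous_on (ball 0 e) (\<lambda>s. z + s *\<^sub>R w)"
        by (intro continuous_intros)
      show "(\<lambda>s. z + s *\<^sub>R w) ` ball 0 e \<subseteq> UI c \<times> UNIV"
        using in_UI by blast
    qed
    show "?\<gamma> ` ball 0 e \<subseteq> L"
      using L(2) L'(3) by (auto simp: ut w Hc_def dist_norm image_subset_iff)
    show "?\<gamma> 0 \<in> chart_dom d"
      using z by (simp add: HS_def)
  qed (use L'(2) cd in auto)
  then show "\<forall>\<^sub>F s in nhds 0. proj (Hcd c d (z + s *\<^sub>R w)) = proj (Hcd c d z)"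
    by (simp add: Hcd_def)
qed

lemma DH_1:
  assumes cd: "c \<in> A" "d \<in> A" and z: "(u, 1) \<in> HS c d" and v: "v \<in> V"
  shows "DH c d (u, 1) (v, 0) = 0"
proof -
  have u: "u \<in> UI c"
    using z by (simp add: HS_def)
  obtain L' e where L': "L' \<in> leaves (restrict_atlas A U) V" "e > 0"
    "\<And>s. \<bar>s\<bar> < e \<Longrightarrow> u + s *\<^sub>R v \<in> UI c \<and> chart_inv c (u + s *\<^sub>R v) \<in> L'"
    using local_leaf[OF cd(1) u v] by metis
  obtain y where y: "\<And>x. x \<in> L' \<Longrightarrow> H (x, 1) = y"
    using H_1[OF L'(1)] by blast
  have "Hc c (u + s *\<^sub>R v, 1) = y" if "\<bar>s\<bar> < e" for s
    using L'(3)[OF that] y by (simp add: Hc_def)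
  from this this[of 0] have "Hcd c d ((u, 1) + s *\<^sub>R (v, 0)) = Hcd c d (u, 1)" if "s \<in> ball 0 e" for s
    using that L'(2) by (simp add: Hcd_def dist_norm)
  moreover have "\<forall>\<^sub>F s in nhds 0. s \<in> ball 0 e"
    using L'(2) by (intro eventually_nhds_in_open) auto
  ultimately have "\<forall>\<^sub>F s in nhds 0. Hcd c d ((u, 1) + s *\<^sub>R (v, 0)) = Hcd c d (u, 1)"
    by (rule eventually_mono[rotated])
  \<comment> \<open>Here the subspace is zero, with the identity as the map having it as
    kernel.\<close>
  then have "DH c d (u, 1) (v, 0) \<in> {0}"
    by (intro derivative_in_subspace[OF bounded_linear_ident _ Hcd_derivative[OF cd z]]) simp_all
  then show ?thesis by simp
qed

lemma DH_0:
  assumes c: "c \<in> A" and u: "u \<in> UI c"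
  shows "(u, 0) \<in> HS c c" "DH c c (u, 0) (v, 0) = v"
proof -
  have 1: "Hc c (w, 0) = chart_inv c w" if "w \<in> UI c" for w
    using UI_inv[OF c that] by (simp add: Hc_def H_0)
  show z: "(u, 0) \<in> HS c c"
    using u 1[OF u] UI_inv[OF c u] by (simp add: HS_def)
  have "((\<lambda>u. (u, 0)) has_derivative (\<lambda>v. (v, 0))) (at u)"
    by (auto intro!: derivative_eq_intros)
  from has_derivative_compose[OF this Hcd_derivative[OF c c z]]
  have "((\<lambda>u. u) has_derivative (\<lambda>v. DH c c (u, 0) (v, 0))) (at u)"
    by (rule has_derivative_transform_open[OF _ open_UI[OF c] u]) (use 1 UI_inv[OF c] in \<open>simp add: Hcd_def\<close>)
  from fun_cong[OF has_derivative_unique[OF this has_derivative_ident], of v]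
  show "DH c c (u, 0) (v, 0) = v" .
qed

text \<open>The pullback of \<open>\<omega>\<close> by \<open>H\<close>, read in the chart
  \<open>c\<close> of the source. No single chart of the target need contain the image, so one is
  chosen for each \<open>z\<close>; the choice is irrelevant by \<open>Hform_eq\<close>.\<close>

definition Hform :: "('m, 'e) form \<Rightarrow> ('m, 'e) chart \<Rightarrow> 'e \<times> real \<Rightarrow> (nat \<Rightarrow> 'e \<times> real) \<Rightarrow> real"
  where "Hform \<omega> c z = pullback (Hcd c (SOME d. d \<in> A \<and> z \<in> HS c d)) (lrep \<omega> (SOME d. d \<in> A \<and> z \<in> HS c d)) z"

lemma pullback_Hcd:
  assumes "d \<in> A" "z \<in> HS c d"
  shows "pullback (Hcd c d) (lrep \<omega> d) z w = \<omega> d (Hc c z) (\<lambda>i. DH c d z (w i))"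
  using assms by (simp add: pullback_def lrep_def Hcd_def HS_def DH_def)

lemma Hform_eq:
  assumes \<omega>: "\<omega> \<in> forms A r" and c: "c \<in> A" and d: "d \<in> A" "z \<in> HS c d"
  shows "Hform \<omega> c z w = pullback (Hcd c d) (lrep \<omega> d) z w"
proof -
  define e where "e = (SOME d. d \<in> A \<and> z \<in> HS c d)"
  have e: "e \<in> A" "z \<in> HS c e"
    unfolding e_def using someI[of "\<lambda>d. d \<in> A \<and> z \<in> HS c d" d] d by blast+
  have "\<omega> e (Hc c z) (\<lambda>i. DH c e z (w i)) = \<omega> d (Hc c z) (\<lambda>i. D_transition e d (Hc c z) (DH c e z (w i)))"
    by (rule forms_transform[OF \<omega> e(1) d(1), symmetric]) (use e d in \<open>auto simp: HS_def\<close>)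
  then show ?thesis
    unfolding Hform_def e_def[symmetric] pullback_Hcd[OF e] pullback_Hcd[OF d]
    by (simp add: DH_change_target[OF c e(1) d(1) e(2) d(2)])
qed

lemma Hform_at:
  assumes "\<omega> \<in> forms A r" "c \<in> A" "d \<in> A" "z \<in> HS c d"
  shows "Hform \<omega> c z w = \<omega> d (Hc c z) (\<lambda>i. DH c d z (w i))"
  using Hform_eq[OF assms] pullback_Hcd[OF assms(3,4)] by simp

lemma Hcd_image: "d \<in> A \<Longrightarrow> Hcd c d ` HS c d \<subseteq> chart_map d ` chart_dom d"
  by (auto simp: Hcd_def HS_def)

lemma lform_Hform:
  assumes \<omega>: "\<omega> \<in> forms A r" and c: "c \<in> A"
  shows "lform r (UI c \<times> UNIV) (Hform \<omega> c)"
proof (rule lform_local)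
  show "open (UI c \<times> (UNIV :: real set))"
    by (intro open_Times open_UI c open_UNIV)
  fix z assume "z \<in> UI c \<times> (UNIV :: real set)"
  then obtain d where d: "d \<in> A" "z \<in> HS c d"
    using HS_cover[OF c] by blast
  have "lform r (HS c d) (Hform \<omega> c)"
    by (rule lform_cong[OF open_HS[OF c d(1)] Hform_eq[OF \<omega> c d(1)], THEN iffD2], assumption,
      rule lform_pullback[OF forms_lform[OF \<omega> d(1)] open_HS[OF c d(1)] Hcd_image[OF d(1)] smooth_Hcd[OF c d(1)]])
  then show "\<exists>T. z \<in> T \<and> lform r T (Hform \<omega> c)"
    using d(2) by blast
qed

lemma dloc_Hform:
  assumes \<omega>: "\<omega> \<in> forms A r" and c: "c \<in> A" and z: "z \<in> UI c \<times> UNIV"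
  shows "dloc r (Hform \<omega> c) z w = Hform (ext_d A r \<omega>) c z w"
proof -
  obtain d where d: "d \<in> A" "z \<in> HS c d"
    using HS_cover[OF c z] by blast
  have "dloc r (Hform \<omega> c) z w = dloc r (pullback (Hcd c d) (lrep \<omega> d)) z w"
    by (rule dloc_cong[OF open_HS[OF c d(1)] d(2) Hform_eq[OF \<omega> c d(1)]])
  also have "\<dots> = pullback (Hcd c d) (dloc r (lrep \<omega> d)) z w"
    by (rule dloc_pullback[OF forms_lform[OF \<omega> d(1)] open_HS[OF c d(1)] Hcd_image[OF d(1)] smooth_Hcd[OF c d(1)] d(2)])
  also have "\<dots> = pullback (Hcd c d) (lrep (ext_d A r \<omega>) d) z w"
    unfolding pullback_def by (rule lrep_ext_d[OF d(1), symmetric]) (use Hcd_image[OF d(1)] d(2) in blast)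
  also have "\<dots> = Hform (ext_d A r \<omega>) c z w"
    by (rule Hform_eq[OF ext_d_forms[OF \<omega>] c d, symmetric])
  finally show ?thesis .
qed

definition KH :: "('m, 'e) form \<Rightarrow> ('m, 'e) chart \<Rightarrow> 'e \<Rightarrow> (nat \<Rightarrow> 'e) \<Rightarrow> real"
  where "KH \<omega> c = fibre_integral (Hform \<omega> c)"

lemma lform_KH: "\<omega> \<in> forms A (Suc r) \<Longrightarrow> c \<in> A \<Longrightarrow> lform r (UI c) (KH \<omega> c)"
  unfolding KH_def by (intro lform_fibre_integral open_UI lform_Hform)

text \<open>The time direction is the same in all charts of the source, so the fibre integrals fit
  together to a form on \<open>U\<close>.\<close>

lemma KH_transform:
  assumes \<omega>: "\<omega> \<in> forms A r" and cd: "c \<in> A" "d \<in> A" and x: "x \<in> chart_dom c" "x \<in> chart_dom d" "x \<in> U"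
  shows "KH \<omega> d (chart_map d x) (\<lambda>i. D_transition c d x (v i)) = KH \<omega> c (chart_map c x) v"
proof -
  have "Hform \<omega> d (chart_map d x, t) (emb0 (\<lambda>i. D_transition c d x (v i))) = Hform \<omega> c (chart_map c x, t) (emb0 v)" for t
  proof -
    let ?z = "(chart_map c x, t)"
    have "?z \<in> UI c \<times> UNIV"
      using x by (auto simp: UI_def)
    then obtain e where e: "e \<in> A" "?z \<in> HS c e"
      using HS_cover[OF cd(1)] by blast
    note ch = DH_change_source[OF cd e(1) x(1,2) e(2)]
    have "emb0 (\<lambda>i. D_transition c d x (v i)) i = (D_transition c d x (fst (emb0 v i)), snd (emb0 v i))" for i
      using linear_0[OF D_transition_linear[OF cd x(1,2)]] by (auto simp: emb0_def emb_def split: nat.split)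
    moreover have "Hc d (chart_map d x, t) = Hc c ?z"
      using x cd by (simp add: Hc_def)
    ultimately show ?thesis
      unfolding Hform_at[OF \<omega> cd(1) e] Hform_at[OF \<omega> cd(2) e(1) ch(1)] by (simp add: ch(2))
  qed
  then show ?thesis
    by (simp add: KH_def fibre_integral_def)
qed

text \<open>The homotopy formula for the pullback by \<open>H\<close>, combined with its
  compatibility with d. At time 0 the map is the inclusion, which returns \<open>\<omega>\<close>
  itself.\<close>

lemma KH_formula:
  assumes \<omega>: "\<omega> \<in> forms A (Suc r)" and c: "c \<in> A" and u: "u \<in> UI c"
  shows "dloc r (KH \<omega> c) u v + KH (ext_d A (Suc r) \<omega>) c u v = Hform \<omega> c (u, 1) (emb v) - \<omega> c (chart_inv c u) v"
proof -
  have "fibre_integral (dloc (Suc r) (Hform \<omega> c)) u v = KH (ext_d A (Suc r) \<omega>) c u v"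
    unfolding KH_def fibre_integral_def using dloc_Hform[OF \<omega> c] u by simp
  moreover have "Hform \<omega> c (u, 0) (emb v) = \<omega> c (chart_inv c u) v"
    using Hform_at[OF \<omega> c c DH_0(1)[OF c u]] UI_inv[OF c u] H_0
    by (simp add: emb_def DH_0(2)[OF c u] Hc_def)
  ultimately show ?thesis
    using homotopy_formula[OF open_UI[OF c] lform_Hform[OF \<omega> c] u, of v] by (simp add: KH_def)
qed

text \<open>The extra argument, the time direction, becomes leafwise under \<open>H\<close>. This
  makes up for the degree lost by integrating, so K keeps the filtration index.\<close>

lemma vdeg_DH_emb0:
  assumes cd: "c \<in> A" "d \<in> A" "z \<in> HS c d"
  shows "Suc (vdeg r v) \<le> vdeg (Suc r) (\<lambda>i. DH c d z (emb0 v i))"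
proof -
  have "insert 0 (Suc ` {i. i < r \<and> v i \<in> V}) \<subseteq> {i. i < Suc r \<and> DH c d z (emb0 v i) \<in> V}"
    using subspace_0[OF subspace_V] by (auto intro!: DH_in_V[OF cd] simp: emb0_def emb_def)
  from card_mono[OF _ this] have "card (insert 0 (Suc ` {i. i < r \<and> v i \<in> V})) \<le> vdeg (Suc r) (\<lambda>i. DH c d z (emb0 v i))"
    by (simp add: vdeg_def)
  moreover have "card (insert 0 (Suc ` {i. i < r \<and> v i \<in> V})) = Suc (vdeg r v)"
    by (subst card_insert_disjoint) (auto simp: vdeg_def card_image)
  ultimately show ?thesis by simp
qed

lemma fvan_KH:
  assumes \<omega>: "\<omega> \<in> filt A V p (Suc r)" and c: "c \<in> A" and u: "u \<in> UI c"
  shows "fvan p r (KH \<omega> c u)"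
  unfolding fvan_def
proof (intro allI impI)
  fix v assume v: "r < p + vdeg r v"
  have "Hform \<omega> c (u, t) (emb0 v) = 0" for t
  proof -
    have "(u, t) \<in> UI c \<times> UNIV"
      using u by simp
    then obtain d where d: "d \<in> A" "(u, t) \<in> HS c d"
      using HS_cover[OF c] by blast
    have "Suc r < p + vdeg (Suc r) (\<lambda>i. DH c d (u, t) (emb0 v i))"
      using v vdeg_DH_emb0[OF c d, of r v] by linarith
    then show ?thesis
      using fvan_if_filt[OF \<omega> d(1), of "Hc c (u, t)"] d(2) unfolding Hform_at[OF filt_forms[OF \<omega>] c d] fvan_def
      by (auto simp: HS_def)
  qed
  then show "KH \<omega> c u v = 0"
    by (simp add: KH_def fibre_integral_def)
qed

text \<open>As \<open>p \<le> r\<close>, more than \<open>r - p\<close> leafwise arguments means at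
  least one, and \<open>H\<close> at time 1 sends it to 0. In the application the index is
  \<open>Suc p\<close> and the degree p + q, so the inequality says that q is positive.\<close>

lemma fvan_Hform_1:
  assumes \<omega>: "\<omega> \<in> forms A r" and c: "c \<in> A" and u: "u \<in> UI c" and p: "p \<le> r"
  shows "fvan p r (\<lambda>v. Hform \<omega> c (u, 1) (emb v))"
  unfolding fvan_def
proof (intro allI impI)
  fix v assume "r < p + vdeg r v"
  then have "card {i. i < r \<and> v i \<in> V} \<noteq> 0"
    using p unfolding vdeg_def by linarith
  then have "{i. i < r \<and> v i \<in> V} \<noteq> {}"
    by (metis card.empty)
  then obtain i where i: "i < r" "v i \<in> V"
    by blast
  obtain d where d: "d \<in> A" "(u, 1) \<in> HS c d"
    using HS_cover[OF c, of "(u, 1)"] u by blast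
  let ?w = "\<lambda>i. DH c d (u, 1) (emb v i)"
  have alt: "alternating r (\<omega> d (Hc c (u, 1)))"
    by (rule forms_alternating[OF \<omega> d(1)]) (use d in \<open>simp add: HS_def\<close>)
  have "?w i = 0"
    using DH_1[OF c d i(2)] by (simp add: emb_def)
  then have "?w(i := 0) = ?w"
    by auto
  then have "\<omega> d (Hc c (u, 1)) ?w = 0"
    using linear_0[OF alternating_linear[OF alt i(1), of ?w]] by simp
  then show "Hform \<omega> c (u, 1) (emb v) = 0"
    by (simp add: Hform_at[OF \<omega> c d])
qed

text \<open>K \<open>\<omega>\<close> exists over \<open>U\<close> only. Multiplied by
  \<open>\<phi>\<close> it extends by zero, because \<open>\<phi>\<close> vanishes near every point
  outside \<open>U\<close>. That \<open>\<phi> = 1\<close> on a neighbourhood, and not just at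
  \<open>x\<close>, is what removes the derivative of \<open>\<phi>\<close> from d
  \<open>\<eta>\<close>.\<close>

lemma filt_trivial_on_U:
  assumes \<omega>: "\<omega> \<in> filt A V p (Suc r)" "ext_d A (Suc r) \<omega> \<in> filt A V (Suc p) (Suc (Suc r))" and p: "p \<le> r"
    and \<phi>: "sm UNIV \<phi>" "\<And>x. x \<in> manifold_set A \<Longrightarrow> x \<notin> U \<Longrightarrow> \<exists>N. open N \<and> x \<in> N \<and> (\<forall>y\<in>N. \<phi> y = 0)"
  obtains \<eta> where "\<eta> \<in> filt A V p r"
    "\<And>N c x. open N \<Longrightarrow> x \<in> N \<Longrightarrow> x \<in> U \<Longrightarrow> (\<And>y. y \<in> N \<Longrightarrow> \<phi> y = 1) \<Longrightarrow> c \<in> A \<Longrightarrow> x \<in> chart_dom c \<Longrightarrow>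
       fvan (Suc p) (Suc r) (\<lambda>v. \<omega> c x v + ext_d A r \<eta> c x v)"
proof -
  note form = filt_forms[OF \<omega>(1)]
  define \<eta> where "\<eta> c x v = (if c \<in> A \<and> x \<in> chart_dom c \<and> x \<in> U then \<phi> x * KH \<omega> c (chart_map c x) v else 0)" for c x v
  have lr: "lrep \<eta> c u v = \<phi> (chart_inv c u) * KH \<omega> c u v" if "c \<in> A" "u \<in> UI c" for c u v
    using UI_inv[OF that] that(1) by (simp add: lrep_def \<eta>_def)
  have form_\<eta>: "\<eta> \<in> forms A r"
  proof (rule formsI)
    show "\<eta> c x v = 0" if "\<not> (c \<in> A \<and> x \<in> chart_dom c)" for c x v
      using that by (auto simp: \<eta>_def)
    show "\<eta> d x (\<lambda>i. D_transition c d x (v i)) = \<eta> c x v"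
      if "c \<in> A" "d \<in> A" "x \<in> chart_dom c" "x \<in> chart_dom d" for c d x v
      using KH_transform[OF form that, of v] that by (simp add: \<eta>_def)
    show "lform r (chart_map c ` chart_dom c) (lrep \<eta> c)" if c: "c \<in> A" for c
    proof (rule lform_local[OF open_im[OF c]])
      fix u assume "u \<in> chart_map c ` chart_dom c"
      then obtain x where x: "x \<in> chart_dom c" "u = chart_map c x"
        by blast
      show "\<exists>T. u \<in> T \<and> lform r T (lrep \<eta> c)"
      proof (cases "x \<in> U")
        case True
        have "smooth_on (UI c) (\<lambda>u. \<phi> (chart_inv c u))"
          using sm_subset[OF \<phi>(1) subset_UNIV] c unfolding sm_def UI_def by blast
        then have "lform r (UI c) (\<lambda>u v. \<phi> (chart_inv c u) * KH \<omega> c u v)"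
          using lform_KH[OF form c] unfolding lform_def
          by (intro conjI ballI allI alternating_scale smooth_on_mult) auto
        moreover have "lform r (UI c) (lrep \<eta> c) \<longleftrightarrow> lform r (UI c) (\<lambda>u v. \<phi> (chart_inv c u) * KH \<omega> c u v)"
          by (rule lform_cong[OF open_UI[OF c] lr[OF c]])
        ultimately have "lform r (UI c) (lrep \<eta> c)"
          by blast
        moreover have "u \<in> UI c"
          using x True by (auto simp: UI_def)
        ultimately show ?thesis by blast
      next
        case False
        have "x \<in> manifold_set A"
          using c x(1) unfolding manifold_set_def by blast
        then obtain N where N: "open N" "x \<in> N" "\<And>y. y \<in> N \<Longrightarrow> \<phi> y = 0"
          using \<phi>(2)[OF _ False] by metis
        let ?T = "chart_map c ` (chart_dom c \<inter> N)"
        have T: "open ?T"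
          by (rule open_chart_image[OF c N(1)])
        have "lform r ?T (\<lambda>u v. 0)"
          using T by (auto simp: lform_def alternating_0 smooth_on_const)
        then have "lform r ?T (lrep \<eta> c)"
          by (rule lform_cong[OF T, THEN iffD2, rotated]) (use N(3) c in \<open>auto simp: lrep_def \<eta>_def\<close>)
        moreover have "u \<in> ?T"
          using x N(2) by auto
        ultimately show ?thesis
          by (intro exI conjI)
      qed
    qed
  qed
  have "\<eta> \<in> filt A V p r"
  proof (rule filtI[OF form_\<eta>])
    fix c x assume c: "c \<in> A" "x \<in> chart_dom c"
    show "fvan p r (\<eta> c x)"
    proof (cases "x \<in> U")
      case True
      then have "chart_map c x \<in> UI c"
        using c by (auto simp: UI_def)
      from fvan_scale[OF fvan_KH[OF \<omega>(1) c(1) this], of "\<phi> x"] show ?thesis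
        using c True by (simp add: \<eta>_def[abs_def])
    next
      case False
      then have "\<eta> c x = (\<lambda>v. 0)"
        by (auto simp: \<eta>_def fun_eq_iff)
      then show ?thesis
        by (simp add: fvan_0)
    qed
  qed
  moreover have "fvan (Suc p) (Suc r) (\<lambda>v. \<omega> c x v + ext_d A r \<eta> c x v)"
    if N: "open N" "x \<in> N" "\<And>y. y \<in> N \<Longrightarrow> \<phi> y = 1" and x: "x \<in> U" and c: "c \<in> A" "x \<in> chart_dom c" for N c x
  proof -
    let ?T = "chart_map c ` (chart_dom c \<inter> (U \<inter> N))" and ?u = "chart_map c x"
    have T: "open ?T" "?u \<in> ?T"
      using N x c open_U by (auto intro!: open_chart_image)
    have u: "?u \<in> UI c"
      using c x by (auto simp: UI_def)
    have eq: "lrep \<eta> c w v = KH \<omega> c w v" if w: "w \<in> ?T" for w v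
    proof -
      have "w \<in> UI c" "chart_inv c w \<in> N"
        using w c(1) by (auto simp: UI_def)
      then show ?thesis
        using lr[OF c(1)] N(3) by simp
    qed
    have "ext_d A r \<eta> c x v = dloc r (KH \<omega> c) ?u v" for v
      unfolding ext_d_at[OF c] by (rule dloc_cong[OF T eq])
    then have "\<omega> c x v + ext_d A r \<eta> c x v
      = Hform \<omega> c (?u, 1) (emb v) + (- 1) * KH (ext_d A (Suc r) \<omega>) c ?u v" for v
      using KH_formula[OF form c(1) u, of v] c by simp
    \<comment> \<open>The first summand gains a step since \<open>H\<close> is constant on leaves at
      time 1, the second since d \<open>\<omega>\<close> is already in the next step and K preserves
      it.\<close>
    moreover have "fvan (Suc p) (Suc r) (\<lambda>v. Hform \<omega> c (?u, 1) (emb v) + (- 1) * KH (ext_d A (Suc r) \<omega>) c ?u v)"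
      by (intro fvan_add fvan_scale fvan_Hform_1[OF form c(1) u] fvan_KH[OF \<omega>(2) c(1) u]) (use p in simp)
    ultimately show ?thesis by simp
  qed
  ultimately show thesis
    by (rule that)
qed

end

section \<open>The first term of the spectral sequence\<close>

lemma (in comm_group) coset_sum:
  assumes "subgroup N G" "x \<in> carrier G" "y \<in> carrier G"
  shows "(N #> x) <#> (N #> y) = N #> (x \<otimes> y)"
  using normal.rcos_sum[of N G x y] assms normal_iff_subgroup by simp

lemma (in group) coset_absorb:
  assumes "subgroup N G" "n \<in> N" "x \<in> carrier G"
  shows "N #> (n \<otimes> x) = N #> x"
proof -
  have "n \<otimes> x \<in> N #> x"
    using assms(2) by (auto simp: r_coset_def)
  from repr_independence[OF this assms(3,1)] show ?thesis by simp
qed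

lemma (in comm_group) subgroup_comm_group:
  assumes "subgroup N G"
  shows "comm_group (G\<lparr>carrier := N\<rparr>)"
proof (rule group.group_comm_groupI)
  show "Group.group (G\<lparr>carrier := N\<rparr>)"
    by (rule subgroup_imp_group[OF assms])
  show "x \<otimes>\<^bsub>G\<lparr>carrier := N\<rparr>\<^esub> y = y \<otimes>\<^bsub>G\<lparr>carrier := N\<rparr>\<^esub> x"
    if "x \<in> carrier (G\<lparr>carrier := N\<rparr>)" "y \<in> carrier (G\<lparr>carrier := N\<rparr>)" for x y
    using that subgroup.mem_carrier[OF assms] by (simp add: m_comm)
qed

lemma r_coset_carrier_update: "r_coset (G\<lparr>carrier := K\<rparr>) N x = r_coset G N x"
  by (simp add: r_coset_def)

text \<open>The induced maps of the spectral sequence are unions over representatives. With this,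
  their well-definedness and their value on a class are shown together.\<close>

lemma UNION_const: "X \<noteq> {} \<Longrightarrow> (\<And>x. x \<in> X \<Longrightarrow> f x = y) \<Longrightarrow> (\<Union>x\<in>X. f x) = y"
  by auto

context foliation begin

abbreviation fadd :: "('m, 'e) form \<Rightarrow> ('m, 'e) form \<Rightarrow> ('m, 'e) form" (infixl "\<oplus>\<^sub>f" 65)
  where "\<alpha> \<oplus>\<^sub>f \<beta> \<equiv> (\<lambda>c x v. \<alpha> c x v + \<beta> c x v)"

abbreviation fscale :: "real \<Rightarrow> ('m, 'e) form \<Rightarrow> ('m, 'e) form"
  where "fscale k \<alpha> \<equiv> (\<lambda>c x v. k * \<alpha> c x v)"

abbreviation fzero :: "('m, 'e) form"
  where "fzero \<equiv> (\<lambda>c x v. 0)"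

lemma filt_group_simps [simp]:
  "carrier (filt_group A V p r) = filt A V p r"
  "\<alpha> \<otimes>\<^bsub>filt_group A V p r\<^esub> \<beta> = \<alpha> \<oplus>\<^sub>f \<beta>"
  "\<one>\<^bsub>filt_group A V p r\<^esub> = fzero"
  by (simp_all add: filt_group_def)

lemma filt_minus: "\<alpha> \<in> filt A V p r \<Longrightarrow> fscale (-1) \<alpha> \<in> filt A V p r"
  by (rule filt_scale)

lemma filt_group_comm: "comm_group (filt_group A V p r)"
proof (rule comm_groupI)
  show "\<exists>y\<in>carrier (filt_group A V p r). y \<otimes>\<^bsub>filt_group A V p r\<^esub> x = \<one>\<^bsub>filt_group A V p r\<^esub>"
    if "x \<in> carrier (filt_group A V p r)" for x
    using filt_minus that by (intro bexI[of _ "fscale (-1) x"]) (simp_all add: fun_eq_iff)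
qed (simp_all add: filt_add filt_0 fun_eq_iff algebra_simps)

lemma filt_subgroup: "subgroup (filt A V (p + 1) r) (filt_group A V p r)"
proof (rule group.subgroupI[OF comm_group.axioms(2)[OF filt_group_comm]])
  show "filt A V (p + 1) r \<subseteq> carrier (filt_group A V p r)"
    using filt_Suc by auto
  show "filt A V (p + 1) r \<noteq> {}"
    using filt_0 by blast
  show "inv\<^bsub>filt_group A V p r\<^esub> a \<in> filt A V (p + 1) r" if a: "a \<in> filt A V (p + 1) r" for a
  proof -
    have "inv\<^bsub>filt_group A V p r\<^esub> a = fscale (-1) a"
      using a filt_minus filt_Suc by (intro group.inv_equality[OF comm_group.axioms(2)[OF filt_group_comm]]) (auto simp: fun_eq_iff)
    then show ?thesis
      using filt_minus[OF a] by simp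
  qed
qed (simp add: filt_add)

definition e0 :: "nat \<Rightarrow> nat \<Rightarrow> ('m, 'e) form \<Rightarrow> ('m, 'e) form set"
  where "e0 p q \<omega> = filt A V (p + 1) (p + q) #>\<^bsub>filt_group A V p (p + q)\<^esub> \<omega>"

lemma E0_comm: "comm_group (E0 A V p q)"
  unfolding E0_def by (rule comm_group.abelian_FactGroup[OF filt_group_comm filt_subgroup])

lemmas E0_group = comm_group.axioms(2)[OF E0_comm]

lemma E0_carrier: "carrier (E0 A V p q) = e0 p q ` filt A V p (p + q)"
  by (simp add: E0_def carrier_FactGroup e0_def[abs_def])

lemma e0_in: "\<omega> \<in> filt A V p (p + q) \<Longrightarrow> e0 p q \<omega> \<in> carrier (E0 A V p q)"
  by (simp add: E0_carrier)

lemma e0_add: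
  assumes "\<alpha> \<in> filt A V p (p + q)" "\<beta> \<in> filt A V p (p + q)"
  shows "e0 p q \<alpha> \<otimes>\<^bsub>E0 A V p q\<^esub> e0 p q \<beta> = e0 p q (\<alpha> \<oplus>\<^sub>f \<beta>)"
  using comm_group.coset_sum[OF filt_group_comm filt_subgroup, of \<alpha> p "p + q" \<beta>] assms
  by (simp add: E0_def e0_def)

lemma e0_absorb: "\<epsilon> \<in> filt A V (p + 1) (p + q) \<Longrightarrow> \<omega> \<in> filt A V p (p + q) \<Longrightarrow> e0 p q (\<epsilon> \<oplus>\<^sub>f \<omega>) = e0 p q \<omega>"
  using group.coset_absorb[OF comm_group.axioms(2)[OF filt_group_comm] filt_subgroup, of \<epsilon> p "p + q" \<omega>]
  by (simp add: e0_def)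

lemma e0_elem: "\<alpha> \<in> e0 p q \<omega> \<longleftrightarrow> (\<exists>\<epsilon>\<in>filt A V (p + 1) (p + q). \<alpha> = \<epsilon> \<oplus>\<^sub>f \<omega>)"
  by (auto simp: e0_def r_coset_def)

lemma e0_nonempty: "e0 p q \<omega> \<noteq> {}"
  using e0_elem filt_0 by blast

lemma E0_one: "\<one>\<^bsub>E0 A V p q\<^esub> = filt A V (p + 1) (p + q)"
  by (simp add: E0_def)

lemma e0_one_iff: "\<omega> \<in> filt A V p (p + q) \<Longrightarrow> e0 p q \<omega> = \<one>\<^bsub>E0 A V p q\<^esub> \<longleftrightarrow> \<omega> \<in> filt A V (p + 1) (p + q)"
  unfolding E0_one e0_def
  using group.coset_join1[OF comm_group.axioms(2)[OF filt_group_comm] _ _ filt_subgroup]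
    group.coset_join2[OF comm_group.axioms(2)[OF filt_group_comm] _ filt_subgroup] by auto

lemma e0_zero: "e0 p q fzero = \<one>\<^bsub>E0 A V p q\<^esub>"
  using e0_one_iff[OF filt_0] filt_0 by simp

lemma ext_d_filt': "\<omega> \<in> filt A V p (p + q) \<Longrightarrow> ext_d A (p + q) \<omega> \<in> filt A V p (p + (q + 1))"
  using ext_d_filt by simp

lemma ext_d_sum: "\<alpha> \<in> filt A V p r \<Longrightarrow> \<beta> \<in> filt A V p' r \<Longrightarrow> ext_d A r (\<alpha> \<oplus>\<^sub>f \<beta>) = ext_d A r \<alpha> \<oplus>\<^sub>f ext_d A r \<beta>"
  by (intro ext_d_add filt_forms)

lemma d0_e0:
  assumes \<omega>: "\<omega> \<in> filt A V p (p + q)"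
  shows "d0 A V p q (e0 p q \<omega>) = e0 p (q + 1) (ext_d A (p + q) \<omega>)"
  unfolding d0_def
proof (rule UNION_const[OF e0_nonempty])
  fix \<alpha> assume "\<alpha> \<in> e0 p q \<omega>"
  then obtain \<epsilon> where \<epsilon>: "\<epsilon> \<in> filt A V (p + 1) (p + q)" "\<alpha> = \<epsilon> \<oplus>\<^sub>f \<omega>"
    unfolding e0_elem by blast
  have "ext_d A (p + q) \<alpha> = ext_d A (p + q) \<epsilon> \<oplus>\<^sub>f ext_d A (p + q) \<omega>"
    unfolding \<epsilon>(2) by (rule ext_d_sum[OF \<epsilon>(1) \<omega>])
  moreover have "ext_d A (p + q) \<epsilon> \<in> filt A V (p + 1) (p + (q + 1))"
    using ext_d_filt[OF \<epsilon>(1)] by simp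
  ultimately show "filt A V (p + 1) (p + q + 1) #>\<^bsub>filt_group A V p (p + q + 1)\<^esub> ext_d A (p + q) \<alpha>
    = e0 p (q + 1) (ext_d A (p + q) \<omega>)"
    using e0_absorb[of _ p "q + 1", OF _ ext_d_filt'[OF \<omega>]] by (simp add: e0_def)
qed

lemma d0_hom: "group_hom (E0 A V p q) (E0 A V p (q + 1)) (d0 A V p q)"
proof (intro group_hom.intro E0_group group_hom_axioms.intro homI)
  show "d0 A V p q x \<in> carrier (E0 A V p (q + 1))" if "x \<in> carrier (E0 A V p q)" for x
    using that d0_e0 e0_in[OF ext_d_filt'] by (auto simp: E0_carrier)
  fix x y assume "x \<in> carrier (E0 A V p q)" "y \<in> carrier (E0 A V p q)"
  then obtain \<alpha> \<beta> where \<alpha>: "\<alpha> \<in> filt A V p (p + q)" "x = e0 p q \<alpha>" and \<beta>: "\<beta> \<in> filt A V p (p + q)" "y = e0 p q \<beta>"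
    unfolding E0_carrier by blast
  show "d0 A V p q (x \<otimes>\<^bsub>E0 A V p q\<^esub> y) = d0 A V p q x \<otimes>\<^bsub>E0 A V p (q + 1)\<^esub> d0 A V p q y"
    unfolding \<alpha>(2) \<beta>(2) e0_add[OF \<alpha>(1) \<beta>(1)] d0_e0[OF \<alpha>(1)] d0_e0[OF \<beta>(1)] d0_e0[OF filt_add[OF \<alpha>(1) \<beta>(1)]]
    by (simp only: e0_add[OF ext_d_filt'[OF \<alpha>(1)] ext_d_filt'[OF \<beta>(1)]] ext_d_sum[OF \<alpha>(1) \<beta>(1)])
qed

text \<open>Forms that represent cycles of \<open>d0\<close>: their derivative drops into the next
  step. \<open>B1\<close> below correspondingly contains representatives of boundaries, which are
  meant modulo the next step.\<close>

definition Z1 :: "nat \<Rightarrow> nat \<Rightarrow> ('m, 'e) form set"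
  where "Z1 p q = {\<omega> \<in> filt A V p (p + q). ext_d A (p + q) \<omega> \<in> filt A V (p + 1) (p + (q + 1))}"

definition B1 :: "nat \<Rightarrow> nat \<Rightarrow> ('m, 'e) form set"
  where "B1 p q = (if q = 0 then {fzero} else ext_d A (p + (q - 1)) ` filt A V p (p + (q - 1)))"

abbreviation K0 :: "nat \<Rightarrow> nat \<Rightarrow> ('m, 'e) form set monoid"
  where "K0 p q \<equiv> (E0 A V p q)\<lparr>carrier := kernel (E0 A V p q) (E0 A V p (q + 1)) (d0 A V p q)\<rparr>"

lemma kernel_eq: "kernel (E0 A V p q) (E0 A V p (q + 1)) (d0 A V p q) = e0 p q ` Z1 p q"
proof -
  have "d0 A V p q (e0 p q \<omega>) = \<one>\<^bsub>E0 A V p (q + 1)\<^esub> \<longleftrightarrow> ext_d A (p + q) \<omega> \<in> filt A V (p + 1) (p + (q + 1))"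
    if "\<omega> \<in> filt A V p (p + q)" for \<omega>
    unfolding d0_e0[OF that] by (rule e0_one_iff[OF ext_d_filt'[OF that]])
  then show ?thesis
    unfolding kernel_def E0_carrier Z1_def by blast
qed

lemmas kernel_eq_Suc = kernel_eq[unfolded Suc_eq_plus1[symmetric]]

lemma kernel_subgroup: "subgroup (kernel (E0 A V p q) (E0 A V p (q + 1)) (d0 A V p q)) (E0 A V p q)"
  by (rule group_hom.subgroup_kernel[OF d0_hom])

lemma boundaries_eq: "boundaries0 A V p q = e0 p q ` B1 p q"
proof (cases q)
  case 0
  then show ?thesis by (simp add: boundaries0_def B1_def e0_zero)
next
  case (Suc q')
  then show ?thesis
    using d0_e0[of _ p q'] by (auto simp: boundaries0_def B1_def E0_carrier image_iff)
qed

lemma filt_ext_d_zero: "\<omega> \<in> forms A r \<Longrightarrow> ext_d A (Suc r) (ext_d A r \<omega>) \<in> filt A V p k"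
  using ext_d_ext_d filt_0 by simp

lemma ext_d_zero: "ext_d A r fzero = fzero"
  using ext_d_scale[OF forms_0[of r], of 0] by simp

lemma B1_subset_Z1: "B1 p q \<subseteq> Z1 p q"
proof (cases q)
  case 0
  then show ?thesis by (simp add: B1_def Z1_def ext_d_zero filt_0)
next
  case (Suc q')
  then show ?thesis
    using ext_d_filt filt_ext_d_zero[OF filt_forms] by (auto simp: B1_def Z1_def)
qed

lemma boundaries_subgroup: "subgroup (boundaries0 A V p q) (K0 p q)"
proof (rule group.subgroup_incl[OF E0_group _ kernel_subgroup])
  show "boundaries0 A V p q \<subseteq> kernel (E0 A V p q) (E0 A V p (q + 1)) (d0 A V p q)"
    unfolding boundaries_eq kernel_eq using B1_subset_Z1 by blast
  show "subgroup (boundaries0 A V p q) (E0 A V p q)"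
  proof (cases q)
    case 0
    then show ?thesis
      using group.triv_subgroup[OF E0_group] by (simp add: boundaries0_def)
  next
    case (Suc q')
    then show ?thesis
      using group_hom.img_is_subgroup[OF d0_hom[of p q']] by (simp add: boundaries0_def)
  qed
qed

lemma K0_comm: "comm_group (K0 p q)"
  by (rule comm_group.subgroup_comm_group[OF E0_comm kernel_subgroup])

lemma E1_comm: "comm_group (E1 A V p q)"
  unfolding E1_def by (rule comm_group.abelian_FactGroup[OF K0_comm boundaries_subgroup])

definition cls :: "nat \<Rightarrow> nat \<Rightarrow> ('m, 'e) form \<Rightarrow> ('m, 'e) form set set"
  where "cls p q \<omega> = boundaries0 A V p q #>\<^bsub>E0 A V p q\<^esub> e0 p q \<omega>"

lemma E1_carrier: "carrier (E1 A V p q) = cls p q ` Z1 p q"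
  by (simp add: E1_def carrier_FactGroup kernel_eq_Suc r_coset_carrier_update cls_def[abs_def] image_image)

lemma E1_one: "\<one>\<^bsub>E1 A V p q\<^esub> = boundaries0 A V p q"
  by (simp add: E1_def)

lemma Z1_filt: "\<omega> \<in> Z1 p q \<Longrightarrow> \<omega> \<in> filt A V p (p + q)"
  by (simp add: Z1_def)

lemma Z1_add: "\<alpha> \<in> Z1 p q \<Longrightarrow> \<beta> \<in> Z1 p q \<Longrightarrow> \<alpha> \<oplus>\<^sub>f \<beta> \<in> Z1 p q"
  unfolding Z1_def using filt_add ext_d_sum by auto

lemma Z1_filt_Suc: "\<omega> \<in> filt A V (p + 1) (p + q) \<Longrightarrow> \<omega> \<in> Z1 p q"
  unfolding Z1_def using filt_Suc ext_d_filt by auto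

lemma cls_add:
  assumes "\<alpha> \<in> Z1 p q" "\<beta> \<in> Z1 p q"
  shows "cls p q \<alpha> \<otimes>\<^bsub>E1 A V p q\<^esub> cls p q \<beta> = cls p q (\<alpha> \<oplus>\<^sub>f \<beta>)"
proof -
  have "e0 p q \<alpha> \<in> carrier (K0 p q)" "e0 p q \<beta> \<in> carrier (K0 p q)"
    using assms by (simp_all add: kernel_eq_Suc)
  from comm_group.coset_sum[OF K0_comm boundaries_subgroup this]
  show ?thesis
    by (simp add: E1_def cls_def r_coset_carrier_update e0_add[OF assms[THEN Z1_filt]])
qed

lemma cls_absorb_B:
  assumes \<beta>: "\<beta> \<in> B1 p q" and \<omega>: "\<omega> \<in> Z1 p q"
  shows "cls p q (\<beta> \<oplus>\<^sub>f \<omega>) = cls p q \<omega>"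
proof -
  have "e0 p q \<beta> \<in> boundaries0 A V p q" "e0 p q \<omega> \<in> carrier (K0 p q)"
    using \<beta> \<omega> by (simp_all add: boundaries_eq kernel_eq_Suc)
  from group.coset_absorb[OF comm_group.axioms(2)[OF K0_comm] boundaries_subgroup this]
  have "cls p q \<omega> = boundaries0 A V p q #>\<^bsub>E0 A V p q\<^esub> (e0 p q \<beta> \<otimes>\<^bsub>E0 A V p q\<^esub> e0 p q \<omega>)"
    by (simp add: cls_def r_coset_carrier_update)
  moreover have "\<beta> \<in> filt A V p (p + q)"
    using \<beta> B1_subset_Z1 Z1_filt by blast
  ultimately show ?thesis
    by (simp add: cls_def e0_add[OF _ Z1_filt[OF \<omega>]])
qed

lemma cls_absorb_F:
  "\<epsilon> \<in> filt A V (p + 1) (p + q) \<Longrightarrow> \<omega> \<in> Z1 p q \<Longrightarrow> cls p q (\<epsilon> \<oplus>\<^sub>f \<omega>) = cls p q \<omega>"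
  unfolding cls_def using e0_absorb Z1_filt by simp

lemma cls_zero:
  assumes "\<omega> \<in> filt A V (p + 1) (p + q)"
  shows "cls p q \<omega> = \<one>\<^bsub>E1 A V p q\<^esub>"
proof -
  have "e0 p q \<omega> = \<one>\<^bsub>K0 p q\<^esub>"
    using e0_one_iff[of \<omega> p q] assms filt_Suc by simp
  moreover have "boundaries0 A V p q #>\<^bsub>K0 p q\<^esub> \<one>\<^bsub>K0 p q\<^esub> = boundaries0 A V p q"
    using group.coset_mult_one[OF comm_group.axioms(2)[OF K0_comm] subgroup.subset[OF boundaries_subgroup]] .
  ultimately show ?thesis
    by (simp add: cls_def E1_one r_coset_carrier_update)
qed

lemma cls_elem: "X \<in> cls p q \<omega> \<Longrightarrow> \<omega> \<in> filt A V p (p + q) \<Longrightarrow> \<exists>\<beta>\<in>B1 p q. X = e0 p q (\<beta> \<oplus>\<^sub>f \<omega>)"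
  unfolding cls_def r_coset_def boundaries_eq
  using e0_add B1_subset_Z1 Z1_filt by (auto simp: subset_iff)

lemma cls_nonempty: "cls p q \<omega> \<noteq> {}"
  using subgroup.one_closed[OF boundaries_subgroup] by (auto simp: cls_def r_coset_def)

section \<open>The cup product computed on representatives\<close>

lemma wedge_add_left: "wedge r s (\<alpha> \<oplus>\<^sub>f \<alpha>') \<beta> = wedge r s \<alpha> \<beta> \<oplus>\<^sub>f wedge r s \<alpha>' \<beta>"
  and wedge_add_right: "wedge r s \<alpha> (\<beta> \<oplus>\<^sub>f \<beta>') = wedge r s \<alpha> \<beta> \<oplus>\<^sub>f wedge r s \<alpha> \<beta>'"
  by (simp_all add: fun_eq_iff wedge_at distrib_left distrib_right Alt_add add_divide_distrib)

lemma wedge_filt':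
  assumes "\<alpha> \<in> filt A V p (p0 + q)" "\<beta> \<in> filt A V p' (p0' + q')"
  shows "wedge (p0 + q) (p0' + q') \<alpha> \<beta> \<in> filt A V (p + p') (p0 + p0' + (q + q'))"
  using wedge_filt[OF assms] by (simp add: ac_simps)

lemma e0_wedge:
  assumes \<alpha>: "\<alpha> \<in> filt A V p (p + q)" and \<beta>: "\<beta> \<in> filt A V p' (p' + q')"
  shows "cup0 A V p q p' q' (e0 p q \<alpha>) (e0 p' q' \<beta>) = e0 (p + p') (q + q') (wedge (p + q) (p' + q') \<alpha> \<beta>)"
  unfolding cup0_def
proof (intro UNION_const e0_nonempty)
  fix \<alpha>' \<beta>' assume "\<alpha>' \<in> e0 p q \<alpha>" "\<beta>' \<in> e0 p' q' \<beta>"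
  then obtain \<epsilon> \<epsilon>' where \<epsilon>: "\<epsilon> \<in> filt A V (p + 1) (p + q)" "\<alpha>' = \<epsilon> \<oplus>\<^sub>f \<alpha>"
    and \<epsilon>': "\<epsilon>' \<in> filt A V (p' + 1) (p' + q')" "\<beta>' = \<epsilon>' \<oplus>\<^sub>f \<beta>"
    unfolding e0_elem by blast
  let ?w = "wedge (p + q) (p' + q')"
  have \<beta>': "\<beta>' \<in> filt A V p' (p' + q')"
    unfolding \<epsilon>'(2) using \<epsilon>'(1) \<beta> by (intro filt_add) (auto intro: filt_Suc)
  have "?w \<alpha>' \<beta>' = ?w \<epsilon> \<beta>' \<oplus>\<^sub>f ?w \<alpha> \<beta>'"
    unfolding \<epsilon>(2) by (rule wedge_add_left)
  also have "?w \<alpha> \<beta>' = ?w \<alpha> \<epsilon>' \<oplus>\<^sub>f ?w \<alpha> \<beta>"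
    unfolding \<epsilon>'(2) by (rule wedge_add_right)
  finally have eq: "?w \<alpha>' \<beta>' = (?w \<epsilon> \<beta>' \<oplus>\<^sub>f ?w \<alpha> \<epsilon>') \<oplus>\<^sub>f ?w \<alpha> \<beta>"
    by (simp add: add.assoc)
  have "?w \<epsilon> \<beta>' \<in> filt A V (p + p' + 1) (p + p' + (q + q'))" "?w \<alpha> \<epsilon>' \<in> filt A V (p + p' + 1) (p + p' + (q + q'))"
    using wedge_filt'[OF \<epsilon>(1) \<beta>'] wedge_filt'[OF \<alpha> \<epsilon>'(1)] by (simp_all add: ac_simps)
  from e0_absorb[OF filt_add[OF this] wedge_filt'[OF \<alpha> \<beta>]]
  show "filt A V (p + p' + 1) (p + p' + (q + q')) #>\<^bsub>filt_group A V (p + p') (p + p' + (q + q'))\<^esub> ?w \<alpha>' \<beta>'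
    = e0 (p + p') (q + q') (?w \<alpha> \<beta>)"
    unfolding eq e0_def .
qed

lemma ext_d_wedge_form:
  assumes "\<alpha> \<in> forms A r" "\<beta> \<in> forms A s"
  shows "ext_d A (r + s) (wedge r s \<alpha> \<beta>) =
    wedge (Suc r) s (ext_d A r \<alpha>) \<beta> \<oplus>\<^sub>f fscale ((-1) ^ r) (wedge r (Suc s) \<alpha> (ext_d A s \<beta>))"
  using ext_d_wedge[OF assms] by (intro ext)

lemma wedge_Z1:
  assumes \<alpha>: "\<alpha> \<in> Z1 p q" and \<beta>: "\<beta> \<in> Z1 p' q'"
  shows "wedge (p + q) (p' + q') \<alpha> \<beta> \<in> Z1 (p + p') (q + q')"
proof -
  have \<alpha>': "\<alpha> \<in> filt A V p (p + q)" "ext_d A (p + q) \<alpha> \<in> filt A V (p + 1) (Suc (p + q))"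
    and \<beta>': "\<beta> \<in> filt A V p' (p' + q')" "ext_d A (p' + q') \<beta> \<in> filt A V (p' + 1) (Suc (p' + q'))"
    using \<alpha> \<beta> by (simp_all add: Z1_def)
  have deg: "p + q + (p' + q') = p + p' + (q + q')"
    by simp
  have "wedge (Suc (p + q)) (p' + q') (ext_d A (p + q) \<alpha>) \<beta> \<in> filt A V (p + p' + 1) (p + p' + (q + q' + 1))"
    "wedge (p + q) (Suc (p' + q')) \<alpha> (ext_d A (p' + q') \<beta>) \<in> filt A V (p + p' + 1) (p + p' + (q + q' + 1))"
    using wedge_filt[OF \<alpha>'(2) \<beta>'(1)] wedge_filt[OF \<alpha>'(1) \<beta>'(2)] by (simp_all add: ac_simps)
  from filt_add[OF this(1) filt_scale[OF this(2), of "(-1) ^ (p + q)"]]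
  have "ext_d A (p + q + (p' + q')) (wedge (p + q) (p' + q') \<alpha> \<beta>) \<in> filt A V (p + p' + 1) (p + p' + (q + q' + 1))"
    unfolding ext_d_wedge_form[OF filt_forms[OF \<alpha>'(1)] filt_forms[OF \<beta>'(1)]] .
  then show ?thesis
    unfolding Z1_def using wedge_filt'[OF \<alpha>'(1) \<beta>'(1)] deg by simp
qed

text \<open>If \<open>\<beta>\<close> is d \<open>\<eta>\<close>, the product is d of the product of
  \<open>\<eta>\<close> and \<open>\<alpha>\<close>, up to a sign times the product of
  \<open>\<eta>\<close> with d \<open>\<alpha>\<close>. The latter lies only in the next step,
  because \<open>\<alpha>\<close> is a cycle modulo the filtration; this is the summand
  \<open>\<epsilon>\<close>.\<close>

lemma wedge_B1_left:
  assumes \<beta>: "\<beta> \<in> B1 p q" and \<alpha>: "\<alpha> \<in> Z1 p' q'"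
  shows "\<exists>\<gamma>\<in>B1 (p + p') (q + q'). \<exists>\<epsilon>\<in>filt A V (p + p' + 1) (p + p' + (q + q')).
    wedge (p + q) (p' + q') \<beta> \<alpha> = \<gamma> \<oplus>\<^sub>f \<epsilon>"
proof (cases q)
  case 0
  have "wedge (p + q) (p' + q') fzero \<alpha> = fzero"
    by (simp add: fun_eq_iff wedge_at Alt_def)
  moreover have "fzero \<in> B1 (p + p') (q + q')"
    unfolding B1_def using filt_0 ext_d_zero by (auto intro!: image_eqI[of _ _ fzero])
  ultimately show ?thesis
    using \<beta> 0 filt_0 by (intro bexI[of _ fzero]) (auto simp: B1_def)
next
  case (Suc k)
  then obtain \<eta> where \<eta>: "\<eta> \<in> filt A V p (p + k)" "\<beta> = ext_d A (p + k) \<eta>"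
    using \<beta> by (auto simp: B1_def)
  have \<alpha>': "\<alpha> \<in> filt A V p' (p' + q')" "ext_d A (p' + q') \<alpha> \<in> filt A V (p' + 1) (Suc (p' + q'))"
    using \<alpha> by (simp_all add: Z1_def)
  let ?\<epsilon> = "fscale (- ((-1) ^ (p + k))) (wedge (p + k) (Suc (p' + q')) \<eta> (ext_d A (p' + q') \<alpha>))"
  let ?\<gamma> = "ext_d A (p + k + (p' + q')) (wedge (p + k) (p' + q') \<eta> \<alpha>)"
  have "wedge (p + q) (p' + q') \<beta> \<alpha> = ?\<gamma> \<oplus>\<^sub>f ?\<epsilon>"
    unfolding ext_d_wedge_form[OF filt_forms[OF \<eta>(1)] filt_forms[OF \<alpha>'(1)]]
    by (simp add: fun_eq_iff Suc \<eta>(2))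
  moreover have "?\<epsilon> \<in> filt A V (p + p' + 1) (p + p' + (q + q'))"
    using filt_scale[OF wedge_filt[OF \<eta>(1) \<alpha>'(2)], of "- ((-1) ^ (p + k))"] by (simp add: Suc ac_simps)
  moreover have "?\<gamma> \<in> B1 (p + p') (q + q')"
    unfolding B1_def using wedge_filt'[OF \<eta>(1) \<alpha>'(1)]
    by (auto simp: Suc ac_simps intro!: image_eqI[of _ _ "wedge (p + k) (p' + q') \<eta> \<alpha>"])
  ultimately show ?thesis
    by (intro bexI[of _ ?\<gamma>] bexI[of _ ?\<epsilon>])
qed

lemma wedge_B1_right:
  assumes \<alpha>: "\<alpha> \<in> Z1 p q" and \<beta>: "\<beta> \<in> B1 p' q'"
  shows "\<exists>\<gamma>\<in>B1 (p + p') (q + q'). \<exists>\<epsilon>\<in>filt A V (p + p' + 1) (p + p' + (q + q')).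
    wedge (p + q) (p' + q') \<alpha> \<beta> = \<gamma> \<oplus>\<^sub>f \<epsilon>"
proof (cases q')
  case 0
  have "wedge (p + q) (p' + q') \<alpha> fzero = fzero"
    by (simp add: fun_eq_iff wedge_at Alt_def)
  moreover have "fzero \<in> B1 (p + p') (q + q')"
    unfolding B1_def using filt_0 ext_d_zero by (auto intro!: image_eqI[of _ _ fzero])
  ultimately show ?thesis
    using \<beta> 0 filt_0 by (intro bexI[of _ fzero]) (auto simp: B1_def)
next
  case (Suc k)
  then obtain \<eta> where \<eta>: "\<eta> \<in> filt A V p' (p' + k)" "\<beta> = ext_d A (p' + k) \<eta>"
    using \<beta> by (auto simp: B1_def)
  have \<alpha>': "\<alpha> \<in> filt A V p (p + q)" "ext_d A (p + q) \<alpha> \<in> filt A V (p + 1) (Suc (p + q))"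
    using \<alpha> by (simp_all add: Z1_def)
  let ?s = "(-1) ^ (p + q) :: real"
  \<comment> \<open>The sign of the product rule is put inside d, so that \<open>?\<gamma>\<close>
    is literally the derivative of a form.\<close>
  let ?\<zeta> = "fscale ?s (wedge (p + q) (p' + k) \<alpha> \<eta>)"
  let ?\<epsilon> = "fscale (- ?s) (wedge (Suc (p + q)) (p' + k) (ext_d A (p + q) \<alpha>) \<eta>)"
  let ?\<gamma> = "ext_d A (p + q + (p' + k)) ?\<zeta>"
  have w: "wedge (p + q) (p' + k) \<alpha> \<eta> \<in> forms A (p + q + (p' + k))"
    by (rule wedge_forms[OF filt_forms[OF \<alpha>'(1)] filt_forms[OF \<eta>(1)]])
  have "?s * ?s = 1"
    by (simp flip: power_mult_distrib)
  then have ss: "?s * (?s * x) = x" for x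
    by (simp flip: mult.assoc)
  have "wedge (p + q) (p' + q') \<alpha> \<beta> = ?\<gamma> \<oplus>\<^sub>f ?\<epsilon>"
    unfolding ext_d_scale[OF w] ext_d_wedge_form[OF filt_forms[OF \<alpha>'(1)] filt_forms[OF \<eta>(1)]]
    by (intro ext) (simp only: Suc \<eta>(2) distrib_left ss, simp)
  moreover have "?\<epsilon> \<in> filt A V (p + p' + 1) (p + p' + (q + q'))"
    using filt_scale[OF wedge_filt[OF \<alpha>'(2) \<eta>(1)], of "- ?s"] by (simp add: Suc ac_simps)
  moreover have "?\<gamma> \<in> B1 (p + p') (q + q')"
    unfolding B1_def using filt_scale[OF wedge_filt'[OF \<alpha>'(1) \<eta>(1)], of ?s]
    by (auto simp: Suc ac_simps intro!: image_eqI[of _ _ ?\<zeta>])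
  ultimately show ?thesis
    by (intro bexI[of _ ?\<gamma>] bexI[of _ ?\<epsilon>])
qed

lemma cls_absorb:
  assumes "\<beta> \<in> B1 p q" "\<epsilon> \<in> filt A V (p + 1) (p + q)" "\<omega> \<in> Z1 p q"
  shows "cls p q ((\<beta> \<oplus>\<^sub>f \<epsilon>) \<oplus>\<^sub>f \<omega>) = cls p q \<omega>"
proof -
  have "(\<beta> \<oplus>\<^sub>f \<epsilon>) \<oplus>\<^sub>f \<omega> = \<beta> \<oplus>\<^sub>f (\<epsilon> \<oplus>\<^sub>f \<omega>)"
    by (simp add: add.assoc)
  moreover have "cls p q (\<beta> \<oplus>\<^sub>f (\<epsilon> \<oplus>\<^sub>f \<omega>)) = cls p q (\<epsilon> \<oplus>\<^sub>f \<omega>)"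
    by (rule cls_absorb_B[OF assms(1) Z1_add[OF Z1_filt_Suc[OF assms(2)] assms(3)]])
  ultimately show ?thesis
    using cls_absorb_F[OF assms(2,3)] by simp
qed

text \<open>Changing the representatives by boundaries alters the product by boundaries and terms of
  the next step, neither of which affects the class.\<close>

lemma cls_wedge:
  assumes \<alpha>: "\<alpha> \<in> Z1 p q" and \<beta>: "\<beta> \<in> Z1 p' q'"
  shows "cup1 A V p q p' q' (cls p q \<alpha>) (cls p' q' \<beta>) = cls (p + p') (q + q') (wedge (p + q) (p' + q') \<alpha> \<beta>)"
  unfolding cup1_def
proof (intro UNION_const cls_nonempty)
  let ?w = "wedge (p + q) (p' + q')"
  fix X Y assume "X \<in> cls p q \<alpha>" "Y \<in> cls p' q' \<beta>"
  then obtain \<delta> \<delta>' where \<delta>: "\<delta> \<in> B1 p q" "X = e0 p q (\<delta> \<oplus>\<^sub>f \<alpha>)" and \<delta>': "\<delta>' \<in> B1 p' q'" "Y = e0 p' q' (\<delta>' \<oplus>\<^sub>f \<beta>)"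
    using cls_elem[OF _ Z1_filt] \<alpha> \<beta> by meson
  have \<alpha>': "\<delta> \<oplus>\<^sub>f \<alpha> \<in> Z1 p q" and \<beta>': "\<delta>' \<oplus>\<^sub>f \<beta> \<in> Z1 p' q'"
    using \<delta>(1) \<delta>'(1) \<alpha> \<beta> B1_subset_Z1 by (auto intro!: Z1_add)
  obtain \<gamma> \<epsilon> where 1: "\<gamma> \<in> B1 (p + p') (q + q')" "\<epsilon> \<in> filt A V (p + p' + 1) (p + p' + (q + q'))"
    "?w \<delta> (\<delta>' \<oplus>\<^sub>f \<beta>) = \<gamma> \<oplus>\<^sub>f \<epsilon>"
    using wedge_B1_left[OF \<delta>(1) \<beta>'] by blast
  obtain \<gamma>' \<epsilon>' where 2: "\<gamma>' \<in> B1 (p + p') (q + q')" "\<epsilon>' \<in> filt A V (p + p' + 1) (p + p' + (q + q'))"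
    "?w \<alpha> \<delta>' = \<gamma>' \<oplus>\<^sub>f \<epsilon>'"
    using wedge_B1_right[OF \<alpha> \<delta>'(1)] by blast
  have "boundaries0 A V (p + p') (q + q') #>\<^bsub>E0 A V (p + p') (q + q')\<^esub> cup0 A V p q p' q' X Y
    = cls (p + p') (q + q') (?w (\<delta> \<oplus>\<^sub>f \<alpha>) (\<delta>' \<oplus>\<^sub>f \<beta>))"
    unfolding \<delta>(2) \<delta>'(2) e0_wedge[OF Z1_filt[OF \<alpha>'] Z1_filt[OF \<beta>']] cls_def ..
  also have "?w (\<delta> \<oplus>\<^sub>f \<alpha>) (\<delta>' \<oplus>\<^sub>f \<beta>) = ?w \<delta> (\<delta>' \<oplus>\<^sub>f \<beta>) \<oplus>\<^sub>f (?w \<alpha> \<delta>' \<oplus>\<^sub>f ?w \<alpha> \<beta>)"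
    by (subst wedge_add_left, subst (2) wedge_add_right) (rule refl)
  also have "cls (p + p') (q + q') \<dots> = cls (p + p') (q + q') (?w \<alpha> \<delta>' \<oplus>\<^sub>f ?w \<alpha> \<beta>)"
    unfolding 1(3)
  proof (rule cls_absorb[OF 1(1,2)])
    have "?w \<alpha> \<delta>' \<in> Z1 (p + p') (q + q')"
      using wedge_Z1[OF \<alpha>] \<delta>'(1) B1_subset_Z1 by blast
    then show "?w \<alpha> \<delta>' \<oplus>\<^sub>f ?w \<alpha> \<beta> \<in> Z1 (p + p') (q + q')"
      by (rule Z1_add[OF _ wedge_Z1[OF \<alpha> \<beta>]])
  qed
  also have "\<dots> = cls (p + p') (q + q') (?w \<alpha> \<beta>)"
    unfolding 2(3) by (rule cls_absorb[OF 2(1,2) wedge_Z1[OF \<alpha> \<beta>]])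
  finally show "boundaries0 A V (p + p') (q + q') #>\<^bsub>E0 A V (p + p') (q + q')\<^esub> cup0 A V p q p' q' X Y
    = cls (p + p') (q + q') (?w \<alpha> \<beta>)" .
qed

text \<open>The classes that die on \<open>C\<close>. The condition is imposed at points rather than
  on neighbourhoods, which suffices because the filtration is a pointwise notion, and which lets the
  sets C simply unite in a product.\<close>

definition J1 :: "'m set \<Rightarrow> nat \<Rightarrow> nat \<Rightarrow> ('m, 'e) form set set set"
  where "J1 C p q = cls p q ` {\<omega> \<in> Z1 p q. \<forall>x\<in>C. \<forall>c\<in>A. x \<in> chart_dom c \<longrightarrow> fvan (Suc p) (p + q) (\<omega> c x)}"

lemma J1_carrier: "J1 C p q \<subseteq> carrier (E1 A V p q)"
  unfolding J1_def E1_carrier by blast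

lemma J1_empty: "J1 {} p q = carrier (E1 A V p q)"
  unfolding J1_def E1_carrier by simp

lemma J1_one: "\<one>\<^bsub>E1 A V p q\<^esub> \<in> J1 C p q"
  unfolding J1_def using cls_zero[OF filt_0] Z1_filt_Suc[OF filt_0] fvan_0
  by (intro image_eqI[of _ _ fzero]) simp_all

lemma J1_mult:
  assumes "a \<in> J1 C p q" "b \<in> J1 C p q"
  shows "a \<otimes>\<^bsub>E1 A V p q\<^esub> b \<in> J1 C p q"
proof -
  obtain \<alpha> \<beta> where \<alpha>: "\<alpha> \<in> Z1 p q" "\<forall>x\<in>C. \<forall>c\<in>A. x \<in> chart_dom c \<longrightarrow> fvan (Suc p) (p + q) (\<alpha> c x)" "a = cls p q \<alpha>"
    and \<beta>: "\<beta> \<in> Z1 p q" "\<forall>x\<in>C. \<forall>c\<in>A. x \<in> chart_dom c \<longrightarrow> fvan (Suc p) (p + q) (\<beta> c x)" "b = cls p q \<beta>"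
    using assms unfolding J1_def by blast
  show ?thesis
    unfolding \<alpha>(3) \<beta>(3) cls_add[OF \<alpha>(1) \<beta>(1)] J1_def
    using Z1_add[OF \<alpha>(1) \<beta>(1)] \<alpha>(2) \<beta>(2) fvan_add by (intro imageI) blast
qed

lemma J1_manifold:
  assumes "manifold_set A \<subseteq> C" "a \<in> J1 C p q"
  shows "a = \<one>\<^bsub>E1 A V p q\<^esub>"
proof -
  obtain \<omega> where \<omega>: "\<omega> \<in> Z1 p q" "\<forall>x\<in>C. \<forall>c\<in>A. x \<in> chart_dom c \<longrightarrow> fvan (Suc p) (p + q) (\<omega> c x)" "a = cls p q \<omega>"
    using assms(2) unfolding J1_def by blast
  have "\<omega> \<in> filt A V (p + 1) (p + q)"
  proof (rule filtI[OF filt_forms[OF Z1_filt[OF \<omega>(1)]]])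
    fix c x assume c: "c \<in> A" "x \<in> chart_dom c"
    then have "x \<in> C"
      using assms(1) by (auto simp: manifold_set_def)
    then show "fvan (p + 1) (p + q) (\<omega> c x)"
      using \<omega>(2) c by simp
  qed
  then show ?thesis
    unfolding \<omega>(3) by (rule cls_zero)
qed

text \<open>At a point of \<open>C\<close> the first factor supplies the additional filtration step,
  at a point of \<open>C'\<close> the second; the filtration degrees add up.\<close>

lemma J1_cup:
  assumes "a \<in> J1 C p q" "b \<in> J1 C' p' q'"
  shows "cup1 A V p q p' q' a b \<in> J1 (C \<union> C') (p + p') (q + q')"
proof -
  obtain \<alpha> \<beta> where \<alpha>: "\<alpha> \<in> Z1 p q" "\<forall>x\<in>C. \<forall>c\<in>A. x \<in> chart_dom c \<longrightarrow> fvan (Suc p) (p + q) (\<alpha> c x)" "a = cls p q \<alpha>"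
    and \<beta>: "\<beta> \<in> Z1 p' q'" "\<forall>x\<in>C'. \<forall>c\<in>A. x \<in> chart_dom c \<longrightarrow> fvan (Suc p') (p' + q') (\<beta> c x)" "b = cls p' q' \<beta>"
    using assms unfolding J1_def by blast
  have "fvan (Suc (p + p')) (p + p' + (q + q')) (wedge (p + q) (p' + q') \<alpha> \<beta> c x)"
    if x: "x \<in> C \<union> C'" "c \<in> A" "x \<in> chart_dom c" for c x
  proof (cases "x \<in> C")
    case True
    then show ?thesis
      using fvan_wedge[of "Suc p" "p + q" \<alpha> c x p' "p' + q'" \<beta>] \<alpha>(2) fvan_if_filt[OF Z1_filt[OF \<beta>(1)] x(2,3)] x
      by (simp add: ac_simps)
  next
    case False
    then have "fvan (Suc p') (p' + q') (\<beta> c x)"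
      using \<beta>(2) x by blast
    then show ?thesis
      using fvan_wedge[of p "p + q" \<alpha> c x "Suc p'" "p' + q'" \<beta>] fvan_if_filt[OF Z1_filt[OF \<alpha>(1)] x(2,3)]
      by (simp add: ac_simps)
  qed
  then show ?thesis
    unfolding \<alpha>(3) \<beta>(3) cls_wedge[OF \<alpha>(1) \<beta>(1)] J1_def
    using wedge_Z1[OF \<alpha>(1) \<beta>(1)] by (intro imageI) blast
qed

lemma J1_finprod:
  assumes "finite I" "\<And>i. i \<in> I \<Longrightarrow> f i \<in> J1 C p q"
  shows "finprod (E1 A V p q) f I \<in> J1 C p q"
  using assms
proof (induction I rule: finite_induct)
  case empty
  show ?case
    by (simp add: comm_monoid.finprod_empty[OF comm_group.axioms(1)[OF E1_comm]] J1_one)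
next
  case (insert i I)
  have "finprod (E1 A V p q) f (insert i I) = f i \<otimes>\<^bsub>E1 A V p q\<^esub> finprod (E1 A V p q) f I"
    using insert.prems insert.hyps J1_carrier
    by (intro comm_monoid.finprod_insert[OF comm_group.axioms(1)[OF E1_comm]]) blast+
  then show ?case
    using insert by (simp add: J1_mult)
qed

text \<open>Every term of the convolution sum lies in the same
  \<open>J1 (C \<union> C') p q\<close>, which is closed under sums. Hence elements of mixed
  bidegree need no separate treatment.\<close>

lemma J1_E1_cup:
  assumes a: "\<And>p q. a (p, q) \<in> J1 C p q" and b: "\<And>p q. b (p, q) \<in> J1 C' p q"
  shows "E1_cup A V a b (p, q) \<in> J1 (C \<union> C') p q"
proof -
  have "cup1 A V i j (p - i) (q - j) (a (i, j)) (b (p - i, q - j)) \<in> J1 (C \<union> C') p q" if "i \<le> p" "j \<le> q" for i j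
    using J1_cup[OF a[of i j] b[of "p - i" "q - j"]] that by simp
  then show ?thesis
    unfolding E1_cup_def by (auto intro!: J1_finprod)
qed

text \<open>The number \<open>m\<close> counts the factors already multiplied; factor number i is
  responsible for the set \<open>CC i\<close>.\<close>

lemma J1_foldl:
  assumes CC: "\<And>i a p q. a \<in> E1_pos A V \<Longrightarrow> a (p, q) \<in> J1 (CC i) p q"
    and "set ys \<subseteq> E1_pos A V" "\<And>p q. a (p, q) \<in> J1 (\<Union>i<m. CC i) p q"
  shows "foldl (E1_cup A V) a ys (p, q) \<in> J1 (\<Union>i<m + length ys. CC i) p q"
  using assms(2,3)
proof (induction ys arbitrary: a m)
  case (Cons y ys)
  have "E1_cup A V a y (p, q) \<in> J1 ((\<Union>i<m. CC i) \<union> CC m) p q" for p q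
    using Cons.prems CC by (intro J1_E1_cup) auto
  moreover have "(\<Union>i<m. CC i) \<union> CC m = (\<Union>i<Suc m. CC i)"
    by (auto simp: lessThan_Suc)
  ultimately have "foldl (E1_cup A V) (E1_cup A V a y) ys (p, q) \<in> J1 (\<Union>i<Suc m + length ys. CC i) p q"
    using Cons.prems(1) by (intro Cons.IH) auto
  then show ?case by simp
qed simp

lemma E1_pos_carrier: "a \<in> E1_pos A V \<Longrightarrow> a (p, q) \<in> carrier (E1 A V p q)"
proof -
  assume "a \<in> E1_pos A V"
  then have "a \<in> carrier (E1_total A V)"
    by (simp add: E1_pos_def)
  moreover have "carrier (E1_total A V) \<subseteq> (\<Pi>\<^sub>E i\<in>UNIV. carrier ((\<lambda>(p, q). E1 A V p q) i))"
    unfolding E1_total_def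
    by (subst carrier_sum_group) (auto simp: comm_group.axioms(2)[OF E1_comm] split: prod.splits)
  ultimately show "a (p, q) \<in> carrier (E1 A V p q)"
    by (force simp: PiE_iff)
qed

lemma J1_categorical:
  assumes U: "tangentially_categorical A V U"
    and \<phi>: "sm UNIV \<phi>" "\<And>x. x \<in> manifold_set A \<Longrightarrow> x \<notin> U \<Longrightarrow> \<exists>N. open N \<and> x \<in> N \<and> (\<forall>y\<in>N. \<phi> y = 0)"
    and a: "a \<in> E1_pos A V"
  shows "a (p, q) \<in> J1 {x \<in> U. \<exists>N. open N \<and> x \<in> N \<and> (\<forall>y\<in>N. \<phi> y = 1)} p q"
proof (cases q)
  \<comment> \<open>Positivity enters here: the components of tangential degree 0 are trivial, so
    there is nothing to kill.\<close>
  case 0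
  then show ?thesis
    using a J1_one by (simp add: E1_pos_def)
next
  case (Suc k)
  obtain H where H: "smooth_map (times_line (restrict_atlas A U)) A H" "\<forall>x\<in>U. H (x, 0) = x"
    "\<forall>L' \<in> leaves (restrict_atlas A U) V. \<exists>L \<in> leaves A V. H ` (L' \<times> UNIV) \<subseteq> L"
    "\<forall>L' \<in> leaves (restrict_atlas A U) V. \<exists>z. \<forall>x\<in>L'. H (x, 1) = z"
    using U unfolding tangentially_categorical_def by blast
  interpret tangential_homotopy A V U H
    by unfold_locales (use U H in \<open>auto simp: tangentially_categorical_def\<close>)
  obtain \<omega> where \<omega>: "\<omega> \<in> Z1 p q" "a (p, q) = cls p q \<omega>"
    using E1_pos_carrier[OF a, of p q] unfolding E1_carrier by blast
  have Z: "\<omega> \<in> filt A V p (Suc (p + k))" "ext_d A (Suc (p + k)) \<omega> \<in> filt A V (Suc p) (Suc (Suc (p + k)))"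
    using \<omega>(1) by (simp_all add: Z1_def Suc)
  obtain \<eta> where \<eta>: "\<eta> \<in> filt A V p (p + k)"
    "\<And>N c x. open N \<Longrightarrow> x \<in> N \<Longrightarrow> x \<in> U \<Longrightarrow> (\<And>y. y \<in> N \<Longrightarrow> \<phi> y = 1) \<Longrightarrow> c \<in> A \<Longrightarrow> x \<in> chart_dom c \<Longrightarrow>
       fvan (Suc p) (Suc (p + k)) (\<lambda>v. \<omega> c x v + ext_d A (p + k) \<eta> c x v)"
    by (rule filt_trivial_on_U[OF Z _ \<phi>]) auto
  let ?\<beta> = "ext_d A (p + k) \<eta>"
  have \<beta>: "?\<beta> \<in> B1 p q"
    using \<eta>(1) by (simp add: B1_def Suc)
  have "fvan (Suc p) (p + q) ((?\<beta> \<oplus>\<^sub>f \<omega>) c x)"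
    if "x \<in> U" "open N" "x \<in> N" "\<forall>y\<in>N. \<phi> y = 1" "c \<in> A" "x \<in> chart_dom c" for x N c
    using \<eta>(2)[OF that(2,3,1) _ that(5,6)] that(4) by (simp add: Suc add.commute)
  moreover have "?\<beta> \<oplus>\<^sub>f \<omega> \<in> Z1 p q"
    using \<beta> B1_subset_Z1 \<omega>(1) by (auto intro!: Z1_add)
  moreover have "a (p, q) = cls p q (?\<beta> \<oplus>\<^sub>f \<omega>)"
    using cls_absorb_B[OF \<beta> \<omega>(1)] \<omega>(2) by simp
  ultimately show ?thesis
    unfolding J1_def by (intro image_eqI[of _ _ "?\<beta> \<oplus>\<^sub>f \<omega>"]) auto
qed

lemma long_products_vanish:
  assumes U: "\<And>i. i \<le> k \<Longrightarrow> tangentially_categorical A V (U i)" "(\<Union>i\<le>k. U i) = manifold_set A"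
    and xs: "xs \<noteq> []" "set xs \<subseteq> E1_pos A V" "k < length xs"
  shows "foldl (E1_cup A V) (hd xs) (tl xs) = \<one>\<^bsub>E1_total A V\<^esub>"
proof -
  have op: "open (U i)" if "i \<le> k" for i
    using U(1)[OF that] by (simp add: tangentially_categorical_def)
  show ?thesis
  proof (rule cutoff_functions[of k U, OF op U(2)])
    fix \<phi> :: "nat \<Rightarrow> 'm \<Rightarrow> real"
    assume \<phi>: "\<And>i. sm UNIV (\<phi> i)"
      "\<And>i x. x \<in> manifold_set A \<Longrightarrow> x \<notin> U i \<Longrightarrow> \<exists>N. open N \<and> x \<in> N \<and> (\<forall>y\<in>N. \<phi> i y = 0)"
      "\<And>x. x \<in> manifold_set A \<Longrightarrow> \<exists>i\<le>k. \<exists>N. open N \<and> x \<in> N \<and> (\<forall>y\<in>N. \<phi> i y = 1)"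
    \<comment> \<open>A product may have more than k + 1 factors. The surplus ones get the empty
      set, on which every class dies.\<close>
    define CC where "CC i = (if i \<le> k then {x \<in> U i. \<exists>N. open N \<and> x \<in> N \<and> (\<forall>y\<in>N. \<phi> i y = 1)} else {})" for i
    have CC: "a (p, q) \<in> J1 (CC i) p q" if "a \<in> E1_pos A V" for a i p q
    proof (cases "i \<le> k")
      case True
      then show ?thesis
        using J1_categorical[OF U(1)[OF True] \<phi>(1,2) that] by (simp add: CC_def)
    next
      case False
      then show ?thesis
        using E1_pos_carrier[OF that] J1_empty by (simp add: CC_def)
    qed
    have cover: "manifold_set A \<subseteq> (\<Union>i<length xs. CC i)"
    proof
      fix x assume x: "x \<in> manifold_set A"
      then obtain i N where i: "i \<le> k" "open N" "x \<in> N" "\<forall>y\<in>N. \<phi> i y = 1"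
        using \<phi>(3) by blast
      have "x \<in> U i"
      proof (rule ccontr)
        assume "x \<notin> U i"
        from \<phi>(2)[OF x this] i(3,4) show False by auto
      qed
      then have "x \<in> CC i"
        using i by (auto simp: CC_def)
      then show "x \<in> (\<Union>i<length xs. CC i)"
        using i(1) xs(3) by (intro UN_I[of i]) auto
    qed
    obtain y ys where ys: "xs = y # ys"
      using xs(1) by (cases xs) auto
    have "foldl (E1_cup A V) y ys (p, q) \<in> J1 (\<Union>i<1 + length ys. CC i) p q" for p q
    proof (rule J1_foldl[of CC])
      show "a (p, q) \<in> J1 (CC i) p q" if "a \<in> E1_pos A V" for a i p q
        by (rule CC[OF that])
      show "set ys \<subseteq> E1_pos A V" "y (p, q) \<in> J1 (\<Union>i<1. CC i) p q" for p q
        using xs(2) ys CC by (auto simp: lessThan_Suc)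
    qed
    then have "foldl (E1_cup A V) y ys (p, q) = \<one>\<^bsub>E1 A V p q\<^esub>" for p q
      using J1_manifold[OF cover] ys by simp
    then show "foldl (E1_cup A V) (hd xs) (tl xs) = \<one>\<^bsub>E1_total A V\<^esub>"
      by (auto simp: ys E1_total_def fun_eq_iff)
  qed
qed

end

theorem theorem8p1:
  fixes A :: "('m::{second_countable_topology, t2_space}, 'e::{real_inner, heine_borel}) chart set"
    and V :: "'e set"
  assumes "foliated_atlas A V"
  shows "lcp (E1_cup A V) (\<one>\<^bsub>E1_total A V\<^esub>) (E1_pos A V) \<le> tangential_cat A V"
  unfolding tangential_cat_def lcp_def
proof (intro INF_greatest SUP_least)
  interpret foliation A V
    by unfold_locales (rule assms)
  fix k :: nat and xs
  assume k: "k \<in> {k. \<exists>U :: nat \<Rightarrow> 'm set. (\<forall>i\<le>k. tangentially_categorical A V (U i)) \<and> (\<Union>i\<le>k. U i) = manifold_set A}"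
    and "xs \<in> {xs. xs \<noteq> [] \<and> set xs \<subseteq> E1_pos A V \<and> foldl (E1_cup A V) (hd xs) (tl xs) \<noteq> \<one>\<^bsub>E1_total A V\<^esub>}"
  then have xs: "xs \<noteq> []" "set xs \<subseteq> E1_pos A V" "foldl (E1_cup A V) (hd xs) (tl xs) \<noteq> \<one>\<^bsub>E1_total A V\<^esub>"
    by simp_all
  obtain U where U: "\<forall>i\<le>k. tangentially_categorical A V (U i)" "(\<Union>i\<le>k. U i) = manifold_set A"
    using k by blast
  \<comment> \<open>A covering by k + 1 categorical sets kills all products of more than k factors,
    so a nonzero product has at most k of them.\<close>
  have "\<not> k < length xs"
    using long_products_vanish[OF _ U(2) xs(1,2)] U(1) xs(3) by auto
  then show "enat (length xs) \<le> enat k"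
    by simp
qed

end
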